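(* Let $(A,\mathcal{C})$ be a crossed monoid over a small category $\mathcal{C}$. Then the simplicial set $N(A,\mathcal{C})$ is $4$-coskeletal.
   Context: Coskeletality. For a simplicial set $X$, let $\mathrm{tr}^n$ be the truncation functor from simplicial sets to $n$-truncated simplicial sets, $\mathrm{cosk}^n$ its right adjoint, and $\mathbf{Cosk}^n=\mathrm{cosk}^n\mathrm{tr}^n$. $X$ is $n$-coskeletal if the unit map $X\to\mathbf{Cosk}^nX$ is an isomorphism. Crossed monoids. $\mathcal{C}$ is a small category with object set $\mathcal{C}_0$ and morphism set $\mathcal{C}_1$; $\mathcal{C}(s,t)$ is the set of morphisms with source $s$ and target $t$, and $\alpha\beta$ means $\alpha$ after $\beta$. A crossed monoid $(A,\mathcal{C})$ over $\mathcal{C}$ is a contravariant functor $A$ from $\mathcal{C}$ to the category of monoids (for $\alpha\in\mathcal{C}(s,t)$ and $a\in A(t)$ write $a^\alpha:=A(\alpha)(a)\in A(s)$) together with monoid homomorphisms $\partial_t\colon A(t)\to\mathcal{C}(t,t)$, $t\in\mathcal{C}_0$, such that $\alpha\,\partial_s(a^\alpha)=\partial_t(a)\,\alpha$ and $ab=b\,a^{\partial_t b}$ for all $s,t\in\mathcal{C}_0$, $\alpha\in\mathcal{C}(s,t)$, $a,b\in A(t)$. The unit of $A(x)$ is $e_x$, the identity of $x$ is $1_x$; write $\partial$ for $\partial_t$. Nerve. The simplicial set $N(A,\mathcal{C})$ is as follows. $N_0(A,\mathcal{C})=\mathcal{C}_0$. For $n\ge1$, $N_n(A,\mathcal{C})$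 is the set of $n\times n$ upper triangular matrices $M=(m_{ij})_{1\le i\le j\le n}$ (entries below the diagonal are absent) for which there is a sequence $(x_0,\dots,x_n)$ of objects of $\mathcal{C}$ with $m_{jj}\in\mathcal{C}(x_j,x_{j-1})$ for $1\le j\le n$ and $m_{ij}\in A(x_i)$ for $1\le i<j\le n$. Thus $N_1(A,\mathcal{C})=\mathcal{C}_1$. Degeneracies: $s_0\colon N_0\to N_1$ is $p\mapsto 1_p$. For $n\ge1$, $M\in N_n$, $0\le j\le n$, $s_j(M)=M'\in N_{n+1}$ with: for $i\le j$: $m'_{ik}=m_{ik}$ if $k\le j$, $m'_{i,j+1}=e_{x_i}$, $m'_{ik}=m_{i,k-1}$ if $k>j+1$; $m'_{j+1,j+1}=1_{x_j}$ and $m'_{j+1,k}=e_{x_j}$ for $k>j+1$; for $i>j+1$: $m'_{ik}=m_{i-1,k-1}$. Faces: on $N_1$, $d_0$ is the source map and $d_1$ the target map. For $n\ge2$, $M\in N_n$, $d_j(M)=M'\in N_{n-1}$ with: for $j=0$: $m'_{ik}=m_{i+1,k+1}$; for $j=n$: $m'_{ik}=m_{ik}$; for $1\le j\le n-1$: if $i<j$ then $m'_{ik}=m_{ik}$ for $k<j$, $m'_{ij}=m_{ij}m_{i,j+1}$, $m'_{ik}=m_{i,k+1}$ for $k>j$; $m'_{jj}=m_{jj}\,\partial(m_{j,j+1})\,m_{j+1,j+1}$; $m'_{jk}=(m_{j,k+1})^{\eta_k}\,m_{j+1,k+1}$ for $k>j$, where $\eta_k=m_{j+1,j+1}\,\partial(m_{j+1,j+2}\cdots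 m_{j+1,k})$ (empty product being the unit, so $\eta_{j+1}=m_{j+1,j+1}$); and $m'_{ik}=m_{i+1,k+1}$ for $i>j$. *)

theory Defs
  imports "HOL-Algebra.Group" "HOL-Library.FuncSet" "HOL-Library.Multiset" "HOL-Library.Extended_Nat"
begin

hide_const (open) Multiset.mult

section \<open>Simplicial sets and truncated simplicial sets\<close>

text \<open>
  Face and degeneracy operators carry the dimension of the simplex they are applied to:
  \<open>face X k i\<close> is \<open>d\<^sub>i : X\<^sub>k \<rightarrow> X\<^sub>k\<^sub>-\<^sub>1\<close> and \<open>degen X k i\<close> is \<open>s\<^sub>i : X\<^sub>k \<rightarrow> X\<^sub>k\<^sub>+\<^sub>1\<close>.
  Their values outside \<open>cells X k\<close> are irrelevant.
\<close>

record 'a sset =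
  cells :: "nat \<Rightarrow> 'a set"
  face :: "nat \<Rightarrow> nat \<Rightarrow> 'a \<Rightarrow> 'a"
  degen :: "nat \<Rightarrow> nat \<Rightarrow> 'a \<Rightarrow> 'a"

text \<open>
  The bound \<open>N\<close> treats both cases at once: \<open>N = \<infinity>\<close> gives simplicial sets, and \<open>N = enat n\<close> gives
  \<open>n\<close>-truncated simplicial sets, where only the structure between dimensions \<open>\<le> n\<close> counts.
\<close>

definition simplicial_upto :: "enat \<Rightarrow> 'a sset \<Rightarrow> bool" where
  "simplicial_upto N X \<longleftrightarrow>
    (\<forall>k i x. enat k \<le> N \<and> 1 \<le> k \<and> i \<le> k \<and> x \<in> cells X k \<longrightarrow> face X k i x \<in> cells X (k - 1)) \<and>
    (\<forall>k i x. enat (Suc k) \<le> N \<and> i \<le> k \<and> x \<in> cells X k \<longrightarrow> degen X k i x \<in> cells X (Suc k)) \<and>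
    (\<forall>k i j x. enat k \<le> N \<and> 2 \<le> k \<and> i < j \<and> j \<le> k \<and> x \<in> cells X k \<longrightarrow>
       face X (k - 1) i (face X k j x) = face X (k - 1) (j - 1) (face X k i x)) \<and>
    (\<forall>k i j x. enat (Suc k) \<le> N \<and> i < j \<and> j \<le> k \<and> x \<in> cells X k \<longrightarrow>
       face X (Suc k) i (degen X k j x) = degen X (k - 1) (j - 1) (face X k i x)) \<and>
    (\<forall>k i j x. enat (Suc k) \<le> N \<and> j \<le> k \<and> (i = j \<or> i = Suc j) \<and> x \<in> cells X k \<longrightarrow>
       face X (Suc k) i (degen X k j x) = x) \<and>
    (\<forall>k i j x. enat (Suc k) \<le> N \<and> Suc j < i \<and> i \<le> Suc k \<and> x \<in> cells X k \<longrightarrow>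
       face X (Suc k) i (degen X k j x) = degen X (k - 1) j (face X k (i - 1) x)) \<and>
    (\<forall>k i j x. enat (Suc (Suc k)) \<le> N \<and> i \<le> j \<and> j \<le> k \<and> x \<in> cells X k \<longrightarrow>
       degen X (Suc k) i (degen X k j x) = degen X (Suc k) (Suc j) (degen X k i x))"

abbreviation simplicial_set :: "'a sset \<Rightarrow> bool" where
  "simplicial_set X \<equiv> simplicial_upto \<infinity> X"

abbreviation truncated_sset :: "nat \<Rightarrow> 'a sset \<Rightarrow> bool" where
  "truncated_sset n X \<equiv> simplicial_upto (enat n) X"

text \<open>
  Simplicial maps, as families of functions that are \<open>undefined\<close> off the cells, so that equality
  of maps is equality of HOL functions.
\<close>

definition smaps :: "enat \<Rightarrow> 'a sset \<Rightarrow> 'b sset \<Rightarrow> (nat \<Rightarrow> 'a \<Rightarrow> 'b) set" where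
  "smaps N X Y = {f.
    (\<forall>k. enat k \<le> N \<longrightarrow> f k \<in> cells X k \<rightarrow>\<^sub>E cells Y k) \<and>
    (\<forall>k. \<not> enat k \<le> N \<longrightarrow> f k = (\<lambda>_. undefined)) \<and>
    (\<forall>k i x. enat k \<le> N \<and> 1 \<le> k \<and> i \<le> k \<and> x \<in> cells X k \<longrightarrow>
       f (k - 1) (face X k i x) = face Y k i (f k x)) \<and>
    (\<forall>k i x. enat (Suc k) \<le> N \<and> i \<le> k \<and> x \<in> cells X k \<longrightarrow>
       f (Suc k) (degen X k i x) = degen Y k i (f k x))}"

definition sset_iso :: "'a sset \<Rightarrow> 'b sset \<Rightarrow> (nat \<Rightarrow> 'a \<Rightarrow> 'b) \<Rightarrow> bool" where
  "sset_iso X Y f \<longleftrightarrow> f \<in> smaps \<infinity> X Y \<and>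
    (\<exists>g \<in> smaps \<infinity> Y X. (\<forall>k. \<forall>x \<in> cells X k. g k (f k x) = x) \<and>
                        (\<forall>k. \<forall>y \<in> cells Y k. f k (g k y) = y))"

definition tr :: "nat \<Rightarrow> 'a sset \<Rightarrow> 'a sset" where
  "tr n X = X\<lparr>cells := \<lambda>k. if k \<le> n then cells X k else {}\<rparr>"

section \<open>The coskeleton\<close>

text \<open>
  A monotone map \<open>[k] \<rightarrow> [m]\<close> is encoded by the list of its \<open>k + 1\<close> values; this is a \<open>k\<close>-simplex of
  the standard simplex \<open>\<Delta>[m]\<close>.
\<close>

definition omit_nth :: "nat \<Rightarrow> 'a list \<Rightarrow> 'a list" where
  "omit_nth i l = take i l @ drop (Suc i) l"

definition repeat_nth :: "nat \<Rightarrow> 'a list \<Rightarrow> 'a list" where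
  "repeat_nth i l = take (Suc i) l @ drop i l"

definition std_simplex :: "nat \<Rightarrow> nat list sset" where
  "std_simplex m = \<lparr>
     cells = \<lambda>k. {l. length l = Suc k \<and> sorted l \<and> set l \<subseteq> {..m}},
     face = \<lambda>k i. omit_nth i,
     degen = \<lambda>k i. repeat_nth i\<rparr>"

definition coface :: "nat \<Rightarrow> nat \<Rightarrow> nat" where
  "coface j i = (if i < j then i else Suc i)"

definition codegen :: "nat \<Rightarrow> nat \<Rightarrow> nat" where
  "codegen j i = (if i \<le> j then i else i - 1)"

text \<open>
  The right adjoint of \<open>tr n\<close>: the \<open>m\<close>-simplices of \<open>cosk n Y\<close> are the maps of \<open>n\<close>-truncated
  simplicial sets \<open>tr n \<Delta>[m] \<rightarrow> Y\<close>, and the operators are precomposition with the cofaces and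
  codegeneracies.  The universal property is proved below (\<open>cosk_right_adjoint\<close>).
\<close>

definition precomp :: "nat \<Rightarrow> nat \<Rightarrow> (nat \<Rightarrow> nat) \<Rightarrow> (nat \<Rightarrow> nat list \<Rightarrow> 'a) \<Rightarrow> nat \<Rightarrow> nat list \<Rightarrow> 'a" where
  "precomp n m \<theta> f = (\<lambda>k. \<lambda>l \<in> cells (tr n (std_simplex m)) k. f k (map \<theta> l))"

definition cosk :: "nat \<Rightarrow> 'a sset \<Rightarrow> (nat \<Rightarrow> nat list \<Rightarrow> 'a) sset" where
  "cosk n Y = \<lparr>
     cells = \<lambda>m. smaps (enat n) (tr n (std_simplex m)) Y,
     face = \<lambda>m j. precomp n (m - 1) (coface j),
     degen = \<lambda>m j. precomp n (Suc m) (codegen j)\<rparr>"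

definition Cosk :: "nat \<Rightarrow> 'a sset \<Rightarrow> (nat \<Rightarrow> nat list \<Rightarrow> 'a) sset" where
  "Cosk n X = cosk n (tr n X)"

text \<open>
  The action \<open>X(\<theta>) : X\<^sub>m \<rightarrow> X\<^sub>k\<close> of a monotone map \<open>\<theta> : [k] \<rightarrow> [m]\<close>, by its epi-mono factorization
  \<open>\<theta> = \<delta>\<^sup>i\<^sup>1 \<cdots> \<delta>\<^sup>i\<^sup>s \<sigma>\<^sup>j\<^sup>1 \<cdots> \<sigma>\<^sup>j\<^sup>t\<close>: here \<open>i1 > \<dots> > is\<close> are the elements of \<open>[m]\<close> missed by \<open>\<theta>\<close>, and
  \<open>j1 < \<dots> < jt\<close> are the \<open>j\<close> with \<open>\<theta>(j) = \<theta>(j+1)\<close>.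
\<close>

fun faces_along :: "'a sset \<Rightarrow> nat \<Rightarrow> nat list \<Rightarrow> 'a \<Rightarrow> 'a" where
  "faces_along X m [] x = x"
| "faces_along X m (i # is) x = faces_along X (m - 1) is (face X m i x)"

fun degens_along :: "'a sset \<Rightarrow> nat \<Rightarrow> nat list \<Rightarrow> 'a \<Rightarrow> 'a" where
  "degens_along X m [] x = x"
| "degens_along X m (j # js) x = degens_along X (Suc m) js (degen X m j x)"

definition missed :: "nat \<Rightarrow> nat list \<Rightarrow> nat list" where
  "missed m l = rev (filter (\<lambda>i. i \<notin> set l) [0..<Suc m])"

definition repeats :: "nat list \<Rightarrow> nat list" where
  "repeats l = filter (\<lambda>j. l ! j = l ! Suc j) [0..<length l - 1]"

definition action :: "'a sset \<Rightarrow> nat \<Rightarrow> nat list \<Rightarrow> 'a \<Rightarrow> 'a" where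
  "action X m l x =
    degens_along X (m - length (missed m l)) (repeats l) (faces_along X m (missed m l) x)"

text \<open>
  The unit sends \<open>x \<in> X\<^sub>m\<close> to the truncation of the map \<open>\<Delta>[m] \<rightarrow> X\<close> corresponding to \<open>x\<close> under the
  Yoneda lemma.
\<close>

definition cosk_unit :: "nat \<Rightarrow> 'a sset \<Rightarrow> nat \<Rightarrow> 'a \<Rightarrow> nat \<Rightarrow> nat list \<Rightarrow> 'a" where
  "cosk_unit n X = (\<lambda>m. \<lambda>x \<in> cells X m. \<lambda>k. \<lambda>l \<in> cells (tr n (std_simplex m)) k. action X m l x)"

definition coskeletal :: "nat \<Rightarrow> 'a sset \<Rightarrow> bool" where
  "coskeletal n X \<longleftrightarrow> simplicial_set X \<and> sset_iso X (Cosk n X) (cosk_unit n X)"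

section \<open>Crossed monoids\<close>

record ('o, 'm) cat =
  Obj :: "'o set"
  Arr :: "'m set"
  src :: "'m \<Rightarrow> 'o"
  tgt :: "'m \<Rightarrow> 'o"
  ident :: "'o \<Rightarrow> 'm"
  cmp :: "'m \<Rightarrow> 'm \<Rightarrow> 'm"

definition arrows :: "('o, 'm) cat \<Rightarrow> 'o \<Rightarrow> 'o \<Rightarrow> 'm set" where
  "arrows C s t = {\<alpha> \<in> Arr C. src C \<alpha> = s \<and> tgt C \<alpha> = t}"

text \<open>\<open>cmp C \<alpha> \<beta>\<close> is \<open>\<alpha>\<close> after \<open>\<beta>\<close>.\<close>

locale small_category =
  fixes C :: "('o, 'm) cat"
  assumes src_in: "\<alpha> \<in> Arr C \<Longrightarrow> src C \<alpha> \<in> Obj C"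
    and tgt_in: "\<alpha> \<in> Arr C \<Longrightarrow> tgt C \<alpha> \<in> Obj C"
    and ident_in: "t \<in> Obj C \<Longrightarrow> ident C t \<in> arrows C t t"
    and cmp_in: "\<lbrakk>\<alpha> \<in> arrows C s t; \<beta> \<in> arrows C r s\<rbrakk> \<Longrightarrow> cmp C \<alpha> \<beta> \<in> arrows C r t"
    and cmp_assoc: "\<lbrakk>\<alpha> \<in> arrows C s t; \<beta> \<in> arrows C r s; \<gamma> \<in> arrows C q r\<rbrakk> \<Longrightarrow>
          cmp C (cmp C \<alpha> \<beta>) \<gamma> = cmp C \<alpha> (cmp C \<beta> \<gamma>)"
    and ident_left: "\<alpha> \<in> arrows C s t \<Longrightarrow> cmp C (ident C t) \<alpha> = \<alpha>"
    and ident_right: "\<alpha> \<in> arrows C s t \<Longrightarrow> cmp C \<alpha> (ident C s) = \<alpha>"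

definition End :: "('o, 'm) cat \<Rightarrow> 'o \<Rightarrow> 'm monoid" where
  "End C t = \<lparr>carrier = arrows C t t, mult = cmp C, one = ident C t\<rparr>"

text \<open>\<open>hom\<close> alone does not require preservation of the unit.\<close>

definition monoid_hom :: "'a monoid \<Rightarrow> 'b monoid \<Rightarrow> ('a \<Rightarrow> 'b) set" where
  "monoid_hom G H = {f \<in> hom G H. f \<one>\<^bsub>G\<^esub> = \<one>\<^bsub>H\<^esub>}"

text \<open>
  \<open>fib A t\<close> is the monoid \<open>A(t)\<close>, \<open>pull A \<alpha> a\<close> is \<open>a\<^sup>\<alpha>\<close> and \<open>bd A t a\<close> is \<open>\<partial>\<^sub>t a\<close>.  The carriers of the
  \<open>A(t)\<close> share a type but may overlap arbitrarily.
\<close>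

record ('o, 'm, 'a) crossed =
  fib :: "'o \<Rightarrow> 'a monoid"
  pull :: "'m \<Rightarrow> 'a \<Rightarrow> 'a"
  bd :: "'o \<Rightarrow> 'a \<Rightarrow> 'm"

locale crossed_monoid = small_category C
  for C :: "('o, 'm) cat" +
  fixes A :: "('o, 'm, 'a) crossed"
  assumes fib_monoid: "t \<in> Obj C \<Longrightarrow> monoid (fib A t)"
    and pull_hom: "\<alpha> \<in> arrows C s t \<Longrightarrow> pull A \<alpha> \<in> monoid_hom (fib A t) (fib A s)"
    and pull_ident: "\<lbrakk>t \<in> Obj C; a \<in> carrier (fib A t)\<rbrakk> \<Longrightarrow> pull A (ident C t) a = a"
    and pull_cmp: "\<lbrakk>\<alpha> \<in> arrows C s t; \<beta> \<in> arrows C r s; a \<in> carrier (fib A t)\<rbrakk> \<Longrightarrow>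
          pull A (cmp C \<alpha> \<beta>) a = pull A \<beta> (pull A \<alpha> a)"
    and bd_hom: "t \<in> Obj C \<Longrightarrow> bd A t \<in> monoid_hom (fib A t) (End C t)"
    and bd_pull: "\<lbrakk>\<alpha> \<in> arrows C s t; a \<in> carrier (fib A t)\<rbrakk> \<Longrightarrow>
          cmp C \<alpha> (bd A s (pull A \<alpha> a)) = cmp C (bd A t a) \<alpha>"
    and peiffer: "\<lbrakk>t \<in> Obj C; a \<in> carrier (fib A t); b \<in> carrier (fib A t)\<rbrakk> \<Longrightarrow>
          a \<otimes>\<^bsub>fib A t\<^esub> b = b \<otimes>\<^bsub>fib A t\<^esub> pull A (bd A t b) a"

section \<open>The nerve\<close>

text \<open>
  A simplex is an object (dimension 0) or an upper triangular matrix, split into its diagonal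
  \<open>D j = m\<^sub>j\<^sub>j\<close> (arrows) and its part \<open>U i k = m\<^sub>i\<^sub>k\<close> with \<open>i < k\<close> (monoid elements).  Indices start
  at 1, and \<open>mk_mat n\<close> makes the entries outside the range \<open>undefined\<close>.
\<close>

datatype ('o, 'm, 'a) ncell = Vertex 'o | Mat "nat \<Rightarrow> 'm" "nat \<Rightarrow> nat \<Rightarrow> 'a"

definition mk_mat :: "nat \<Rightarrow> (nat \<Rightarrow> 'm) \<Rightarrow> (nat \<Rightarrow> nat \<Rightarrow> 'a) \<Rightarrow> ('o, 'm, 'a) ncell" where
  "mk_mat n D U = Mat (\<lambda>j. if 1 \<le> j \<and> j \<le> n then D j else undefined)
                      (\<lambda>i k. if 1 \<le> i \<and> i < k \<and> k \<le> n then U i k else undefined)"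

definition nerve_cells :: "('o, 'm) cat \<Rightarrow> ('o, 'm, 'a) crossed \<Rightarrow> nat \<Rightarrow> ('o, 'm, 'a) ncell set" where
  "nerve_cells C A n = (if n = 0 then Vertex ` Obj C else
     {mk_mat n D U | D U. \<exists>x. (\<forall>i \<le> n. x i \<in> Obj C) \<and>
        (\<forall>j. 1 \<le> j \<and> j \<le> n \<longrightarrow> D j \<in> arrows C (x j) (x (j - 1))) \<and>
        (\<forall>i j. 1 \<le> i \<and> i < j \<and> j \<le> n \<longrightarrow> U i j \<in> carrier (fib A (x i)))})"

text \<open>The objects \<open>x\<^sub>0, \<dots>, x\<^sub>n\<close> belonging to a matrix (\<open>n \<ge> 1\<close>) are determined by its diagonal.\<close>

definition vert :: "('o, 'm) cat \<Rightarrow> (nat \<Rightarrow> 'm) \<Rightarrow> nat \<Rightarrow> 'o" where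
  "vert C D j = (if j = 0 then tgt C (D 1) else src C (D j))"

fun nerve_degen ::
  "('o, 'm) cat \<Rightarrow> ('o, 'm, 'a) crossed \<Rightarrow> nat \<Rightarrow> nat \<Rightarrow> ('o, 'm, 'a) ncell \<Rightarrow> ('o, 'm, 'a) ncell" where
  "nerve_degen C A n j (Vertex p) = mk_mat 1 (\<lambda>_. ident C p) undefined"
| "nerve_degen C A n j (Mat D U) = mk_mat (Suc n)
     (\<lambda>i. if i \<le> j then D i
          else if i = Suc j then ident C (vert C D j)
          else D (i - 1))
     (\<lambda>i k. if i \<le> j then
              (if k \<le> j then U i k
               else if k = Suc j then \<one>\<^bsub>fib A (vert C D i)\<^esub>
               else U i (k - 1))
            else if i = Suc j then \<one>\<^bsub>fib A (vert C D j)\<^esub>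
            else U (i - 1) (k - 1))"

definition eta ::
  "('o, 'm) cat \<Rightarrow> ('o, 'm, 'a) crossed \<Rightarrow> (nat \<Rightarrow> 'm) \<Rightarrow> (nat \<Rightarrow> nat \<Rightarrow> 'a) \<Rightarrow> nat \<Rightarrow> nat \<Rightarrow> 'm" where
  "eta C A D U j k = (let G = fib A (vert C D (Suc j)) in
     cmp C (D (Suc j))
       (bd A (vert C D (Suc j))
         (foldr (mult G) (map (U (Suc j)) [j + 2..<Suc k]) \<one>\<^bsub>G\<^esub>)))"

fun nerve_face ::
  "('o, 'm) cat \<Rightarrow> ('o, 'm, 'a) crossed \<Rightarrow> nat \<Rightarrow> nat \<Rightarrow> ('o, 'm, 'a) ncell \<Rightarrow> ('o, 'm, 'a) ncell" where
  "nerve_face C A n j (Vertex p) = undefined"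
| "nerve_face C A n j (Mat D U) =
    (if n = 1 then Vertex (if j = 0 then src C (D 1) else tgt C (D 1))
     else if j = 0 then mk_mat (n - 1) (\<lambda>i. D (Suc i)) (\<lambda>i k. U (Suc i) (Suc k))
     else if j = n then mk_mat (n - 1) D U
     else mk_mat (n - 1)
       (\<lambda>i. if i < j then D i
            else if i = j then cmp C (D j) (cmp C (bd A (vert C D j) (U j (Suc j))) (D (Suc j)))
            else D (Suc i))
       (\<lambda>i k. if i < j then
                (if k < j then U i k
                 else if k = j then U i j \<otimes>\<^bsub>fib A (vert C D i)\<^esub> U i (Suc j)
                 else U i (Suc k))
              else if i = j then
                pull A (eta C A D U j k) (U j (Suc k))
                  \<otimes>\<^bsub>fib A (vert C D (Suc j))\<^esub> U (Suc j) (Suc k)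
              else U (Suc i) (Suc k)))"

definition nerve :: "('o, 'm) cat \<Rightarrow> ('o, 'm, 'a) crossed \<Rightarrow> ('o, 'm, 'a) ncell sset" where
  "nerve C A = \<lparr>cells = nerve_cells C A, face = nerve_face C A, degen = nerve_degen C A\<rparr>"

section \<open>The adjunction between truncation and coskeleton\<close>

lemma repeats_Cons2: "repeats (a # b # l) = (if a = b then [0] else []) @ map Suc (repeats (b # l))"
proof -
  have e: "[0..<length (a # b # l) - 1] = 0 # map Suc [0..<length (b # l) - 1]"
    by (simp add: map_Suc_upt upt_conv_Cons del: upt_Suc)
  show ?thesis unfolding repeats_def e by (simp add: filter_map o_def)
qed

lemma card_repeats: "sorted l \<Longrightarrow> l \<noteq> [] \<Longrightarrow> card (set l) + length (repeats l) = length l"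
proof (induction l rule: induct_list012)
  case (3 a b l)
  then show ?case by (cases "a = b") (auto simp: repeats_Cons2 card_insert_if)
qed (simp_all add: repeats_def)

lemma set_repeats: "set (repeats l) = {j. Suc j < length l \<and> l ! j = l ! Suc j}"
  by (auto simp: repeats_def)

lemma strict_repeats: "sorted_wrt (<) (repeats l)"
  by (simp add: repeats_def sorted_wrt_filter)

lemma set_missed: "set (missed m l) = {..m} - set l"
  unfolding missed_def by (auto simp: less_Suc_eq_le simp del: upt_Suc)

lemma distinct_desc: "sorted_wrt (>) xs \<Longrightarrow> distinct (xs :: nat list)"
  by (induction xs) auto

lemma strict_missed: "sorted_wrt (>) (missed m l)"
  by (simp add: missed_def sorted_wrt_rev sorted_wrt_filter)

lemma length_missed:
  assumes "set l \<subseteq> {..m}"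
  shows "length (missed m l) + card (set l) = Suc m"
proof -
  have "distinct (missed m l)" by (simp add: missed_def)
  then have "length (missed m l) = card ({..m} - set l)"
    by (metis distinct_card set_missed)
  also have "\<dots> = Suc m - card (set l)" using assms by (simp add: card_Diff_subset)
  finally show ?thesis using card_mono[OF _ assms] by simp
qed

lemma desc_equal: "sorted_wrt (>) xs \<Longrightarrow> sorted_wrt (>) ys \<Longrightarrow> set xs = set ys \<Longrightarrow> xs = ys"
  for xs ys :: "nat list"
  using strict_sorted_equal[of "rev xs" "rev ys"] by (simp add: sorted_wrt_rev)

lemma in_std_simplex:
  "l \<in> cells (std_simplex m) k \<longleftrightarrow> length l = Suc k \<and> sorted l \<and> set l \<subseteq> {..m}"
  by (simp add: std_simplex_def)

lemma face_std_simplex [simp]: "face (std_simplex m) k i l = omit_nth i l"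
  by (simp add: std_simplex_def)

lemma degen_std_simplex [simp]: "degen (std_simplex m) k i l = repeat_nth i l"
  by (simp add: std_simplex_def)

lemma length_omit [simp]: "i < length l \<Longrightarrow> length (omit_nth i l) = length l - 1"
  by (simp add: omit_nth_def)

lemma length_repeat [simp]: "i < length l \<Longrightarrow> length (repeat_nth i l) = Suc (length l)"
  by (simp add: repeat_nth_def)

lemma nth_omit [simp]: "i < length l \<Longrightarrow> Suc j < length l \<Longrightarrow>
    omit_nth i l ! j = (if j < i then l ! j else l ! Suc j)"
  by (auto simp: nth_append omit_nth_def)

lemma nth_repeat [simp]: "i < length l \<Longrightarrow> j \<le> length l \<Longrightarrow>
    repeat_nth i l ! j = (if j \<le> i then l ! j else l ! (j - 1))"
  by (cases "j \<le> i") (simp_all add: nth_append repeat_nth_def min_absorb2)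

lemma map_omit: "map f (omit_nth i l) = omit_nth i (map f l)"
  by (simp add: omit_nth_def take_map drop_map)

lemma map_repeat: "map f (repeat_nth i l) = repeat_nth i (map f l)"
  by (simp add: repeat_nth_def take_map drop_map)

lemma set_omit: "set (omit_nth i l) \<subseteq> set l"
  using set_take_subset[of i l] set_drop_subset[of "Suc i" l] by (auto simp: omit_nth_def)

lemma set_repeat: "set (repeat_nth i l) = set l"
proof -
  have "set l = set (take (Suc i) l) \<union> set (drop (Suc i) l)"
    by (metis append_take_drop_id set_append)
  moreover have "set (drop (Suc i) l) \<subseteq> set (drop i l)" by (rule set_drop_subset_set_drop) simp
  moreover have "set (drop i l) \<subseteq> set l" by (rule set_drop_subset)
  ultimately show ?thesis by (auto simp: repeat_nth_def)
qed

lemma std_simplex_face_in: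
  "1 \<le> k \<Longrightarrow> i \<le> k \<Longrightarrow> l \<in> cells (std_simplex m) k \<Longrightarrow> omit_nth i l \<in> cells (std_simplex m) (k - 1)"
  unfolding in_std_simplex using set_omit[of i l] by (auto simp: sorted_iff_nth_mono)

lemma std_simplex_degen_in:
  "i \<le> k \<Longrightarrow> l \<in> cells (std_simplex m) k \<Longrightarrow> repeat_nth i l \<in> cells (std_simplex m) (Suc k)"
  unfolding in_std_simplex using set_repeat[of i l] by (auto simp: sorted_iff_nth_mono)

lemma simplicial_std_simplex: "simplicial_set (std_simplex m)"
proof -
  have 1: "omit_nth i (omit_nth j l) = omit_nth (j - 1) (omit_nth i l)"
    if "length l = Suc k" "2 \<le> k" "i < j" "j \<le> k" for i j k and l :: "nat list"
    using that by (intro nth_equalityI) auto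
  have 2: "omit_nth i (repeat_nth j l) = repeat_nth (j - 1) (omit_nth i l)"
    if "length l = Suc k" "i < j" "j \<le> k" for i j k and l :: "nat list"
    using that by (intro nth_equalityI) auto
  have 3: "omit_nth i (repeat_nth j l) = l"
    if "length l = Suc k" "j \<le> k" "i = j \<or> i = Suc j" for i j k and l :: "nat list"
    using that by (intro nth_equalityI) auto
  have 4: "omit_nth i (repeat_nth j l) = repeat_nth j (omit_nth (i - 1) l)"
    if "length l = Suc k" "Suc j < i" "i \<le> Suc k" for i j k and l :: "nat list"
    using that by (intro nth_equalityI) auto
  have 5: "repeat_nth i (repeat_nth j l) = repeat_nth (Suc j) (repeat_nth i l)"
    if "length l = Suc k" "i \<le> j" "j \<le> k" for i j k and l :: "nat list"
    using that by (intro nth_equalityI) auto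
  show ?thesis
    unfolding simplicial_upto_def face_std_simplex degen_std_simplex
    by (intro conjI allI impI; (elim conjE)?)
      ((rule std_simplex_face_in; assumption) | (rule std_simplex_degen_in; assumption)
       | (rule 1 2 3 4 5; (assumption | simp add: in_std_simplex)))+
qed

text \<open>Every simplex of \<open>\<Delta>[m]\<close> arises from the fundamental one by faces and degeneracies.\<close>

lemma std_simplex_induct [consumes 1, case_names id face degen]:
  assumes l: "l \<in> cells (std_simplex m) k"
    and id: "P m [0..<Suc m]"
    and del: "\<And>k l i. \<lbrakk>l \<in> cells (std_simplex m) k; P k l; 1 \<le> k; i \<le> k\<rbrakk> \<Longrightarrow> P (k - 1) (omit_nth i l)"
    and dup: "\<And>k l i. \<lbrakk>l \<in> cells (std_simplex m) k; P k l; i \<le> k\<rbrakk> \<Longrightarrow> P (Suc k) (repeat_nth i l)"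
  shows "P k l"
proof -
  have insort_split: "\<exists>i \<le> length zs. insort a zs = take i zs @ a # drop i zs" for a :: nat and zs
  proof (induction zs)
    case (Cons z zs)
    then obtain i where i: "i \<le> length zs" "insort a zs = take i zs @ a # drop i zs" by auto
    show ?case
    proof (cases "a \<le> z")
      case True then show ?thesis by (intro exI[of _ 0]) simp
    next
      case False then show ?thesis using i by (intro exI[of _ "Suc i"]) simp
    qed
  qed simp
  have A: "P (length zs - 1) zs \<and> sorted zs \<and> set zs = {..m}" if "zs = fold insort xs [0..<Suc m]" "set xs \<subseteq> {..m}" for xs zs
    using that
  proof (induction xs arbitrary: zs rule: rev_induct)
    case Nil
    then show ?case using id by (auto simp del: upt_Suc)
  next
    case (snoc a xs)
    let ?z = "fold insort xs [0..<Suc m]"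
    have z: "P (length ?z - 1) ?z" "sorted ?z" "set ?z = {..m}" using snoc.IH[of ?z] snoc.prems by auto
    have "a \<in> set ?z" using snoc.prems z by auto
    then obtain i where i: "i < length ?z" "?z ! i = a" by (auto simp: in_set_conv_nth)
    have "repeat_nth i ?z = take i ?z @ a # drop i ?z"
      using i by (simp add: take_Suc_conv_app_nth repeat_nth_def)
    moreover have "mset (take i zs @ a # drop i zs) = add_mset a (mset zs)" for zs
      by (metis append_take_drop_id mset.simps(2) mset_append union_mset_add_mset_right)
    ultimately have m: "mset (repeat_nth i ?z) = mset (insort a ?z)"
      by (simp del: upt_Suc mset_append)
    have zc: "?z \<in> cells (std_simplex m) (length ?z - 1)"
      using z i by (auto simp: in_std_simplex)
    have il: "i \<le> length ?z - 1" using i by simp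
    have "sorted (repeat_nth i ?z)" using std_simplex_degen_in[OF il zc] by (simp only: in_std_simplex)
    moreover have "sorted (insort a ?z)" using z(2) by (rule sorted_insort[THEN iffD2])
    ultimately have e: "insort a ?z = repeat_nth i ?z" using m
      by (metis properties_for_sort)
    have "P (Suc (length ?z - 1)) (insort a ?z)" unfolding e by (rule dup[OF zc z(1) il])
    moreover have "length (insort a ?z) - 1 = Suc (length ?z - 1)" using i by simp
    ultimately have "P (length (insort a ?z) - 1) (insort a ?z)" by metis
    moreover have "set (insort a ?z) = {..m}" using z snoc.prems by (auto simp: set_insort_key)
    ultimately show ?case using snoc.prems(1) z(2) by (simp add: sorted_insort)
  qed
  have B: "P (length l - 1) l" if "P (length zs - 1) zs" "zs = fold insort ys l" "set ys \<subseteq> {..m}" for ys zs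
    using that
  proof (induction ys arbitrary: zs rule: rev_induct)
    case Nil
    then show ?case by simp
  next
    case (snoc a ys)
    let ?z = "fold insort ys l"
    have z: "sorted ?z \<and> set ?z \<subseteq> {..m} \<and> ?z \<noteq> []" using snoc.prems(3) l
    proof (induction ys rule: rev_induct)
      case Nil then show ?case by (auto simp: in_std_simplex)
    next
      case (snoc b ys)
      then show ?case by (auto simp: sorted_insort set_insort_key insort_not_Nil)
    qed
    obtain i where i: "i \<le> length ?z" "insort a ?z = take i ?z @ a # drop i ?z"
      using insort_split by blast
    have e: "omit_nth i (insort a ?z) = ?z" using i by (simp add: omit_nth_def)
    have c: "insort a ?z \<in> cells (std_simplex m) (length ?z)"
      using z snoc.prems by (auto simp: in_std_simplex set_insort_key sorted_insort)
    have "P (length ?z) (insort a ?z)" using snoc.prems by simp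
    then have "P (length ?z - 1) ?z"
      using del[OF c _ _ i(1)] z unfolding e by (simp add: Suc_le_eq)
    then show ?case using snoc.IH[of ?z] snoc.prems by simp
  qed
  have "sorted (fold insort l [0..<Suc m])" "sorted (fold insort [0..<Suc m] l)"
    "mset (fold insort l [0..<Suc m]) = mset (fold insort [0..<Suc m] l)"
  proof -
    have s: "sorted ys \<Longrightarrow> sorted (fold insort xs ys)" for xs ys :: "nat list"
      by (induction xs arbitrary: ys) (auto simp: sorted_insort)
    have m: "mset (fold insort xs ys) = mset xs + mset ys" for xs ys :: "nat list"
      by (induction xs arbitrary: ys) auto
    show "sorted (fold insort l [0..<Suc m])" by (rule s) (simp del: upt_Suc)
    show "sorted (fold insort [0..<Suc m] l)" using l by (intro s) (simp add: in_std_simplex)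
    show "mset (fold insort l [0..<Suc m]) = mset (fold insort [0..<Suc m] l)"
      by (simp add: m del: upt_Suc)
  qed
  then have e: "fold insort l [0..<Suc m] = fold insort [0..<Suc m] l" by (metis properties_for_sort)
  have "P (length (fold insort l [0..<Suc m]) - 1) (fold insort l [0..<Suc m])"
    using A[OF refl, of l] l by (simp add: in_std_simplex del: upt_Suc)
  then have "P (length l - 1) l" by (rule B[OF _ e]) auto
  then show ?thesis using l by (simp add: in_std_simplex)
qed

context
  fixes X :: "'a sset"
  assumes X: "simplicial_set X"
begin

lemma face_in: "1 \<le> k \<Longrightarrow> i \<le> k \<Longrightarrow> x \<in> cells X k \<Longrightarrow> face X k i x \<in> cells X (k - 1)"
  using X unfolding simplicial_upto_def by simp

lemma degen_in: "i \<le> k \<Longrightarrow> x \<in> cells X k \<Longrightarrow> degen X k i x \<in> cells X (Suc k)"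
  using X unfolding simplicial_upto_def by simp

lemma face_face: "2 \<le> k \<Longrightarrow> i < j \<Longrightarrow> j \<le> k \<Longrightarrow> x \<in> cells X k \<Longrightarrow>
       face X (k - 1) i (face X k j x) = face X (k - 1) (j - 1) (face X k i x)"
  using X unfolding simplicial_upto_def by simp

lemma face_degen_less: "i < j \<Longrightarrow> j \<le> k \<Longrightarrow> x \<in> cells X k \<Longrightarrow>
       face X (Suc k) i (degen X k j x) = degen X (k - 1) (j - 1) (face X k i x)"
  using X unfolding simplicial_upto_def by simp

lemma face_degen_eq: "j \<le> k \<Longrightarrow> i = j \<or> i = Suc j \<Longrightarrow> x \<in> cells X k \<Longrightarrow>
       face X (Suc k) i (degen X k j x) = x"
  using X unfolding simplicial_upto_def by simp

lemma face_degen_greater: "Suc j < i \<Longrightarrow> i \<le> Suc k \<Longrightarrow> x \<in> cells X k \<Longrightarrow>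
       face X (Suc k) i (degen X k j x) = degen X (k - 1) j (face X k (i - 1) x)"
  using X unfolding simplicial_upto_def by simp

lemma degen_degen: "i \<le> j \<Longrightarrow> j \<le> k \<Longrightarrow> x \<in> cells X k \<Longrightarrow>
       degen X (Suc k) i (degen X k j x) = degen X (Suc k) (Suc j) (degen X k i x)"
  using X unfolding simplicial_upto_def by simp

end

context
  fixes X :: "'a sset"
  assumes X: "simplicial_set X"
begin

lemmas d_in = face_in[OF X] and s_in = degen_in[OF X] and d_d = face_face[OF X] and s_s = degen_degen[OF X]
  and d_s_less = face_degen_less[OF X] and d_s_eq = face_degen_eq[OF X] and d_s_greater = face_degen_greater[OF X]

lemma degens_along_snoc:
  "degens_along X m (js @ [t]) x = degen X (m + length js) t (degens_along X m js x)"
  by (induction js arbitrary: m x) auto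

lemma faces_along_snoc:
  "faces_along X m (is @ [t]) x = face X (m - length is) t (faces_along X m is x)"
  by (induction "is" arbitrary: m x) auto

lemma degens_along_in:
  "x \<in> cells X m \<Longrightarrow> sorted_wrt (<) js \<Longrightarrow> set js \<subseteq> {..<m + length js} \<Longrightarrow>
     degens_along X m js x \<in> cells X (m + length js)"
proof (induction js rule: rev_induct)
  case (snoc t js)
  then have "degens_along X m js x \<in> cells X (m + length js)"
    by (fastforce simp: sorted_wrt_append)
  then show ?case using snoc.prems by (simp add: degens_along_snoc s_in)
qed simp

lemma faces_along_in:
  "x \<in> cells X m \<Longrightarrow> sorted_wrt (>) is \<Longrightarrow> set is \<subseteq> {..m} \<Longrightarrow> length is \<le> m \<Longrightarrow>
     faces_along X m is x \<in> cells X (m - length is)"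
proof (induction "is" rule: rev_induct)
  case (snoc t "is")
  then have h: "faces_along X m is x \<in> cells X (m - length is)"
    by (auto simp: sorted_wrt_append)
  have "distinct is" using snoc.prems(2) by (auto simp: sorted_wrt_append intro: distinct_desc)
  moreover have "set is \<subseteq> {t<..m}" using snoc.prems by (auto simp: sorted_wrt_append)
  ultimately have "length is \<le> m - t"
    by (metis card_greaterThanAtMost card_mono distinct_card finite_greaterThanAtMost)
  moreover have "t \<le> m" using snoc.prems by auto
  ultimately show ?case using snoc.prems d_in[OF _ _ h, of t] by (simp add: faces_along_snoc)
qed simp

lemma degen_degens_along:
  assumes "x \<in> cells X m" "sorted_wrt (<) js" "set js \<subseteq> {..<m + length js}" "i \<le> m + length js"
  shows "\<exists>js'. sorted_wrt (<) js' \<and> length js' = Suc (length js) \<and>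
     set js' = {j \<in> set js. j < i} \<union> {i} \<union> Suc ` {j \<in> set js. i \<le> j} \<and>
     degen X (m + length js) i (degens_along X m js x) = degens_along X m js' x"
  using assms
proof (induction js rule: rev_induct)
  case Nil
  show ?case by (rule exI[of _ "[i]"]) simp
next
  case (snoc t js)
  have js: "sorted_wrt (<) js" "set js \<subseteq> {..<t}" "t \<le> m + length js"
    using snoc.prems by (auto simp: sorted_wrt_append)
  then have js': "set js \<subseteq> {..<m + length js}" by auto
  have z: "degens_along X m js x \<in> cells X (m + length js)"
    using degens_along_in snoc.prems(1) js(1) js' by blast
  show ?case
  proof (cases "t < i")
    case True
    have "degen X (m + length (js @ [t])) i (degens_along X m (js @ [t]) x)
      = degens_along X m (js @ [t] @ [i]) x"
      unfolding append_assoc[symmetric] degens_along_snoc[of m "js @ [t]"] by simp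
    moreover have "sorted_wrt (<) (js @ [t] @ [i])" using js True by (auto simp: sorted_wrt_append)
    ultimately show ?thesis using js True
      by (intro exI[of _ "js @ [t] @ [i]"]) force
  next
    case False
    obtain js1 where 1: "sorted_wrt (<) js1" "length js1 = Suc (length js)"
      "set js1 = {j \<in> set js. j < i} \<union> {i} \<union> Suc ` {j \<in> set js. i \<le> j}"
      "degen X (m + length js) i (degens_along X m js x) = degens_along X m js1 x"
      using snoc.IH[OF snoc.prems(1) js(1) js'] False js(3) by auto
    have "degen X (m + length (js @ [t])) i (degens_along X m (js @ [t]) x)
       = degen X (Suc (m + length js)) (Suc t) (degens_along X m js1 x)"
      using s_s[of i t "m + length js", OF _ js(3) z] False by (simp add: degens_along_snoc 1(4))
    also have "\<dots> = degens_along X m (js1 @ [Suc t]) x"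
      by (simp add: degens_along_snoc 1(2))
    moreover have "sorted_wrt (<) (js1 @ [Suc t])"
      using 1 js(2) False by (auto simp: sorted_wrt_append)
    ultimately show ?thesis using 1 False
      by (intro exI[of _ "js1 @ [Suc t]"]) auto
  qed
qed

lemma face_faces_along:
  assumes "x \<in> cells X m" "sorted_wrt (>) is" "set is \<subseteq> {..m}" "v \<le> m" "v \<notin> set is"
    "i = card ({..<v} - set is)" "length is < m"
  shows "\<exists>is'. sorted_wrt (>) is' \<and> length is' = Suc (length is) \<and> set is' = insert v (set is) \<and>
     face X (m - length is) i (faces_along X m is x) = faces_along X m is' x"
  using assms
proof (induction "is" arbitrary: i rule: rev_induct)
  case Nil
  then show ?case by (intro exI[of _ "[v]"]) simp
next
  case (snoc t "is")
  have s: "sorted_wrt (>) is" "\<forall>j \<in> set is. t < j" "set is \<subseteq> {..m}" "t \<le> m" "v \<notin> set is" "v \<noteq> t"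
    "length is < m"
    using snoc.prems by (auto simp: sorted_wrt_append)
  have z: "faces_along X m is x \<in> cells X (m - length is)"
    using faces_along_in snoc.prems(1) s by simp
  show ?case
  proof (cases "v < t")
    case True
    then have "{..<v} - set (is @ [t]) = {..<v}" using s(2) by auto
    then have "i = v" using snoc.prems(6) by simp
    moreover have "faces_along X m (is @ [t] @ [v]) x =
      face X (m - length (is @ [t])) v (faces_along X m (is @ [t]) x)"
      unfolding append_assoc[symmetric] faces_along_snoc[of m "is @ [t]"] by simp
    moreover have "sorted_wrt (>) (is @ [t] @ [v])" using s True by (auto simp: sorted_wrt_append)
    ultimately show ?thesis
      by (intro exI[of _ "is @ [t] @ [v]"]) (simp add: insert_commute)
  next
    case False
    then have tv: "t < v" using s by simp
    have e: "{..<v} - set is = insert t ({..<v} - set (is @ [t]))"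
      using tv s(2) unfolding set_append by (simp add: set_eq_iff) (metis less_irrefl)
    have i: "card ({..<v} - set is) = Suc i"
      unfolding snoc.prems(6) by (subst e, subst card_insert_disjoint) auto
    obtain is1 where 1: "sorted_wrt (>) is1" "length is1 = Suc (length is)"
      "set is1 = insert v (set is)"
      "face X (m - length is) (Suc i) (faces_along X m is x) = faces_along X m is1 x"
      using snoc.IH[OF snoc.prems(1) s(1,3) snoc.prems(4) s(5) i[symmetric] s(7)] by auto
    have "{..t} \<subseteq> {..<v} - set is" using tv s(2) by auto
    then have "card {..t} \<le> Suc i" unfolding i[symmetric] by (intro card_mono) auto
    then have ti: "t < Suc i" by simp
    have "distinct is" using s(1) by (rule distinct_desc)
    then have "card ({..m} - set is) = Suc m - length is"
      using s(3) by (simp add: card_Diff_subset distinct_card)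
    moreover have "{..<v} - set is \<subset> {..m} - set is"
      using snoc.prems(4) s(5) by (intro psubsetI) auto
    then have "card ({..<v} - set is) < card ({..m} - set is)" by (intro psubset_card_mono) auto
    ultimately have im: "Suc i \<le> m - length is" using i s(7) by simp
    have "face X (m - length (is @ [t])) i (faces_along X m (is @ [t]) x)
      = face X (m - length is - 1) (Suc i - 1) (face X (m - length is) t (faces_along X m is x))"
      by (simp add: faces_along_snoc)
    also have "\<dots> = face X (m - length is - 1) t (face X (m - length is) (Suc i) (faces_along X m is x))"
      using snoc.prems(7) by (intro d_d[symmetric, OF _ ti im z]) simp
    also have "\<dots> = faces_along X m (is1 @ [t]) x"
      by (simp add: faces_along_snoc 1)
    finally have "face X (m - length (is @ [t])) i (faces_along X m (is @ [t]) x)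
      = faces_along X m (is1 @ [t]) x" .
    moreover have "sorted_wrt (>) (is1 @ [t])" using 1 s tv by (auto simp: sorted_wrt_append)
    ultimately show ?thesis using 1 by (intro exI[of _ "is1 @ [t]"]) auto
  qed
qed

lemma action_facts:
  assumes l: "l \<in> cells (std_simplex m) k" and x: "x \<in> cells X m"
  shows "length (missed m l) \<le> m"
    and "k = m - length (missed m l) + length (repeats l)"
    and "faces_along X m (missed m l) x \<in> cells X (m - length (missed m l))"
    and "set (repeats l) \<subseteq> {..<k}"
proof -
  have l': "length l = Suc k" "sorted l" "set l \<subseteq> {..m}" "l \<noteq> []"
    using l by (auto simp: in_std_simplex)
  have "card (set l) \<ge> 1" using l' by (simp add: Suc_le_eq card_gt_0_iff)
  with length_missed[OF l'(3)] card_repeats[OF l'(2,4)] l'(1)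
  show 1: "length (missed m l) \<le> m" and "k = m - length (missed m l) + length (repeats l)" by linarith+
  show "faces_along X m (missed m l) x \<in> cells X (m - length (missed m l))"
    using x 1 by (intro faces_along_in strict_missed) (auto simp: set_missed)
  show "set (repeats l) \<subseteq> {..<k}" using l' by (auto simp: set_repeats)
qed

lemma action_in:
  "l \<in> cells (std_simplex m) k \<Longrightarrow> x \<in> cells X m \<Longrightarrow> action X m l x \<in> cells X k"
  unfolding action_def using action_facts[of l m k x] degens_along_in strict_repeats by metis

lemma action_id: "action X m [0..<Suc m] x = x"
proof -
  have "missed m [0..<Suc m] = []" "repeats [0..<Suc m] = []"
    by (auto simp: missed_def repeats_def filter_empty_conv simp del: upt_Suc)
  then show ?thesis by (simp add: action_def del: upt_Suc)
qed

lemma action_degen: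
  assumes l: "l \<in> cells (std_simplex m) k" and i: "i \<le> k" and x: "x \<in> cells X m"
  shows "action X m (repeat_nth i l) x = degen X k i (action X m l x)"
proof -
  note f = action_facts[OF l x]
  have len: "length l = Suc k" using l by (simp add: in_std_simplex)
  obtain js where js: "sorted_wrt (<) js"
    "set js = {j \<in> set (repeats l). j < i} \<union> {i} \<union> Suc ` {j \<in> set (repeats l). i \<le> j}"
    "degen X k i (action X m l x) = degens_along X (m - length (missed m l)) js (faces_along X m (missed m l) x)"
    using degen_degens_along[OF f(3) strict_repeats, of l i] f i by (auto simp: action_def)
  have "j \<in> set (repeats (repeat_nth i l)) \<longleftrightarrow> j \<in> set js" for j
  proof -
    consider "j < i" | "j = i" | j' where "j = Suc j'" "i \<le> j'"
      by (metis Suc_le_D Suc_le_mono linorder_neqE_nat less_eq_Suc_le)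
    then show ?thesis
      by cases (use len i in \<open>auto simp: set_repeats js(2)\<close>)
  qed
  then have "repeats (repeat_nth i l) = js"
    by (intro strict_sorted_equal strict_repeats js(1)) blast
  moreover have "missed m (repeat_nth i l) = missed m l"
    by (simp add: missed_def set_repeat)
  ultimately show ?thesis by (simp add: action_def[of _ _ "repeat_nth i l"] js(3))
qed

lemma action_face:
  assumes "l \<in> cells (std_simplex m) k" "1 \<le> k" "i \<le> k" "x \<in> cells X m"
  shows "action X m (omit_nth i l) x = face X k i (action X m l x)"
  using assms
proof (induction k arbitrary: l i)
  case (Suc k)
  note l = Suc.prems(1) and i = Suc.prems(3) and x = Suc.prems(4)
  have l': "length l = Suc (Suc k)" "sorted l" "set l \<subseteq> {..m}"
    using l by (auto simp: in_std_simplex)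
  show ?case
  proof (cases "\<exists>j \<le> k. l ! j = l ! Suc j")
    case True
    then obtain j where j: "j \<le> k" "l ! j = l ! Suc j" by blast
    define r where "r = omit_nth j l"
    have r: "r \<in> cells (std_simplex m) k"
      using std_simplex_face_in[OF _ _ l, of j] j by (simp add: r_def)
    have lr: "l = repeat_nth j r"
      using l'(1) j by (intro nth_equalityI) (auto simp: r_def le_Suc_eq not_le Suc_diff_Suc
        dest!: less_imp_Suc_add)
    have z: "action X m r x \<in> cells X k" by (rule action_in[OF r x])
    have a: "action X m l x = degen X k j (action X m r x)"
      unfolding lr by (rule action_degen[OF r j(1) x])
    have SD: "simplicial_set (std_simplex m)" by (rule simplicial_std_simplex)
    consider "i = j \<or> i = Suc j" | "i < j" | "Suc j < i" by linarith
    then show ?thesis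
    proof cases
      case 1
      then show ?thesis
        using d_s_eq[OF j(1) 1 z] face_degen_eq[OF SD, simplified, OF j(1) 1 r] by (simp add: a flip: lr)
    next
      case 2
      then have ik: "1 \<le> k" "i \<le> k" "j - 1 \<le> k - 1" using j by auto
      have "omit_nth i l = repeat_nth (j - 1) (omit_nth i r)"
        using face_degen_less[OF SD, simplified, OF 2 j(1) r] by (simp flip: lr)
      also have "action X m \<dots> x = degen X (k - 1) (j - 1) (action X m (omit_nth i r) x)"
        by (rule action_degen[OF std_simplex_face_in[OF ik(1,2) r] ik(3) x])
      also have "\<dots> = degen X (k - 1) (j - 1) (face X k i (action X m r x))"
        using Suc.IH[OF r ik(1,2) x] by simp
      also have "\<dots> = face X (Suc k) i (action X m l x)"
        unfolding a by (rule d_s_less[OF 2 j(1) z, symmetric])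
      finally show ?thesis .
    next
      case 3
      then have ik: "1 \<le> k" "i - 1 \<le> k" "j \<le> k - 1" using j i by auto
      have "omit_nth i l = repeat_nth j (omit_nth (i - 1) r)"
        using face_degen_greater[OF SD, simplified, OF 3 i r] by (simp flip: lr)
      also have "action X m \<dots> x = degen X (k - 1) j (action X m (omit_nth (i - 1) r) x)"
        by (rule action_degen[OF std_simplex_face_in[OF ik(1,2) r] ik(3) x])
      also have "\<dots> = degen X (k - 1) j (face X k (i - 1) (action X m r x))"
        using Suc.IH[OF r ik(1,2) x] by simp
      also have "\<dots> = face X (Suc k) i (action X m l x)"
        unfolding a by (rule d_s_greater[OF 3 i z, symmetric])
      finally show ?thesis .
    qed
  next
    case False
    then have rl: "repeats l = []" using l'(1)
      by (simp flip: set_empty add: set_repeats)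
    have "card (set l) = length l" using card_repeats[OF l'(2)] rl l'(1) by force
    then have "distinct l" by (rule card_distinct)
    then have strict: "sorted_wrt (<) l" using l'(2) by (simp add: strict_sorted_iff)
    have "distinct (omit_nth i l)"
      using \<open>distinct l\<close> unfolding omit_nth_def
      by (metis distinct_append append_take_drop_id distinct_take distinct_drop inf_commute
          set_take_disj_set_drop_if_distinct lessI less_imp_le)
    moreover have o: "omit_nth i l \<in> cells (std_simplex m) k"
      using std_simplex_face_in[OF _ _ l, of i] i by simp
    ultimately have "length (repeats (omit_nth i l)) = 0"
      using card_repeats[of "omit_nth i l"] by (force simp: in_std_simplex distinct_card)
    then have ro: "repeats (omit_nth i l) = []" by simp
    have il: "i < length l" using i l'(1) by simp
    have split: "set l = insert (l ! i) (set (omit_nth i l))"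
      unfolding omit_nth_def using id_take_nth_drop[OF il]
      by (metis Un_insert_right list.simps(15) set_append)
    have notin: "l ! i \<notin> set (omit_nth i l)"
      using \<open>distinct l\<close> id_take_nth_drop[OF il] unfolding omit_nth_def
      by (metis Un_iff distinct_append distinct.simps(2) disjoint_insert(1) list.simps(15) set_append)
    have vm: "l ! i \<le> m" using l'(3) il by (meson atMost_iff nth_mem subsetD)
    have "{..<l ! i} - set (missed m l) = set (take i l)"
    proof -
      have "{..<l ! i} - set (missed m l) = {u \<in> set l. u < l ! i}"
        using vm by (auto simp: set_missed)
      also have "\<dots> = set (take i l)"
      proof -
        have "{u \<in> set l. u < l ! i} = {l ! j | j. j < i}"
          using strict il
          by (auto simp: in_set_conv_nth sorted_wrt_iff_nth_less)
             (metis linorder_neqE_nat order_less_asym, metis order.strict_trans)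
        then show ?thesis using il by (auto simp: nth_image[symmetric])
      qed
      finally show ?thesis .
    qed
    then have c: "i = card ({..<l ! i} - set (missed m l))"
      using \<open>distinct l\<close> il by (simp add: distinct_card)
    have ml: "length (missed m l) < m" and mk: "m - length (missed m l) = Suc k"
      using action_facts(1,2)[OF l x] rl by auto
    obtain js where js: "sorted_wrt (>) js" "length js = Suc (length (missed m l))"
      "set js = insert (l ! i) (set (missed m l))"
      "face X (Suc k) i (faces_along X m (missed m l) x) = faces_along X m js x"
      using face_faces_along[OF x strict_missed _ vm _ c ml] il mk
      by (auto simp: set_missed)
    have "set (missed m (omit_nth i l)) = set js"
      using split notin vm by (auto simp: js(3) set_missed)
    then have "missed m (omit_nth i l) = js" by (intro desc_equal strict_missed js(1))
    then show ?thesis by (simp add: action_def rl ro js(4))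
  qed
qed simp

lemma action_coface:
  assumes "l \<in> cells (std_simplex (m - 1)) k" "1 \<le> m" "i \<le> m" "x \<in> cells X m"
  shows "map (coface i) l \<in> cells (std_simplex m) k \<and>
    action X (m - 1) l (face X m i x) = action X m (map (coface i) l) x"
  using assms(1)
proof (induction rule: std_simplex_induct)
  case id
  have u: "[0..<Suc m] \<in> cells (std_simplex m) m"
    by (auto simp: in_std_simplex simp del: upt_Suc)
  have "map (coface i) [0..<Suc (m - 1)] = omit_nth i [0..<Suc m]"
    using assms by (intro nth_equalityI) (auto simp: coface_def simp del: upt_Suc)
  then show ?case
    using action_face[OF u assms(2-4)] std_simplex_face_in[OF assms(2,3) u]
    by (simp add: action_id del: upt_Suc)
next
  case (face k l j)
  note x' = d_in[OF assms(2-4)]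
  let ?l = "map (coface i) l"
  have l: "?l \<in> cells (std_simplex m) k"
    and e: "action X (m - 1) l (face X m i x) = action X m ?l x" using face by blast+
  show ?case
    unfolding map_omit action_face[OF face(1-3) x'] action_face[OF l face(2,3) assms(4)] e
    using std_simplex_face_in[OF face(2,3) l] by simp
next
  case (degen k l j)
  note x' = d_in[OF assms(2-4)]
  let ?l = "map (coface i) l"
  have l: "?l \<in> cells (std_simplex m) k"
    and e: "action X (m - 1) l (face X m i x) = action X m ?l x" using degen by blast+
  show ?case
    unfolding map_repeat action_degen[OF degen(1,2) x'] action_degen[OF l degen(2) assms(4)] e
    using std_simplex_degen_in[OF degen(2) l] by simp
qed

lemma action_codegen:
  assumes "l \<in> cells (std_simplex (Suc m)) k" "i \<le> m" "x \<in> cells X m"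
  shows "map (codegen i) l \<in> cells (std_simplex m) k \<and>
    action X (Suc m) l (degen X m i x) = action X m (map (codegen i) l) x"
  using assms(1)
proof (induction rule: std_simplex_induct)
  case id
  have u: "[0..<Suc m] \<in> cells (std_simplex m) m"
    by (auto simp: in_std_simplex simp del: upt_Suc)
  have "map (codegen i) [0..<Suc (Suc m)] = repeat_nth i [0..<Suc m]"
    using assms by (intro nth_equalityI) (auto simp: codegen_def simp del: upt_Suc)
  then show ?case
    using action_degen[OF u assms(2,3)] std_simplex_degen_in[OF assms(2) u]
    by (simp add: action_id del: upt_Suc)
next
  case (face k l j)
  note x' = s_in[OF assms(2,3)]
  let ?l = "map (codegen i) l"
  have l: "?l \<in> cells (std_simplex m) k"
    and e: "action X (Suc m) l (degen X m i x) = action X m ?l x" using face by blast+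
  show ?case
    unfolding map_omit action_face[OF face(1-3) x'] action_face[OF l face(2,3) assms(3)] e
    using std_simplex_face_in[OF face(2,3) l] by simp
next
  case (degen k l j)
  note x' = s_in[OF assms(2,3)]
  let ?l = "map (codegen i) l"
  have l: "?l \<in> cells (std_simplex m) k"
    and e: "action X (Suc m) l (degen X m i x) = action X m ?l x" using degen by blast+
  show ?case
    unfolding map_repeat action_degen[OF degen(1,2) x'] action_degen[OF l degen(2) assms(3)] e
    using std_simplex_degen_in[OF degen(2) l] by simp
qed

end

lemma cells_tr: "cells (tr n X) k = (if k \<le> n then cells X k else {})"
  by (simp add: tr_def)

lemma face_tr [simp]: "face (tr n X) = face X" and degen_tr [simp]: "degen (tr n X) = degen X"
  by (simp_all add: tr_def)

lemma truncated_tr: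
  assumes "simplicial_set X"
  shows "truncated_sset n (tr n X)"
  unfolding simplicial_upto_def face_tr degen_tr cells_tr
  by (intro conjI allI impI; elim conjE)
     (simp_all add: face_in[OF assms, simplified] degen_in[OF assms] face_face[OF assms, simplified]
       face_degen_less[OF assms, simplified] face_degen_eq[OF assms]
       face_degen_greater[OF assms, simplified] degen_degen[OF assms] split: if_splits)

lemma map_in_std_simplex:
  assumes "l \<in> cells (std_simplex m) k" "mono_on {..m} \<theta>" "\<theta> ` {..m} \<subseteq> {..m'}"
  shows "map \<theta> l \<in> cells (std_simplex m') k"
proof -
  have l: "length l = Suc k" "sorted l" "set l \<subseteq> {..m}" using assms(1) by (simp_all add: in_std_simplex)
  have "sorted (map \<theta> l)"
    unfolding sorted_iff_nth_mono length_map
  proof (intro allI impI)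
    fix i j assume "i \<le> j" "j < length l"
    moreover from this l(2) have "l ! i \<le> l ! j" by (simp add: sorted_iff_nth_mono)
    moreover have "l ! i \<in> {..m}" "l ! j \<in> {..m}"
      using calculation(1,2) l(3) by (meson nth_mem order_le_less_trans subsetD)+
    ultimately show "map \<theta> l ! i \<le> map \<theta> l ! j"
      using mono_onD[OF assms(2)] by simp
  qed
  then show ?thesis using l assms(3) by (auto simp: in_std_simplex)
qed

lemma precomp_apply:
  "l \<in> cells (std_simplex m) k \<Longrightarrow> k \<le> n \<Longrightarrow> precomp n m \<theta> f k l = f k (map \<theta> l)"
  by (simp add: precomp_def cells_tr)

lemma smaps_tr_eqI:
  assumes "\<And>k. f k \<in> extensional (cells (tr n (std_simplex m)) k)"
    and "\<And>k. g k \<in> extensional (cells (tr n (std_simplex m)) k)"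
    and "\<And>k l. k \<le> n \<Longrightarrow> l \<in> cells (std_simplex m) k \<Longrightarrow> f k l = g k l"
  shows "f = g"
proof (intro ext)
  fix k l
  show "f k l = g k l"
    using assms(1,2)[of k] assms(3)[of k l]
    by (cases "k \<le> n \<and> l \<in> cells (std_simplex m) k") (auto simp: cells_tr extensional_def)
qed

lemma precomp_extensional: "precomp n m \<theta> f k \<in> extensional (cells (tr n (std_simplex m)) k)"
  by (simp add: precomp_def)

lemma smaps_tr_iff:
  "f \<in> smaps (enat n) (tr n (std_simplex m)) Y \<longleftrightarrow>
    (\<forall>k. f k \<in> extensional (cells (tr n (std_simplex m)) k)) \<and>
    (\<forall>k l. k \<le> n \<and> l \<in> cells (std_simplex m) k \<longrightarrow> f k l \<in> cells Y k) \<and>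
    (\<forall>k i l. k \<le> n \<and> 1 \<le> k \<and> i \<le> k \<and> l \<in> cells (std_simplex m) k \<longrightarrow>
       f (k - 1) (omit_nth i l) = face Y k i (f k l)) \<and>
    (\<forall>k i l. Suc k \<le> n \<and> i \<le> k \<and> l \<in> cells (std_simplex m) k \<longrightarrow>
       f (Suc k) (repeat_nth i l) = degen Y k i (f k l))"
  (is "_ \<longleftrightarrow> ?R")
proof
  assume "f \<in> smaps (enat n) (tr n (std_simplex m)) Y"
  then show ?R unfolding smaps_def
    by (auto simp: cells_tr PiE_iff extensional_def split: if_splits)
next
  assume R: ?R
  then have "f k = (\<lambda>_. undefined)" if "\<not> k \<le> n" for k
    using that by (auto simp: cells_tr extensional_def fun_eq_iff)
  moreover have "f k \<in> extensional (cells (std_simplex m) k)" if "k \<le> n" for k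
    using that R by (metis cells_tr)
  ultimately show "f \<in> smaps (enat n) (tr n (std_simplex m)) Y"
    using R unfolding smaps_def by (auto simp: cells_tr PiE_iff)
qed

lemma precomp_in:
  assumes f: "f \<in> smaps (enat n) (tr n (std_simplex m')) Y"
    and \<theta>: "mono_on {..m} \<theta>" "\<theta> ` {..m} \<subseteq> {..m'}"
  shows "precomp n m \<theta> f \<in> smaps (enat n) (tr n (std_simplex m)) Y"
  unfolding smaps_tr_iff
proof (intro conjI allI impI; (elim conjE)?)
  fix k l assume "k \<le> n" "l \<in> cells (std_simplex m) k"
  then show "precomp n m \<theta> f k l \<in> cells Y k"
    using f map_in_std_simplex[OF _ \<theta>] by (simp add: precomp_apply smaps_tr_iff)
next
  fix k i l assume h: "k \<le> n" "1 \<le> k" "i \<le> k" "l \<in> cells (std_simplex m) k"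
  have "precomp n m \<theta> f (k - 1) (omit_nth i l) = f (k - 1) (omit_nth i (map \<theta> l))"
    using std_simplex_face_in[OF h(2-4)] h by (simp add: precomp_apply map_omit)
  also have "\<dots> = face Y k i (f k (map \<theta> l))"
    using f map_in_std_simplex[OF h(4) \<theta>] h by (simp add: smaps_tr_iff)
  finally show "precomp n m \<theta> f (k - 1) (omit_nth i l) = face Y k i (precomp n m \<theta> f k l)"
    using h by (simp add: precomp_apply)
next
  fix k i l assume h: "Suc k \<le> n" "i \<le> k" "l \<in> cells (std_simplex m) k"
  have "precomp n m \<theta> f (Suc k) (repeat_nth i l) = f (Suc k) (repeat_nth i (map \<theta> l))"
    using std_simplex_degen_in[OF h(2-3)] h by (simp add: precomp_apply map_repeat)
  also have "\<dots> = degen Y k i (f k (map \<theta> l))"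
    using f map_in_std_simplex[OF h(3) \<theta>] h by (simp add: smaps_tr_iff)
  finally show "precomp n m \<theta> f (Suc k) (repeat_nth i l) = degen Y k i (precomp n m \<theta> f k l)"
    using h by (simp add: precomp_apply)
qed (rule precomp_extensional)

lemma precomp_precomp:
  assumes \<theta>: "mono_on {..m} \<theta>" "\<theta> ` {..m} \<subseteq> {..m'}"
    and eq: "\<And>i. i \<le> m \<Longrightarrow> \<theta>' (\<theta> i) = \<psi> i"
  shows "precomp n m \<theta> (precomp n m' \<theta>' f) = precomp n m \<psi> f"
proof (rule smaps_tr_eqI[where n = n and m = m])
  fix k l assume k: "k \<le> n" and l: "l \<in> cells (std_simplex m) k"
  have "map \<theta>' (map \<theta> l) = map \<psi> l"
    using eq l by (auto simp: in_std_simplex)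
  then show "precomp n m \<theta> (precomp n m' \<theta>' f) k l = precomp n m \<psi> f k l"
    unfolding precomp_apply[OF l k] precomp_apply[OF map_in_std_simplex[OF l \<theta>] k] by metis
qed (rule precomp_extensional)+

lemma precomp_id:
  assumes f: "f \<in> smaps (enat n) (tr n (std_simplex m)) Y" and "\<And>i. i \<le> m \<Longrightarrow> \<psi> i = i"
  shows "precomp n m \<psi> f = f"
proof (rule smaps_tr_eqI[where n = n and m = m])
  show "f k \<in> extensional (cells (tr n (std_simplex m)) k)" for k
    using f by (simp add: smaps_tr_iff)
  fix k l assume "k \<le> n" and l: "l \<in> cells (std_simplex m) k"
  moreover have "map \<psi> l = l" using assms(2) l by (intro map_idI) (auto simp: in_std_simplex)
  ultimately show "precomp n m \<psi> f k l = f k l" by (metis precomp_apply)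
qed (rule precomp_extensional)

lemma coface_mono: "mono_on {..m} (coface j)" "coface j ` {..k} \<subseteq> {..Suc k}"
  "1 \<le> k \<Longrightarrow> coface j ` {..k - 1} \<subseteq> {..k}"
  by (auto simp: coface_def mono_on_def)

lemma codegen_mono: "mono_on {..m} (codegen j)" "j \<le> k \<Longrightarrow> codegen j ` {..Suc k} \<subseteq> {..k}"
  by (auto simp: codegen_def mono_on_def)

lemma precomp_commute:
  assumes "mono_on {..m} \<theta>" "\<theta> ` {..m} \<subseteq> {..p}" "mono_on {..m} \<theta>'" "\<theta>' ` {..m} \<subseteq> {..q}"
    and "\<And>i. i \<le> m \<Longrightarrow> \<phi> (\<theta> i) = \<phi>' (\<theta>' i)"
  shows "precomp n m \<theta> (precomp n p \<phi> f) = precomp n m \<theta>' (precomp n q \<phi>' f)"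
proof -
  have "precomp n m \<theta> (precomp n p \<phi> f) = precomp n m (\<lambda>i. \<phi>' (\<theta>' i)) f"
    using assms(5) by (rule precomp_precomp[OF assms(1,2)])
  also have "\<dots> = precomp n m \<theta>' (precomp n q \<phi>' f)"
    by (rule precomp_precomp[OF assms(3,4) refl, symmetric])
  finally show ?thesis .
qed

lemma cosk_sel [simp]:
  "cells (cosk n Y) m = smaps (enat n) (tr n (std_simplex m)) Y"
  "face (cosk n Y) m j = precomp n (m - 1) (coface j)"
  "degen (cosk n Y) m j = precomp n (Suc m) (codegen j)"
  by (simp_all add: cosk_def)

lemma simplicial_cosk: "simplicial_set (cosk n Y)"
  unfolding simplicial_upto_def cosk_sel
proof (intro conjI allI impI; (elim conjE)?)
  fix k i :: nat and f assume "1 \<le> k" "f \<in> smaps (enat n) (tr n (std_simplex k)) Y"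
  then show "precomp n (k - 1) (coface i) f \<in> smaps (enat n) (tr n (std_simplex (k - 1))) Y"
    by (intro precomp_in coface_mono(1)) (auto simp: coface_def)
next
  fix k i :: nat and f assume "i \<le> k" "f \<in> smaps (enat n) (tr n (std_simplex k)) Y"
  then show "precomp n (Suc k) (codegen i) f \<in> smaps (enat n) (tr n (std_simplex (Suc k))) Y"
    by (intro precomp_in codegen_mono(1)) (auto simp: codegen_def)
next
  fix k i j :: nat and f :: "nat \<Rightarrow> nat list \<Rightarrow> 'a" assume "2 \<le> k" "i < j" "j \<le> k"
  then show "precomp n (k - 1 - 1) (coface i) (precomp n (k - 1) (coface j) f)
    = precomp n (k - 1 - 1) (coface (j - 1)) (precomp n (k - 1) (coface i) f)"
    by (intro precomp_commute coface_mono) (auto simp: coface_def)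
next
  fix k i j :: nat and f :: "nat \<Rightarrow> nat list \<Rightarrow> 'a" assume "i < j" "j \<le> k"
  then show "precomp n (Suc k - 1) (coface i) (precomp n (Suc k) (codegen j) f)
    = precomp n (Suc (k - 1)) (codegen (j - 1)) (precomp n (k - 1) (coface i) f)"
    by (cases k) (auto intro!: precomp_commute coface_mono codegen_mono simp: coface_def codegen_def)
next
  fix k i j :: nat and f assume "j \<le> k" "i = j \<or> i = Suc j" "f \<in> smaps (enat n) (tr n (std_simplex k)) Y"
  then show "precomp n (Suc k - 1) (coface i) (precomp n (Suc k) (codegen j) f) = f"
    by (subst precomp_precomp[OF coface_mono(1) _ refl])
       (auto intro!: precomp_id simp: coface_def codegen_def)
next
  fix k i j :: nat and f :: "nat \<Rightarrow> nat list \<Rightarrow> 'a" assume "Suc j < i" "i \<le> Suc k"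
  then show "precomp n (Suc k - 1) (coface i) (precomp n (Suc k) (codegen j) f)
    = precomp n (Suc (k - 1)) (codegen j) (precomp n (k - 1) (coface (i - 1)) f)"
    by (cases k) (auto intro!: precomp_commute coface_mono codegen_mono simp: coface_def codegen_def)
next
  fix k i j :: nat and f :: "nat \<Rightarrow> nat list \<Rightarrow> 'a" assume "i \<le> j" "j \<le> k"
  then show "precomp n (Suc (Suc k)) (codegen i) (precomp n (Suc k) (codegen j) f)
    = precomp n (Suc (Suc k)) (codegen (Suc j)) (precomp n (Suc k) (codegen i) f)"
    by (intro precomp_commute codegen_mono) (auto simp: codegen_def)
qed

definition counit :: "nat \<Rightarrow> (nat \<Rightarrow> nat list \<Rightarrow> 'a) \<Rightarrow> 'a" where
  "counit k f = f k [0..<Suc k]"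

lemma fundamental_in: "[0..<Suc m] \<in> cells (std_simplex m) m"
  by (auto simp: in_std_simplex simp del: upt_Suc)

text \<open>The transpose of a map \<open>g : tr n X \<rightarrow> Y\<close>.\<close>

definition transpose_map :: "nat \<Rightarrow> 'a sset \<Rightarrow> (nat \<Rightarrow> 'a \<Rightarrow> 'b) \<Rightarrow> nat \<Rightarrow> 'a \<Rightarrow> nat \<Rightarrow> nat list \<Rightarrow> 'b" where
  "transpose_map n X g = (\<lambda>m. \<lambda>x \<in> cells X m. \<lambda>k. \<lambda>l \<in> cells (tr n (std_simplex m)) k.
     g k (action X m l x))"

lemma transpose_map_in:
  assumes X: "simplicial_set X" and g: "g \<in> smaps (enat n) (tr n X) Y"
  shows "transpose_map n X g \<in> smaps \<infinity> X (cosk n Y)"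
proof -
  let ?h = "transpose_map n X g"
  have ext: "?h m x k \<in> extensional (cells (tr n (std_simplex m)) k)" if "x \<in> cells X m" for m x k
    using that by (simp add: transpose_map_def)
  have app: "?h m x k l = g k (action X m l x)"
    if "x \<in> cells X m" "k \<le> n" "l \<in> cells (std_simplex m) k" for m x k l
    using that by (simp add: transpose_map_def cells_tr)
  have g1: "g k x \<in> cells Y k" if "k \<le> n" "x \<in> cells X k" for k x
    using g that unfolding smaps_def by (auto simp: cells_tr)
  have g2: "g (k - 1) (face X k i x) = face Y k i (g k x)"
    if "k \<le> n" "1 \<le> k" "i \<le> k" "x \<in> cells X k" for k i x
    using g that unfolding smaps_def by (simp add: cells_tr)
  have g3: "g (Suc k) (degen X k i x) = degen Y k i (g k x)"
    if "Suc k \<le> n" "i \<le> k" "x \<in> cells X k" for k i x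
    using g that unfolding smaps_def by (simp add: cells_tr)
  have "?h m x \<in> smaps (enat n) (tr n (std_simplex m)) Y" if x: "x \<in> cells X m" for m x
    unfolding smaps_tr_iff
  proof (intro conjI allI impI; (elim conjE)?)
    show "?h m x k \<in> extensional (cells (tr n (std_simplex m)) k)" for k by (rule ext[OF x])
  next
    fix k l assume h: "k \<le> n" "l \<in> cells (std_simplex m) k"
    show "?h m x k l \<in> cells Y k"
      unfolding app[OF x h] by (rule g1[OF h(1) action_in[OF X h(2) x]])
  next
    fix k i l assume h: "k \<le> n" "1 \<le> k" "i \<le> k" "l \<in> cells (std_simplex m) k"
    have "k - 1 \<le> n" using h by simp
    then show "?h m x (k - 1) (omit_nth i l) = face Y k i (?h m x k l)"
      using app[OF x _ std_simplex_face_in[OF h(2-4)]]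
      by (simp only: app[OF x h(1,4)] action_face[OF X h(4,2,3) x]
          g2[OF h(1-3) action_in[OF X h(4) x]])
  next
    fix k i l assume h: "Suc k \<le> n" "i \<le> k" "l \<in> cells (std_simplex m) k"
    have k: "k \<le> n" using h by simp
    show "?h m x (Suc k) (repeat_nth i l) = degen Y k i (?h m x k l)"
      unfolding app[OF x h(1) std_simplex_degen_in[OF h(2,3)]] app[OF x k h(3)]
        action_degen[OF X h(3,2) x] by (rule g3[OF h(1,2) action_in[OF X h(3) x]])
  qed
  moreover have "?h (m - 1) (face X m i x) = precomp n (m - 1) (coface i) (?h m x)"
    if m: "1 \<le> m" "i \<le> m" "x \<in> cells X m" for m i x
  proof (rule smaps_tr_eqI[where n = n and m = "m - 1"])
    show "?h (m - 1) (face X m i x) k \<in> extensional (cells (tr n (std_simplex (m - 1))) k)" for k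
      by (rule ext[OF face_in[OF X m]])
    fix k l assume k: "k \<le> n" and l: "l \<in> cells (std_simplex (m - 1)) k"
    have "map (coface i) l \<in> cells (std_simplex m) k"
      and "action X (m - 1) l (face X m i x) = action X m (map (coface i) l) x"
      using action_coface[OF X l m] by blast+
    then show "?h (m - 1) (face X m i x) k l = precomp n (m - 1) (coface i) (?h m x) k l"
      unfolding precomp_apply[OF l k] app[OF face_in[OF X m] k l] by (simp only: app[OF m(3) k])
  qed (rule precomp_extensional)
  moreover have "?h (Suc m) (degen X m i x) = precomp n (Suc m) (codegen i) (?h m x)"
    if m: "i \<le> m" "x \<in> cells X m" for m i x
  proof (rule smaps_tr_eqI[where n = n and m = "Suc m"])
    show "?h (Suc m) (degen X m i x) k \<in> extensional (cells (tr n (std_simplex (Suc m))) k)" for k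
      by (rule ext[OF degen_in[OF X m]])
    fix k l assume k: "k \<le> n" and l: "l \<in> cells (std_simplex (Suc m)) k"
    have "map (codegen i) l \<in> cells (std_simplex m) k"
      and "action X (Suc m) l (degen X m i x) = action X m (map (codegen i) l) x"
      using action_codegen[OF X l m] by blast+
    then show "?h (Suc m) (degen X m i x) k l = precomp n (Suc m) (codegen i) (?h m x) k l"
      unfolding precomp_apply[OF l k] app[OF degen_in[OF X m] k l] by (simp only: app[OF m(2) k])
  qed (rule precomp_extensional)
  moreover have "?h m \<in> extensional (cells X m)" for m by (simp add: transpose_map_def)
  ultimately show ?thesis
    unfolding smaps_def[of \<infinity>] by (simp add: PiE_iff)
qed

lemma counit_transpose_map:
  assumes "simplicial_set X" "k \<le> n" "x \<in> cells X k"
  shows "counit k (transpose_map n X g k x) = g k x"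
  using assms fundamental_in[of k]
  by (simp add: counit_def transpose_map_def cells_tr action_id[OF assms(1)] del: upt_Suc)

lemma counit_natural:
  assumes f: "f \<in> cells (cosk n Y) k" and k: "k \<le> n"
  shows "counit k f \<in> cells Y k"
    and "\<lbrakk>1 \<le> k; i \<le> k\<rbrakk> \<Longrightarrow> counit (k - 1) (face (cosk n Y) k i f) = face Y k i (counit k f)"
    and "\<lbrakk>Suc k \<le> n; i \<le> k\<rbrakk> \<Longrightarrow> counit (Suc k) (degen (cosk n Y) k i f) = degen Y k i (counit k f)"
proof -
  let ?u = "[0..<Suc k]"
  note u = fundamental_in[of k]
  have f': "f \<in> smaps (enat n) (tr n (std_simplex k)) Y" using f by simp
  then show "counit k f \<in> cells Y k"
    using k u unfolding counit_def smaps_tr_iff by blast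
  show "counit (k - 1) (face (cosk n Y) k i f) = face Y k i (counit k f)" if i: "1 \<le> k" "i \<le> k"
  proof -
    have "k - 1 \<le> n" using k by simp
    moreover have "map (coface i) [0..<Suc (k - 1)] = omit_nth i ?u"
      using i by (intro nth_equalityI) (auto simp: coface_def simp del: upt_Suc)
    ultimately have "counit (k - 1) (face (cosk n Y) k i f) = f (k - 1) (omit_nth i ?u)"
      by (simp only: counit_def cosk_sel precomp_apply[OF fundamental_in])
    also have "\<dots> = face Y k i (f k ?u)"
      using f' k i u unfolding smaps_tr_iff by blast
    finally show ?thesis by (simp only: counit_def)
  qed
  show "counit (Suc k) (degen (cosk n Y) k i f) = degen Y k i (counit k f)" if i: "Suc k \<le> n" "i \<le> k"
  proof -
    have "map (codegen i) [0..<Suc (Suc k)] = repeat_nth i ?u"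
      using i by (intro nth_equalityI) (auto simp: codegen_def simp del: upt_Suc)
    then have "counit (Suc k) (degen (cosk n Y) k i f) = f (Suc k) (repeat_nth i ?u)"
      by (simp only: counit_def cosk_sel precomp_apply[OF fundamental_in i(1)])
    also have "\<dots> = degen Y k i (f k ?u)"
      using f' i u unfolding smaps_tr_iff by blast
    finally show ?thesis by (simp only: counit_def)
  qed
qed

lemma map_to_cosk_eq:
  assumes X: "simplicial_set X" and h: "h \<in> smaps \<infinity> X (cosk n Y)" and x: "x \<in> cells X m"
    and k: "k \<le> n" and l: "l \<in> cells (std_simplex m) k"
  shows "h m x k l = counit k (h k (action X m l x))"
proof -
  have h1: "h m x \<in> smaps (enat n) (tr n (std_simplex m)) Y" if "x \<in> cells X m" for m x
    using h that unfolding smaps_def[of \<infinity>] by auto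
  have h2: "h (k - 1) (face X k i x) = precomp n (k - 1) (coface i) (h k x)"
    if "1 \<le> k" "i \<le> k" "x \<in> cells X k" for k i x
    using h that unfolding smaps_def[of \<infinity>] by simp
  have h3: "h (Suc k) (degen X k i x) = precomp n (Suc k) (codegen i) (h k x)"
    if "i \<le> k" "x \<in> cells X k" for k i x
    using h that unfolding smaps_def[of \<infinity>] by simp
  have "h k (action X m l x) = precomp n k (nth l) (h m x)"
    using l
  proof (induction rule: std_simplex_induct)
    case id
    have "precomp n m (nth [0..<Suc m]) (h m x) = h m x"
      by (rule precomp_id[OF h1[OF x]]) (simp del: upt_Suc)
    then show ?case by (simp only: action_id[OF X])
  next
    case (face k l i)
    have "h (k - 1) (action X m (omit_nth i l) x)
      = precomp n (k - 1) (coface i) (precomp n k (nth l) (h m x))"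
      unfolding action_face[OF X face(1-3) x] h2[OF face(2,3) action_in[OF X face(1) x]] face(4) ..
    also have "\<dots> = precomp n (k - 1) (nth (omit_nth i l)) (h m x)"
      using face by (intro precomp_precomp coface_mono) (auto simp: coface_def in_std_simplex)
    finally show ?case .
  next
    case (degen k l i)
    have "h (Suc k) (action X m (repeat_nth i l) x)
      = precomp n (Suc k) (codegen i) (precomp n k (nth l) (h m x))"
      unfolding action_degen[OF X degen(1,2) x] h3[OF degen(2) action_in[OF X degen(1) x]] degen(3) ..
    also have "\<dots> = precomp n (Suc k) (nth (repeat_nth i l)) (h m x)"
      using degen by (intro precomp_precomp codegen_mono) (auto simp: codegen_def in_std_simplex)
    finally show ?case .
  qed
  then have "counit k (h k (action X m l x)) = h m x k (map (nth l) [0..<Suc k])"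
    by (simp only: counit_def precomp_apply[OF fundamental_in k])
  also have "map (nth l) [0..<Suc k] = l"
    using l map_nth[of l] by (simp add: in_std_simplex del: upt_Suc)
  finally show ?thesis ..
qed

text \<open>
  \<open>cosk n\<close> is right adjoint to \<open>tr n\<close>, with counit \<open>counit\<close>, and \<open>cosk_unit\<close> is the unit of this
  adjunction.
\<close>

lemma cosk_right_adjoint:
  assumes X: "simplicial_set X" and g: "g \<in> smaps (enat n) (tr n X) Y"
  shows "\<exists>!h. h \<in> smaps \<infinity> X (cosk n Y) \<and> (\<forall>k \<le> n. \<forall>x \<in> cells X k. counit k (h k x) = g k x)"
proof (rule ex1I[of _ "transpose_map n X g"])
  show "transpose_map n X g \<in> smaps \<infinity> X (cosk n Y) \<and>
      (\<forall>k \<le> n. \<forall>x \<in> cells X k. counit k (transpose_map n X g k x) = g k x)"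
    using transpose_map_in[OF X g] counit_transpose_map[OF X] by blast
next
  fix h assume h: "h \<in> smaps \<infinity> X (cosk n Y) \<and> (\<forall>k \<le> n. \<forall>x \<in> cells X k. counit k (h k x) = g k x)"
  then have hE: "h m \<in> cells X m \<rightarrow>\<^sub>E smaps (enat n) (tr n (std_simplex m)) Y" for m
    unfolding smaps_def[of \<infinity>] by simp
  show "h = transpose_map n X g"
  proof (rule ext, rule ext)
    fix m x
    show "h m x = transpose_map n X g m x"
    proof (cases "x \<in> cells X m")
      case True
      show ?thesis
      proof (rule smaps_tr_eqI[where n = n and m = m])
        show "h m x k \<in> extensional (cells (tr n (std_simplex m)) k)" for k
          using PiE_mem[OF hE True] unfolding smaps_tr_iff by blast
        show "transpose_map n X g m x k \<in> extensional (cells (tr n (std_simplex m)) k)" for k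
          using True by (simp add: transpose_map_def)
        fix k l assume k: "k \<le> n" and l: "l \<in> cells (std_simplex m) k"
        have "h m x k l = g k (action X m l x)"
          using map_to_cosk_eq[OF X conjunct1[OF h] True k l] h k action_in[OF X l True] by auto
        then show "h m x k l = transpose_map n X g m x k l"
          using True k l by (simp add: transpose_map_def cells_tr)
      qed
    next
      case False
      then show ?thesis using hE[of m] by (auto simp: transpose_map_def PiE_iff extensional_def)
    qed
  qed
qed

lemma cosk_unit_is_unit:
  assumes X: "simplicial_set X"
  shows "cosk_unit n X \<in> smaps \<infinity> X (Cosk n X)"
    and "\<lbrakk>k \<le> n; x \<in> cells X k\<rbrakk> \<Longrightarrow> counit k (cosk_unit n X k x) = x"
proof -
  define g where "g = (\<lambda>k. if k \<le> n then restrict (\<lambda>x. x) (cells X k) else (\<lambda>_. undefined))"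
  have gx: "g k x = x" if "k \<le> n" "x \<in> cells X k" for k x using that by (simp add: g_def)
  have "g \<in> smaps (enat n) (tr n X) (tr n X)"
    unfolding smaps_def
    by (auto simp: g_def cells_tr face_in[OF X, simplified] degen_in[OF X])
  moreover have e: "cosk_unit n X = transpose_map n X g"
    unfolding cosk_unit_def transpose_map_def
    by (intro ext) (auto simp: restrict_def cells_tr gx action_in[OF X])
  ultimately show "cosk_unit n X \<in> smaps \<infinity> X (Cosk n X)"
    unfolding Cosk_def using transpose_map_in[OF X] by metis
  show "counit k (cosk_unit n X k x) = x" if "k \<le> n" "x \<in> cells X k"
    unfolding e counit_transpose_map[OF X that] by (rule gx[OF that])
qed

end

theory Submission
  imports Defs
begin

text \<open>
  A matrix in \<open>N\<^sub>n(A, C)\<close> is best read row by row.  The \<open>i\<close>-th row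
  \<open>(m\<^sub>i\<^sub>i; m\<^sub>i\<^sub>,\<^sub>i\<^sub>+\<^sub>1, \<dots>, m\<^sub>i\<^sub>n)\<close> consists of an arrow \<open>x\<^sub>i \<rightarrow> x\<^sub>i\<^sub>-\<^sub>1\<close> and \<open>n - i\<close> elements of
  \<open>A(x\<^sub>i)\<close>.  Such rows are the morphisms of degree \<open>n - i\<close> of a simplicial category: for fixed
  ends they form the nerve of the category defined by the right action \<open>\<alpha> \<cdot> a = \<alpha> \<partial>a\<close> of \<open>A(s)\<close>
  on \<open>C(s, t)\<close>, and they are composed by
  \<open>(\<alpha>; a\<^sub>1, a\<^sub>2, \<dots>) (\<beta>; b\<^sub>1, b\<^sub>2, \<dots>) = (\<alpha> \<beta>; a\<^sub>1\<^bsup>\<beta>\<^esup> b\<^sub>1, a\<^sub>2\<^bsup>\<beta> \<partial>b\<^sub>1\<^esup> b\<^sub>2, \<dots>)\<close>.  The composition is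
  associative and compatible with faces by the two axioms that relate \<open>\<partial>\<close> to the action:
  equivariance and the Peiffer identity (\<open>twist_assoc\<close>, \<open>contract_twist\<close>,
  \<open>simplicial_category_rows\<close>).  In these terms the face and degeneracy formulas of the nerve are
  those of the \<open>W\<close>-bar construction, which yields a simplicial set for every simplicial category
  (\<open>simplicial_chains\<close>, \<open>matrix_face\<close>, \<open>matrix_degen\<close>).  So the nerve is a simplicial set.

  A simplicial set is \<open>n\<close>-coskeletal as soon as every boundary of dimension \<open>m > n\<close> has exactly one
  filler (\<open>coskeletalI\<close>).  The faces \<open>d\<^sub>0\<close> and \<open>d\<^sub>m\<close> of an \<open>m \<times> m\<close> matrix show all of its entries
  except the corner \<open>m\<^sub>1\<^sub>m\<close>, and this is the corner of \<open>d\<^sub>2\<close> if \<open>m \<ge> 4\<close>.  Hence \<open>d\<^sub>0\<close>, \<open>d\<^sub>2\<close> and \<open>d\<^sub>m\<close>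
  determine a matrix for \<open>m \<ge> 4\<close>, and the corresponding members of a boundary can be glued to
  one.  For \<open>m \<ge> 5\<close> this matrix has the other prescribed faces as well, as one sees by comparing
  them through the same three faces, in dimension \<open>m - 1 \<ge> 4\<close> (\<open>unique_filler_from_three_faces\<close>).
\<close>

section \<open>Coskeletality through boundary fillers\<close>

text \<open>
  The \<open>m + 1\<close> faces of a boundary \<open>\<partial>\<Delta>[m] \<rightarrow> X\<close>.  The guard \<open>2 \<le> m\<close> is there because vertices have
  no faces.
\<close>

definition compatible :: "'a sset \<Rightarrow> nat \<Rightarrow> (nat \<Rightarrow> 'a) \<Rightarrow> bool" where
  "compatible X m y \<longleftrightarrow> (\<forall>i \<le> m. y i \<in> cells X (m - 1)) \<and>
     (2 \<le> m \<longrightarrow> (\<forall>i j. i < j \<and> j \<le> m \<longrightarrow> face X (m - 1) i (y j) = face X (m - 1) (j - 1) (y i)))"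

definition unique_filler :: "'a sset \<Rightarrow> nat \<Rightarrow> (nat \<Rightarrow> 'a) \<Rightarrow> bool" where
  "unique_filler X m y \<longleftrightarrow> (\<exists>!x. x \<in> cells X m \<and> (\<forall>i \<le> m. face X m i x = y i))"

lemma sset_isoI:
  assumes X: "simplicial_set X" and f: "f \<in> smaps \<infinity> X Y"
    and bij: "\<And>k. bij_betw (f k) (cells X k) (cells Y k)"
  shows "sset_iso X Y f"
proof -
  define g where "g = (\<lambda>k. \<lambda>y \<in> cells Y k. inv_into (cells X k) (f k) y)"
  have f_face: "f (k - 1) (face X k i x) = face Y k i (f k x)"
    if "1 \<le> k" "i \<le> k" "x \<in> cells X k" for k i x
    using f that unfolding smaps_def by simp
  have f_degen: "f (Suc k) (degen X k i x) = degen Y k i (f k x)"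
    if "i \<le> k" "x \<in> cells X k" for k i x
    using f that unfolding smaps_def by simp
  have gf: "g k (f k x) = x" if "x \<in> cells X k" for k x
    using bij[of k] that by (auto simp: g_def bij_betw_def inv_into_f_f)
  have surj: "\<exists>x \<in> cells X k. y = f k x" if "y \<in> cells Y k" for k y
    using bij[of k] that by (auto simp: bij_betw_def)
  have fg: "f k (g k y) = y" if "y \<in> cells Y k" for k y
    using surj[OF that] gf by auto
  have "g k \<in> cells Y k \<rightarrow>\<^sub>E cells X k" for k
    using surj gf by (auto simp: PiE_iff g_def restrict_extensional) (metis gf g_def restrict_apply)
  moreover have "g (k - 1) (face Y k i y) = face X k i (g k y)"
    if "1 \<le> k" "i \<le> k" "y \<in> cells Y k" for k i y
    using surj[OF that(3)] f_face[OF that(1,2)] gf face_in[OF X that(1,2)] by metis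
  moreover have "g (Suc k) (degen Y k i y) = degen X k i (g k y)"
    if "i \<le> k" "y \<in> cells Y k" for k i y
    using surj[OF that(2)] f_degen[OF that(1)] gf degen_in[OF X that(1)] by metis
  ultimately have "g \<in> smaps \<infinity> Y X" unfolding smaps_def by simp
  then show ?thesis unfolding sset_iso_def using f gf fg by blast
qed

text \<open>\<open>\<Delta>[m]\<close> is the free simplicial set on its fundamental simplex (Yoneda).\<close>

lemma action_fundamental:
  assumes "l \<in> cells (std_simplex m) k"
  shows "action (std_simplex m) m l [0..<Suc m] = l"
  using assms
proof (induction rule: std_simplex_induct)
  case id
  then show ?case by (rule action_id[OF simplicial_std_simplex])
next
  case (face k l i)
  then show ?case
    using action_face[OF simplicial_std_simplex face(1-3) fundamental_in] face(4) by (simp del: upt_Suc)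
next
  case (degen k l i)
  then show ?case
    using action_degen[OF simplicial_std_simplex degen(1,2) fundamental_in] degen(3) by (simp del: upt_Suc)
qed

text \<open>
  A map of truncated simplicial sets commutes with the action of a monotone map between low
  dimensions because \<open>action\<close> applies all faces before any degeneracy, so that no intermediate
  dimension exceeds the bound.
\<close>

lemma smaps_tr_action:
  assumes W: "simplicial_set W" and X: "simplicial_set X" and g: "g \<in> smaps (enat n) (tr n W) (tr n X)"
    and m: "m \<le> n" and k: "k \<le> n" and l: "l \<in> cells (std_simplex m) k" and w: "w \<in> cells W m"
  shows "g k (action W m l w) = action X m l (g m w)"
proof -
  have g_face: "g (k - 1) (face W k i x) = face X k i (g k x)"
    if "k \<le> n" "1 \<le> k" "i \<le> k" "x \<in> cells W k" for k i x
    using g that unfolding smaps_def by (simp add: cells_tr)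
  have g_degen: "g (Suc k) (degen W k i x) = degen X k i (g k x)"
    if "Suc k \<le> n" "i \<le> k" "x \<in> cells W k" for k i x
    using g that unfolding smaps_def by (simp add: cells_tr)
  have faces: "g (m - length is) (faces_along W m is w) = faces_along X m is (g m w)"
    if "sorted_wrt (>) is" "set is \<subseteq> {..m}" "length is \<le> m" for "is"
    using that
  proof (induction "is" rule: rev_induct)
    case (snoc t "is")
    then have s: "sorted_wrt (>) is" "\<forall>j \<in> set is. t < j" "set is \<subseteq> {..m}" "length is < m" "t \<le> m"
      by (auto simp: sorted_wrt_append)
    have z: "faces_along W m is w \<in> cells W (m - length is)"
      using faces_along_in[OF W w] s by simp
    have "distinct is" using s(1) by (rule distinct_desc)
    moreover have "set is \<subseteq> {t<..m}" using s by auto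
    ultimately have "length is \<le> m - t"
      by (metis card_greaterThanAtMost card_mono distinct_card finite_greaterThanAtMost)
    then have t: "t \<le> m - length is" using s by simp
    have "g (m - length is - 1) (face W (m - length is) t (faces_along W m is w)) =
      face X (m - length is) t (g (m - length is) (faces_along W m is w))"
      using s m t z by (intro g_face) auto
    then show ?case
      using snoc.IH s by (simp add: faces_along_snoc[OF W] faces_along_snoc[OF X])
  qed simp
  have degens: "g (p + length js) (degens_along W p js x) = degens_along X p js (g p x)"
    if "sorted_wrt (<) js" "set js \<subseteq> {..<p + length js}" "p + length js \<le> n" "x \<in> cells W p"
    for js p x
    using that
  proof (induction js rule: rev_induct)
    case (snoc t js)
    then have s: "sorted_wrt (<) js" "set js \<subseteq> {..<p + length js}" "p + length js \<le> n"
      "t \<le> p + length js"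
      by (fastforce simp: sorted_wrt_append)+
    have z: "degens_along W p js x \<in> cells W (p + length js)"
      using degens_along_in[OF W] snoc.prems(4) s by blast
    show ?case
      using snoc.IH s snoc.prems z by (simp add: degens_along_snoc[OF W] degens_along_snoc[OF X] g_degen)
  qed simp
  note a = action_facts[OF W l w]
  have "g k (degens_along W (m - length (missed m l)) (repeats l) (faces_along W m (missed m l) w)) =
    degens_along X (m - length (missed m l)) (repeats l)
      (g (m - length (missed m l)) (faces_along W m (missed m l) w))"
    using degens[OF strict_repeats _ _ a(3), of l] a k by simp
  also have "g (m - length (missed m l)) (faces_along W m (missed m l) w) =
      faces_along X m (missed m l) (g m w)"
    using faces[OF strict_missed] a(1) by (simp add: set_missed)
  finally show ?thesis by (simp add: action_def)
qed

text \<open>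
  For \<open>m > n\<close> a monotone map \<open>[k] \<rightarrow> [m]\<close> with \<open>k \<le> n\<close> misses a vertex, so it factors through a
  coface.
\<close>

lemma cosk_cell_eqI:
  assumes f: "f \<in> cells (cosk n Y) m" and g: "g \<in> cells (cosk n Y) m" and nm: "n < m"
    and eq: "\<And>i. i \<le> m \<Longrightarrow> face (cosk n Y) m i f = face (cosk n Y) m i g"
  shows "f = g"
proof (rule smaps_tr_eqI[where n = n and m = m])
  show "f k \<in> extensional (cells (tr n (std_simplex m)) k)" for k
    using f by (simp add: smaps_tr_iff)
  show "g k \<in> extensional (cells (tr n (std_simplex m)) k)" for k
    using g by (simp add: smaps_tr_iff)
  fix k l assume k: "k \<le> n" and l: "l \<in> cells (std_simplex m) k"
  have "card (set l) < card {..m}"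
    using l k nm card_length[of l] by (simp add: in_std_simplex)
  then obtain i where i: "i \<le> m" "i \<notin> set l"
    by (metis atMost_iff card_mono finite_set linorder_not_le subsetI)
  define p where "p = (\<lambda>v. if v < i then v else v - 1 :: nat)"
  have p: "map p l \<in> cells (std_simplex (m - 1)) k"
    using i nm by (intro map_in_std_simplex[OF l]) (auto simp: p_def mono_on_def)
  have "map (coface i) (map p l) = l"
    unfolding map_map
  proof (rule map_idI)
    fix v assume "v \<in> set l"
    then have "v \<noteq> i" using i(2) by blast
    then show "(coface i \<circ> p) v = v" by (auto simp: p_def coface_def)
  qed
  then show "f k l = g k l"
    using fun_cong[OF fun_cong[OF eq[OF i(1)]], of k "map p l"]
    by (simp del: map_map One_nat_def add: precomp_apply[OF p k])
qed

text \<open>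
  By induction on \<open>m\<close> the unit is bijective in dimension \<open>m\<close>.  For \<open>m \<le> n\<close> a map from
  \<open>tr n \<Delta>[m]\<close> is determined by its value at the fundamental simplex.  For \<open>m > n\<close> the faces of an
  \<open>m\<close>-simplex of the coskeleton come from unique cells of \<open>X\<close> by the induction hypothesis; these
  form a boundary, and its filler is the only possible preimage.
\<close>

lemma coskeletalI:
  assumes X: "simplicial_set X"
    and fill: "\<And>m y. \<lbrakk>n < m; compatible X m y\<rbrakk> \<Longrightarrow> unique_filler X m y"
  shows "coskeletal n X"
proof -
  let ?Z = "Cosk n X" and ?u = "cosk_unit n X"
  note u = cosk_unit_is_unit(1)[OF X, of n]
  have Z: "simplicial_set ?Z" unfolding Cosk_def by (rule simplicial_cosk)
  have u_in: "?u k x \<in> cells ?Z k" if "x \<in> cells X k" for k x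
    using u that unfolding smaps_def[of \<infinity>] by auto
  have u_face: "?u (k - 1) (face X k i x) = face ?Z k i (?u k x)"
    if "1 \<le> k" "i \<le> k" "x \<in> cells X k" for k i x
    using u that unfolding smaps_def[of \<infinity>] by simp
  have bij: "bij_betw (?u m) (cells X m) (cells ?Z m)" for m
  proof (induction m rule: less_induct)
    case (less m)
    show ?case
    proof (cases "m \<le> n")
      case True
      have "\<exists>x \<in> cells X m. ?u m x = f" if f: "f \<in> cells ?Z m" for f
      proof (rule bexI)
        have f': "f \<in> smaps (enat n) (tr n (std_simplex m)) (tr n X)"
          using f by (simp add: Cosk_def)
        let ?x = "f m [0..<Suc m]"
        show x: "?x \<in> cells X m"
          using f' True fundamental_in[of m] unfolding smaps_tr_iff cells_tr by fastforce
        show "?u m ?x = f"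
        proof (rule smaps_tr_eqI[where n = n and m = m])
          show "?u m ?x k \<in> extensional (cells (tr n (std_simplex m)) k)" for k
            using x by (simp add: cosk_unit_def del: upt_Suc)
          show "f k \<in> extensional (cells (tr n (std_simplex m)) k)" for k
            using f' by (simp add: smaps_tr_iff)
          fix k l assume kl: "k \<le> n" "l \<in> cells (std_simplex m) k"
          then show "?u m ?x k l = f k l"
            using smaps_tr_action[OF simplicial_std_simplex X f' True kl fundamental_in]
            by (simp add: cosk_unit_def x action_fundamental cells_tr del: upt_Suc)
        qed
      qed
      then show ?thesis
        using u_in cosk_unit_is_unit(2)[OF X True]
        by (auto simp: bij_betw_def intro!: inj_on_inverseI[where g = "counit m"])
    next
      case False
      then have m: "n < m" "1 \<le> m" by auto
      have inj': "x = x'" if "x \<in> cells X k" "x' \<in> cells X k" "?u k x = ?u k x'" "k < m" for k x x'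
        using less[OF that(4)] that by (auto simp: bij_betw_def inj_on_def)
      have "?u m x \<noteq> ?u m x'"
        if x: "x \<in> cells X m" "x' \<in> cells X m" and ne: "x \<noteq> x'" for x x'
      proof
        assume e: "?u m x = ?u m x'"
        have eq: "face X m i x = face X m i x'" if "i \<le> m" for i
          using u_face[OF m(2) that] face_in[OF X m(2) that] x e m by (intro inj'[of _ "m - 1"]) auto
        have "compatible X m (\<lambda>i. face X m i x)"
          using face_in[OF X m(2) _ x(1)] face_face[OF X _ _ _ x(1)] by (simp add: compatible_def)
        from fill[OF m(1) this] have "x = x'"
          using x eq unfolding unique_filler_def by metis
        with ne show False by simp
      qed
      moreover have "\<exists>x \<in> cells X m. ?u m x = f" if f: "f \<in> cells ?Z m" for f
      proof -
        have "\<exists>y \<in> cells X (m - 1). ?u (m - 1) y = face ?Z m i f" if "i \<le> m" for i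
          using less[of "m - 1"] face_in[OF Z m(2) that f] m unfolding bij_betw_def
          by (metis diff_less imageE less_le_trans zero_less_one)
        then obtain y where y: "\<And>i. i \<le> m \<Longrightarrow> y i \<in> cells X (m - 1)"
          "\<And>i. i \<le> m \<Longrightarrow> ?u (m - 1) (y i) = face ?Z m i f" by metis
        have "face X (m - 1) i (y j) = face X (m - 1) (j - 1) (y i)"
          if ij: "2 \<le> m" "i < j" "j \<le> m" for i j
        proof (rule inj'[of _ "m - 1 - 1"])
          have b: "1 \<le> m - 1" "i \<le> m - 1" "j - 1 \<le> m - 1" "i \<le> m" using ij by auto
          show "face X (m - 1) i (y j) \<in> cells X (m - 1 - 1)"
            "face X (m - 1) (j - 1) (y i) \<in> cells X (m - 1 - 1)"
            by (intro face_in[OF X] b y ij)+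
          show "?u (m - 1 - 1) (face X (m - 1) i (y j)) = ?u (m - 1 - 1) (face X (m - 1) (j - 1) (y i))"
            unfolding u_face[OF b(1,2) y(1)[OF ij(3)]] u_face[OF b(1,3) y(1)[OF b(4)]] y(2)[OF ij(3)] y(2)[OF b(4)]
            by (rule face_face[OF Z ij f])
        qed (use ij in simp)
        then have "compatible X m y" using y by (simp add: compatible_def)
        from fill[OF m(1) this] obtain x where x: "x \<in> cells X m" "\<And>i. i \<le> m \<Longrightarrow> face X m i x = y i"
          unfolding unique_filler_def by blast
        have "?u m x = f"
        proof (rule cosk_cell_eqI[OF _ _ m(1)])
          show "?u m x \<in> cells (cosk n (tr n X)) m" "f \<in> cells (cosk n (tr n X)) m"
            using u_in[OF x(1)] f unfolding Cosk_def .
          show "face (cosk n (tr n X)) m i (?u m x) = face (cosk n (tr n X)) m i f" if "i \<le> m" for i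
            using u_face[OF m(2) that x(1)] y(2)[OF that] x(2)[OF that] unfolding Cosk_def by metis
        qed
        with x(1) show ?thesis by blast
      qed
      ultimately show ?thesis
        using u_in unfolding bij_betw_def inj_on_def by blast
    qed
  qed
  show ?thesis unfolding coskeletal_def using X sset_isoI[OF X u bij] by blast
qed

text \<open>
  Three faces are enough to control a boundary.  If \<open>d\<^sub>0\<close>, \<open>d\<^sub>2\<close>, \<open>d\<^sub>m\<close> are jointly injective in all
  dimensions \<open>m \<ge> n\<close>, then a cell with the prescribed faces number \<open>0\<close>, \<open>2\<close> and \<open>m\<close> has the other
  prescribed faces as well: the compatibility conditions give the faces \<open>0\<close>, \<open>2\<close> and \<open>m - 1\<close> of
  \<open>y\<^sub>j\<close>, directly for \<open>j > 2\<close> and then through \<open>y\<^sub>3\<close> for \<open>j = 1\<close>.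
\<close>

lemma unique_filler_from_three_faces:
  assumes X: "simplicial_set X" and m: "4 \<le> n" "n < m" and y: "compatible X m y"
    and inj: "\<And>k x x'. \<lbrakk>n \<le> k; x \<in> cells X k; x' \<in> cells X k; face X k 0 x = face X k 0 x';
      face X k 2 x = face X k 2 x'; face X k k x = face X k k x'\<rbrakk> \<Longrightarrow> x = x'"
    and ex: "\<exists>x \<in> cells X m. face X m 0 x = y 0 \<and> face X m 2 x = y 2 \<and> face X m m x = y m"
  shows "unique_filler X m y"
proof -
  obtain x where x: "x \<in> cells X m" and e: "face X m 0 x = y 0" "face X m 2 x = y 2" "face X m m x = y m"
    using ex by blast
  have y_in: "y i \<in> cells X (m - 1)" if "i \<le> m" for i using y that by (simp add: compatible_def)
  have y_face: "face X (m - 1) i (y j) = face X (m - 1) (j - 1) (y i)" if "i < j" "j \<le> m" for i j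
    using y that m by (simp add: compatible_def)
  have x_face: "face X (m - 1) i (face X m j x) = face X (m - 1) (j - 1) (face X m i x)"
    if "i < j" "j \<le> m" for i j
    using face_face[OF X _ that x] m by simp
  have x_in: "face X m j x \<in> cells X (m - 1)" if "j \<le> m" for j
    using face_in[OF X _ that x] m by simp
  have step: "face X m j x = y j"
    if j: "1 \<le> j" "j < m" "face X (m - 1) 2 (face X m j x) = face X (m - 1) 2 (y j)" for j
  proof (rule inj[of "m - 1"])
    show "face X (m - 1) 0 (face X m j x) = face X (m - 1) 0 (y j)"
      using x_face[of 0 j] y_face[of 0 j] j e by simp
    show "face X (m - 1) (m - 1) (face X m j x) = face X (m - 1) (m - 1) (y j)"
      using x_face[of j m] y_face[of j m] j e by simp
  qed (use m j x_in y_in in auto)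
  have gt2: "face X m j x = y j" if "2 < j" "j < m" for j
    using x_face[of 2 j] y_face[of 2 j] that e by (intro step) auto
  have "face X m 1 x = y 1"
    using x_face[of 1 3] y_face[of 1 3] gt2[of 3] m by (intro step) auto
  then have "face X m j x = y j" if "j \<le> m" for j
    using that e gt2[of j] by (metis Suc_1 le_neq_implies_less less_one linorder_neqE_nat not_less_eq)
  moreover have "x' = x" if "x' \<in> cells X m" "\<forall>i \<le> m. face X m i x' = y i" for x'
    using that(2) m by (intro inj[OF _ that(1) x]) (simp_all add: e)
  ultimately show ?thesis using x unfolding unique_filler_def by blast
qed

text \<open>
  Structure is transported along the images of cells, so that it need not be known beforehand that
  the faces and degeneracies of \<open>X\<close> are cells.
\<close>

lemma simplicial_set_transfer:
  assumes Y: "simplicial_set Y"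
    and onto: "\<And>k. \<psi> k ` cells Y k = cells X k"
    and \<psi>_face: "\<And>k i y. \<lbrakk>1 \<le> k; i \<le> k; y \<in> cells Y k\<rbrakk> \<Longrightarrow> face X k i (\<psi> k y) = \<psi> (k - 1) (face Y k i y)"
    and \<psi>_degen: "\<And>k i y. \<lbrakk>i \<le> k; y \<in> cells Y k\<rbrakk> \<Longrightarrow> degen X k i (\<psi> k y) = \<psi> (Suc k) (degen Y k i y)"
  shows "simplicial_set X"
proof -
  have \<psi>_in: "\<psi> k y \<in> cells X k" if "y \<in> cells Y k" for k y using onto that by blast
  note d_in = face_in[OF Y] and s_in = degen_in[OF Y]
  show ?thesis
    unfolding simplicial_upto_def onto[symmetric]
  proof (intro conjI allI impI; elim conjE imageE)
    fix k i x y assume "1 \<le> k" "i \<le> k" "x = \<psi> k y" "y \<in> cells Y k"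
    then show "face X k i x \<in> \<psi> (k - 1) ` cells Y (k - 1)" using d_in by (simp add: \<psi>_face)
  next
    fix k i x y assume "i \<le> k" "x = \<psi> k y" "y \<in> cells Y k"
    then show "degen X k i x \<in> \<psi> (Suc k) ` cells Y (Suc k)" using s_in by (simp add: \<psi>_degen)
  next
    fix k i j x y assume h: "2 \<le> k" "i < j" "j \<le> k" "x = \<psi> k y" "y \<in> cells Y k"
    then have b: "1 \<le> k" "i \<le> k" "1 \<le> k - 1" "i \<le> k - 1" "j - 1 \<le> k - 1" by auto
    show "face X (k - 1) i (face X k j x) = face X (k - 1) (j - 1) (face X k i x)"
      unfolding h(4) \<psi>_face[OF b(1) h(3,5)] \<psi>_face[OF b(1,2) h(5)]
        \<psi>_face[OF b(3,4) d_in[OF b(1) h(3,5)]] \<psi>_face[OF b(3,5) d_in[OF b(1,2) h(5)]]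
        face_face[OF Y h(1-3,5)] ..
  next
    fix k i j x y assume h: "i < j" "j \<le> k" "x = \<psi> k y" "y \<in> cells Y k"
    then have b: "1 \<le> k" "i \<le> k" "i \<le> Suc k" "j - 1 \<le> k - 1" "1 \<le> Suc k" "Suc (k - 1) = k" "Suc k - 1 = k"
      by auto
    show "face X (Suc k) i (degen X k j x) = degen X (k - 1) (j - 1) (face X k i x)"
      unfolding h(3) \<psi>_face[OF b(1,2) h(4)] \<psi>_degen[OF h(2,4)] \<psi>_face[OF b(5,3) s_in[OF h(2,4)]]
        \<psi>_degen[OF b(4) d_in[OF b(1,2) h(4)]] face_degen_less[OF Y h(1,2,4)] b(6,7) ..
  next
    fix k i j x y assume h: "j \<le> k" "i = j \<or> i = Suc j" "x = \<psi> k y" "y \<in> cells Y k"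
    then have "1 \<le> Suc k" "i \<le> Suc k" by auto
    from \<psi>_face[OF this s_in[OF h(1,4)]] show "face X (Suc k) i (degen X k j x) = x"
      unfolding h(3) \<psi>_degen[OF h(1,4)] by (simp add: face_degen_eq[OF Y h(1,2,4)])
  next
    fix k i j x y assume h: "Suc j < i" "i \<le> Suc k" "x = \<psi> k y" "y \<in> cells Y k"
    then have b: "1 \<le> k" "i - 1 \<le> k" "j \<le> k" "j \<le> k - 1" "1 \<le> Suc k" "Suc (k - 1) = k" "Suc k - 1 = k"
      by auto
    show "face X (Suc k) i (degen X k j x) = degen X (k - 1) j (face X k (i - 1) x)"
      unfolding h(3) \<psi>_face[OF b(1,2) h(4)] \<psi>_degen[OF b(3) h(4)] \<psi>_face[OF b(5) h(2) s_in[OF b(3) h(4)]]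
        \<psi>_degen[OF b(4) d_in[OF b(1,2) h(4)]] face_degen_greater[OF Y h(1,2,4)] b(6,7) ..
  next
    fix k i j x y assume h: "i \<le> j" "j \<le> k" "x = \<psi> k y" "y \<in> cells Y k"
    then have b: "i \<le> k" "i \<le> Suc k" "Suc j \<le> Suc k" by auto
    show "degen X (Suc k) i (degen X k j x) = degen X (Suc k) (Suc j) (degen X k i x)"
      unfolding h(3) \<psi>_degen[OF h(2,4)] \<psi>_degen[OF b(1) h(4)] \<psi>_degen[OF b(2) s_in[OF h(2,4)]]
        \<psi>_degen[OF b(3) s_in[OF b(1) h(4)]] degen_degen[OF Y h(1,2,4)] ..
  qed
qed

lemma unique_filler_transfer:
  assumes Y: "simplicial_set Y" and m: "2 \<le> m"
    and bij: "\<And>k. bij_betw (\<psi> k) (cells Y k) (cells X k)"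
    and \<psi>_face: "\<And>k i y. \<lbrakk>1 \<le> k; i \<le> k; y \<in> cells Y k\<rbrakk> \<Longrightarrow> face X k i (\<psi> k y) = \<psi> (k - 1) (face Y k i y)"
    and fill: "\<And>y. compatible Y m y \<Longrightarrow> unique_filler Y m y"
    and z: "compatible X m z"
  shows "unique_filler X m z"
proof -
  have inj: "y = y'" if "\<psi> k y = \<psi> k y'" "y \<in> cells Y k" "y' \<in> cells Y k" for k y y'
    using bij[of k] that by (auto simp: bij_betw_def inj_on_def)
  have onto: "\<exists>y \<in> cells Y k. x = \<psi> k y" if "x \<in> cells X k" for k x
    using bij[of k] that by (auto simp: bij_betw_def)
  have \<psi>_in: "\<psi> k y \<in> cells X k" if "y \<in> cells Y k" for k y
    using bij[of k] that by (auto simp: bij_betw_def)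
  have "\<exists>u \<in> cells Y (m - 1). z i = \<psi> (m - 1) u" if "i \<le> m" for i
    using z that onto unfolding compatible_def by blast
  then obtain y where y: "\<And>i. i \<le> m \<Longrightarrow> y i \<in> cells Y (m - 1)" "\<And>i. i \<le> m \<Longrightarrow> z i = \<psi> (m - 1) (y i)"
    by metis
  have "face Y (m - 1) i (y j) = face Y (m - 1) (j - 1) (y i)" if ij: "i < j" "j \<le> m" for i j
  proof (rule inj)
    have b: "1 \<le> m - 1" "i \<le> m - 1" "j - 1 \<le> m - 1" "i \<le> m" using ij m by auto
    show "face Y (m - 1) i (y j) \<in> cells Y (m - 1 - 1)"
      "face Y (m - 1) (j - 1) (y i) \<in> cells Y (m - 1 - 1)"
      by (intro face_in[OF Y] b y ij)+
    show "\<psi> (m - 1 - 1) (face Y (m - 1) i (y j)) = \<psi> (m - 1 - 1) (face Y (m - 1) (j - 1) (y i))"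
      using z ij b m unfolding compatible_def
      by (metis \<psi>_face[OF b(1,2) y(1)[OF ij(2)]] \<psi>_face[OF b(1,3) y(1)[OF b(4)]] y(2)[OF ij(2)] y(2)[OF b(4)])
  qed
  then have "compatible Y m y" using y(1) by (simp add: compatible_def)
  from fill[OF this] obtain u where u: "u \<in> cells Y m" "\<And>i. i \<le> m \<Longrightarrow> face Y m i u = y i"
    and uniq: "\<And>u'. u' \<in> cells Y m \<Longrightarrow> (\<forall>i \<le> m. face Y m i u' = y i) \<Longrightarrow> u' = u"
    unfolding unique_filler_def by metis
  have m1: "1 \<le> m" using m by simp
  show ?thesis
    unfolding unique_filler_def
  proof (rule ex1I[of _ "\<psi> m u"])
    show "\<psi> m u \<in> cells X m \<and> (\<forall>i \<le> m. face X m i (\<psi> m u) = z i)"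
      using u y(2) \<psi>_in \<psi>_face[OF m1] by simp
    fix x assume x: "x \<in> cells X m \<and> (\<forall>i \<le> m. face X m i x = z i)"
    then obtain u' where u': "u' \<in> cells Y m" "x = \<psi> m u'" using onto by blast
    have "face Y m i u' = y i" if i: "i \<le> m" for i
    proof (rule inj)
      show "\<psi> (m - 1) (face Y m i u') = \<psi> (m - 1) (y i)"
        using \<psi>_face[OF m1 i u'(1)] x u'(2) y(2)[OF i] i by metis
    qed (use face_in[OF Y m1 i u'(1)] y(1)[OF i] in auto)
    then show "x = \<psi> m u" using uniq u' by blast
  qed
qed


section \<open>The classifying simplicial set of a simplicial category\<close>

text \<open>
  The operators \<open>\<delta>\<close> and \<open>\<sigma>\<close> are not indexed by the degree or by the objects of the morphism
  they act on: a morphism is meant to carry this information.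
\<close>

locale simplicial_category =
  fixes Ob :: "'o set"
    and K :: "nat \<Rightarrow> 'o \<Rightarrow> 'o \<Rightarrow> 'r set"
    and \<delta> \<sigma> :: "nat \<Rightarrow> 'r \<Rightarrow> 'r"
    and comp :: "'r \<Rightarrow> 'r \<Rightarrow> 'r"
    and unit :: "nat \<Rightarrow> 'o \<Rightarrow> 'r"
    and target :: "'r \<Rightarrow> 'o"
  assumes hom_simplicial:
      "\<lbrakk>s \<in> Ob; t \<in> Ob\<rbrakk> \<Longrightarrow> simplicial_set \<lparr>cells = \<lambda>n. K n s t, face = \<lambda>_. \<delta>, degen = \<lambda>_. \<sigma>\<rparr>"
    and K_Ob: "r \<in> K n s t \<Longrightarrow> s \<in> Ob \<and> t \<in> Ob"
    and target: "r \<in> K n s t \<Longrightarrow> target r = t"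
    and comp_in: "\<lbrakk>r \<in> K n s t; r' \<in> K n u s\<rbrakk> \<Longrightarrow> comp r r' \<in> K n u t"
    and comp_assoc: "\<lbrakk>r \<in> K n s t; r' \<in> K n u s; r'' \<in> K n v u\<rbrakk> \<Longrightarrow>
      comp (comp r r') r'' = comp r (comp r' r'')"
    and unit_in: "x \<in> Ob \<Longrightarrow> unit n x \<in> K n x x"
    and comp_unit: "r \<in> K n s t \<Longrightarrow> comp r (unit n s) = r"
    and unit_comp: "r \<in> K n s t \<Longrightarrow> comp (unit n t) r = r"
    and \<delta>_comp: "\<lbrakk>r \<in> K (Suc n) s t; r' \<in> K (Suc n) u s; i \<le> Suc n\<rbrakk> \<Longrightarrow>
      \<delta> i (comp r r') = comp (\<delta> i r) (\<delta> i r')"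
    and \<sigma>_comp: "\<lbrakk>r \<in> K n s t; r' \<in> K n u s; i \<le> n\<rbrakk> \<Longrightarrow> \<sigma> i (comp r r') = comp (\<sigma> i r) (\<sigma> i r')"
    and \<delta>_unit: "\<lbrakk>x \<in> Ob; i \<le> Suc n\<rbrakk> \<Longrightarrow> \<delta> i (unit (Suc n) x) = unit n x"
    and \<sigma>_unit: "\<lbrakk>x \<in> Ob; i \<le> n\<rbrakk> \<Longrightarrow> \<sigma> i (unit n x) = unit (Suc n) x"
begin

lemma hom_face_in: "r \<in> K (Suc n) s t \<Longrightarrow> i \<le> Suc n \<Longrightarrow> \<delta> i r \<in> K n s t"
  using face_in[OF hom_simplicial[of s t], of "Suc n" i r] K_Ob by fastforce

lemma hom_degen_in: "r \<in> K n s t \<Longrightarrow> i \<le> n \<Longrightarrow> \<sigma> i r \<in> K (Suc n) s t"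
  using degen_in[OF hom_simplicial[of s t], of i n r] K_Ob by fastforce

lemma hom_face_face: "\<lbrakk>r \<in> K (Suc (Suc n)) s t; i < j; j \<le> Suc (Suc n)\<rbrakk> \<Longrightarrow> \<delta> i (\<delta> j r) = \<delta> (j - 1) (\<delta> i r)"
  using face_face[OF hom_simplicial[of s t], of "Suc (Suc n)" i j r] K_Ob by fastforce

lemma hom_face_degen_less: "\<lbrakk>r \<in> K n s t; i < j; j \<le> n\<rbrakk> \<Longrightarrow> \<delta> i (\<sigma> j r) = \<sigma> (j - 1) (\<delta> i r)"
  using face_degen_less[OF hom_simplicial[of s t], of i j n r] K_Ob by fastforce

lemma hom_face_degen_eq: "\<lbrakk>r \<in> K n s t; j \<le> n; i = j \<or> i = Suc j\<rbrakk> \<Longrightarrow> \<delta> i (\<sigma> j r) = r"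
  using face_degen_eq[OF hom_simplicial[of s t], of j n i r] K_Ob by fastforce

lemma hom_face_degen_greater: "\<lbrakk>r \<in> K n s t; Suc j < i; i \<le> Suc n\<rbrakk> \<Longrightarrow> \<delta> i (\<sigma> j r) = \<sigma> j (\<delta> (i - 1) r)"
  using face_degen_greater[OF hom_simplicial[of s t], of j i n r] K_Ob by fastforce

lemma hom_degen_degen: "\<lbrakk>r \<in> K n s t; i \<le> j; j \<le> n\<rbrakk> \<Longrightarrow> \<sigma> i (\<sigma> j r) = \<sigma> (Suc j) (\<sigma> i r)"
  using degen_degen[OF hom_simplicial[of s t], of i j n r] K_Ob by fastforce

end

text \<open>
  An \<open>n\<close>-simplex is a string \<open>x\<^sub>0 \<leftarrow> x\<^sub>1 \<leftarrow> \<dots> \<leftarrow> x\<^sub>n\<close> of morphisms of degrees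
  \<open>n - 1, n - 2, \<dots>, 0\<close> (the codiagonal \<open>W\<close>-bar construction of Artin and Mazur), closed by its
  last object \<open>x\<^sub>n\<close>.
\<close>

datatype ('o, 'r) chain = Pt 'o | Row 'r "('o, 'r) chain"

primrec rows :: "('o, 'r) chain \<Rightarrow> 'r list" where
  "rows (Pt x) = []"
| "rows (Row r M) = r # rows M"

primrec end_ob :: "('o, 'r) chain \<Rightarrow> 'o" where
  "end_ob (Pt x) = x"
| "end_ob (Row r M) = end_ob M"

primrec chain_dim :: "('o, 'r) chain \<Rightarrow> nat" where
  "chain_dim (Pt x) = 0"
| "chain_dim (Row r M) = Suc (chain_dim M)"

context simplicial_category
begin

primrec top_ob :: "('o, 'r) chain \<Rightarrow> 'o" where
  "top_ob (Pt x) = x"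
| "top_ob (Row r M) = target r"

inductive chain_in :: "nat \<Rightarrow> 'o \<Rightarrow> ('o, 'r) chain \<Rightarrow> bool" where
  Pt_in: "x \<in> Ob \<Longrightarrow> chain_in 0 x (Pt x)"
| Row_in: "chain_in n s M \<Longrightarrow> r \<in> K n s t \<Longrightarrow> chain_in (Suc n) t (Row r M)"

lemma chain_in_0D: "chain_in 0 t M \<Longrightarrow> M = Pt t \<and> t \<in> Ob"
  by (erule chain_in.cases) auto

lemma chain_in_SucD: "chain_in (Suc n) t M \<Longrightarrow> \<exists>r s L. M = Row r L \<and> r \<in> K n s t \<and> chain_in n s L"
  by (erule chain_in.cases) auto

text \<open>
  The face formulas of the \<open>W\<close>-bar construction, as a recursion along the chain.  A point has no
  faces and is sent to itself as a default.
\<close>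

fun chain_face :: "nat \<Rightarrow> ('o, 'r) chain \<Rightarrow> ('o, 'r) chain" where
  "chain_face i (Pt x) = Pt x"
| "chain_face 0 (Row r M) = M"
| "chain_face (Suc 0) (Row r (Pt x)) = Pt (target r)"
| "chain_face (Suc 0) (Row r (Row r' M)) = Row (comp (\<delta> 0 r) r') M"
| "chain_face (Suc (Suc i)) (Row r M) = Row (\<delta> (Suc i) r) (chain_face (Suc i) M)"

fun chain_degen :: "nat \<Rightarrow> ('o, 'r) chain \<Rightarrow> ('o, 'r) chain" where
  "chain_degen 0 M = Row (unit (chain_dim M) (top_ob M)) M"
| "chain_degen (Suc i) (Row r M) = Row (\<sigma> i r) (chain_degen i M)"
| "chain_degen (Suc i) (Pt x) = Pt x"

primrec obs :: "('o, 'r) chain \<Rightarrow> 'o list" where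
  "obs (Pt x) = [x]"
| "obs (Row r M) = target r # obs M"

definition chains :: "('o, 'r) chain sset" where
  "chains = \<lparr>cells = \<lambda>n. {M. \<exists>t. chain_in n t M}, face = \<lambda>_. chain_face, degen = \<lambda>_. chain_degen\<rparr>"

lemma chains_sel [simp]:
  "M \<in> cells chains n \<longleftrightarrow> (\<exists>t. chain_in n t M)"
  "face chains n = chain_face" "degen chains n = chain_degen"
  by (simp_all add: chains_def)

lemma chain_in_facts: "chain_in n t M \<Longrightarrow> chain_dim M = n \<and> top_ob M = t \<and> t \<in> Ob"
  by (induction rule: chain_in.induct) (auto simp: target K_Ob)

lemma chain_face_0_in: "chain_in (Suc n) t M \<Longrightarrow> \<exists>s. chain_in n s (chain_face 0 M)"
  by (auto dest!: chain_in_SucD)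

lemma chain_face_Suc_in: "chain_in (Suc n) t M \<Longrightarrow> i \<le> n \<Longrightarrow> chain_in n t (chain_face (Suc i) M)"
proof (induction n arbitrary: t M i)
  case 0
  then obtain r x where "M = Row r (Pt x)" "r \<in> K 0 x t"
    using chain_in_SucD chain_in_0D by metis
  then show ?case using 0 K_Ob[of r] by (auto intro!: Pt_in simp: target)
next
  case (Suc n)
  obtain r s M' where M: "M = Row r M'" "chain_in (Suc n) s M'" "r \<in> K (Suc n) s t"
    using chain_in_SucD[OF Suc.prems(1)] by blast
  show ?case
  proof (cases i)
    case 0
    obtain r' u M'' where M': "M' = Row r' M''" "chain_in n u M''" "r' \<in> K n u s"
      using chain_in_SucD[OF M(2)] by blast
    with M 0 show ?thesis by (auto intro!: Row_in comp_in hom_face_in)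
  next
    case (Suc j)
    then have "chain_in n s (chain_face (Suc j) M')"
      using Suc.IH[OF M(2), of j] Suc.prems by simp
    then show ?thesis using Suc M Suc.prems by (auto intro!: Row_in hom_face_in)
  qed
qed

lemma chain_degen_in: "chain_in n t M \<Longrightarrow> i \<le> n \<Longrightarrow> chain_in (Suc n) t (chain_degen i M)"
proof (induction i arbitrary: n t M)
  case 0
  then show ?case using chain_in_facts[OF 0(1)] by (auto intro!: Row_in unit_in)
next
  case (Suc i)
  then obtain n' where n: "n = Suc n'" by (cases n) auto
  with Suc.prems obtain r s M' where "M = Row r M'" "chain_in n' s M'" "r \<in> K n' s t"
    using chain_in_SucD by blast
  then show ?case using Suc.IH Suc.prems n by (auto intro!: Row_in hom_degen_in)
qed

lemma chain_face_in: "chain_in (Suc n) t M \<Longrightarrow> i \<le> Suc n \<Longrightarrow> \<exists>s. chain_in n s (chain_face i M)"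
  using chain_face_0_in chain_face_Suc_in by (cases i) (simp, metis Suc_le_mono)

text \<open>
  For \<open>d\<^sub>1 d\<^sub>2\<close> the identity is the associativity of the composition with
  \<open>\<delta>\<^sub>0 \<delta>\<^sub>1 = \<delta>\<^sub>0 \<delta>\<^sub>0\<close>, and for \<open>d\<^sub>1 d\<^sub>j\<close> with \<open>j > 2\<close> the functoriality of \<open>\<delta>\<close>; all other
  cases are inherited from the homs and from the tail.
\<close>

lemma chain_face_face:
  "chain_in (Suc (Suc n)) t M \<Longrightarrow> i < j \<Longrightarrow> j \<le> Suc (Suc n) \<Longrightarrow>
     chain_face i (chain_face j M) = chain_face (j - 1) (chain_face i M)"
proof (induction n arbitrary: t M i j)
  case (0 t M i j)
  obtain r s r' x where M: "M = Row r (Row r' (Pt x))" "r \<in> K 1 s t" "r' \<in> K 0 x s"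
    using chain_in_SucD[OF 0(1)] by (auto dest!: chain_in_SucD chain_in_0D)
  have "target (comp (\<delta> 0 r) r') = target (\<delta> 1 r)"
    using M target[OF comp_in[OF hom_face_in[of r 0 s t 0] M(3)]] target[OF hom_face_in[of r 0 s t 1]] by simp
  moreover have "j = 1 \<or> j = 2" using 0 by auto
  ultimately show ?case using 0(2) M target[OF M(3)]
    by (auto simp: less_Suc_eq numeral_2_eq_2)
next
  case (Suc n)
  obtain r s L where L: "M = Row r L" "chain_in (Suc (Suc n)) s L" "r \<in> K (Suc (Suc n)) s t"
    using chain_in_SucD[OF Suc.prems(1)] by blast
  then obtain r' u M' where M: "M = Row r (Row r' M')" "chain_in (Suc (Suc n)) s (Row r' M')"
    "r \<in> K (Suc (Suc n)) s t" "r' \<in> K (Suc n) u s" "chain_in (Suc n) u M'"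
    using chain_in_SucD[OF L(2)] by blast
  then obtain r'' v M'' where M': "M' = Row r'' M''" "r'' \<in> K n v u" "chain_in n v M''"
    using chain_in_SucD[OF M(5)] by blast
  note [simp] = M(1) M'(1)
  consider "i = 0" "j = 1" | j' where "i = 0" "j = Suc (Suc j')" | "i = 1" "j = 2"
    | j' where "i = 1" "j = Suc (Suc (Suc j'))"
    | i' j' where "i = Suc (Suc i')" "j = Suc (Suc j')" "Suc i' < Suc j'"
    using Suc.prems(2) by (cases i; cases "i - 1"; cases j; cases "j - 1"; cases "j - 2") auto
  then show ?case
  proof cases
    case 3
    have "\<delta> 0 (\<delta> 1 r) = \<delta> 0 (\<delta> 0 r)" using hom_face_face[OF M(3), of 0 1] by simp
    then show ?thesis
      using 3 \<delta>_comp[OF hom_face_in[OF M(3), of 0] M(4), of 0]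
        comp_assoc[OF hom_face_in[OF hom_face_in[OF M(3)]] hom_face_in[OF M(4)] M'(2)]
      by (simp add: numeral_2_eq_2)
  next
    case 4
    then show ?thesis
      using hom_face_face[OF M(3), of 0 "Suc (Suc j')"] \<delta>_comp[OF hom_face_in[OF M(3), of 0] M(4), of "Suc j'"]
        Suc.prems(3) by simp
  next
    case 5
    obtain k where "j' = Suc k" using 5(3) by (cases j') auto
    with 5 show ?thesis
      using hom_face_face[OF M(3), of "Suc i'" "Suc j'"] Suc.IH[OF M(2), of "Suc i'" "Suc j'"] Suc.prems(3)
      by simp
  qed simp_all
qed

lemma chain_face_degen_less:
  "chain_in n t M \<Longrightarrow> i < j \<Longrightarrow> j \<le> n \<Longrightarrow> chain_face i (chain_degen j M) = chain_degen (j - 1) (chain_face i M)"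
proof (induction n arbitrary: t M i j)
  case (Suc n t M i j)
  obtain r s M' where M: "M = Row r M'" "chain_in n s M'" "r \<in> K n s t"
    using chain_in_SucD[OF Suc.prems(1)] by blast
  from Suc.prems obtain j' where j: "j = Suc j'" by (cases j) auto
  consider "i = 0" | "i = 1" "j' \<noteq> 0" | i' where "i = Suc (Suc i')" "j' \<noteq> 0"
    using Suc.prems(2) j by (cases i; cases "i - 1") auto
  then show ?case
  proof cases
    case 2
    then obtain k n' where k: "j' = Suc k" "n = Suc n'" using Suc.prems(3) j by (cases j'; cases n) auto
    obtain r' u M'' where M': "M' = Row r' M''" "r' \<in> K n' u s"
      using chain_in_SucD[of n' s M'] M(2) k by blast
    then show ?thesis
      using 2 j k M hom_face_degen_less[OF M(3), of 0 j'] Suc.prems(3)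
        \<sigma>_comp[of "\<delta> 0 r" n' s t r' u k] hom_face_in[of r n' s t 0] by simp
  next
    case 3
    then obtain k n' where k: "j' = Suc k" "n = Suc n'" using Suc.prems(3) j by (cases j'; cases n) auto
    show ?thesis
      using 3 j k M hom_face_degen_less[OF M(3), of "Suc i'" j'] Suc.prems(2,3) Suc.IH[OF M(2), of "Suc i'" j']
      by simp
  qed (use M j in simp)
qed simp

lemma chain_face_degen_eq:
  "chain_in n t M \<Longrightarrow> j \<le> n \<Longrightarrow> i = j \<or> i = Suc j \<Longrightarrow> chain_face i (chain_degen j M) = M"
proof (induction j arbitrary: n t M i)
  case (0 n t M i)
  show ?case
  proof (cases M)
    case (Row r M')
    then obtain n' s where "n = Suc n'" "r \<in> K n' s t"
      using 0(1) by (auto elim: chain_in.cases)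
    then show ?thesis
      using 0 Row chain_in_facts[OF 0(1)] \<delta>_unit[of t 0 n'] unit_comp[of r n' s t] by (auto simp: target)
  qed (use 0 chain_in_facts[OF 0(1)] target[OF unit_in] in \<open>auto\<close>)
next
  case (Suc j n t M i)
  then obtain n' where n: "n = Suc n'" by (cases n) auto
  with Suc.prems obtain r s M' where M: "M = Row r M'" "chain_in n' s M'" "r \<in> K n' s t"
    using chain_in_SucD by blast
  show ?case
  proof (cases "i = 1")
    case True
    then have "j = 0" using Suc.prems(3) by simp
    then show ?thesis
      using True M hom_face_degen_eq[OF M(3), of 0 0] chain_in_facts[OF M(2)] comp_unit[OF M(3)] by simp
  next
    case False
    then obtain i' where i: "i = Suc (Suc i')" using Suc.prems(3) by (cases i; cases "i - 1") auto
    then show ?thesis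
      using M n Suc.prems Suc.IH[OF M(2), of "Suc i'"] hom_face_degen_eq[OF M(3), of j "Suc i'"] by simp
  qed
qed

lemma chain_face_degen_greater:
  "chain_in n t M \<Longrightarrow> Suc j < i \<Longrightarrow> i \<le> Suc n \<Longrightarrow>
     chain_face i (chain_degen j M) = chain_degen j (chain_face (i - 1) M)"
proof (induction j arbitrary: n t M i)
  case (0 n t M i)
  then obtain i' n' where i: "i = Suc (Suc i')" and n: "n = Suc n'"
    by (cases i; cases "i - 1"; cases n) auto
  have "chain_in n' t (chain_face (Suc i') M)" using chain_face_Suc_in[of n' t M i'] 0 i n by simp
  from chain_in_facts[OF this] show ?case
    using chain_in_facts[OF 0(1)] \<delta>_unit[of t "Suc i'" n'] 0 i n by simp
next
  case (Suc j n t M i)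
  then obtain i' n' where i: "i = Suc (Suc (Suc i'))" and n: "n = Suc n'"
    by (cases i; cases "i - 1"; cases "i - 2"; cases n) auto
  with Suc.prems obtain r s M' where M: "M = Row r M'" "chain_in n' s M'" "r \<in> K n' s t"
    using chain_in_SucD by blast
  then show ?case
    using Suc.prems i n hom_face_degen_greater[OF M(3), of j "Suc (Suc i')"] Suc.IH[OF M(2), of "Suc (Suc i')"]
    by simp
qed

lemma chain_degen_degen:
  "chain_in n t M \<Longrightarrow> i \<le> j \<Longrightarrow> j \<le> n \<Longrightarrow> chain_degen i (chain_degen j M) = chain_degen (Suc j) (chain_degen i M)"
proof (induction i arbitrary: n t M j)
  case (0 n t M j)
  then show ?case
    using chain_in_facts[OF 0(1)] chain_in_facts[OF chain_degen_in[OF 0(1,3)]] \<sigma>_unit by simp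
next
  case (Suc i n t M j)
  then obtain j' n' where j: "j = Suc j'" and n: "n = Suc n'" by (cases j; cases n) auto
  with Suc.prems obtain r s M' where M: "M = Row r M'" "chain_in n' s M'" "r \<in> K n' s t"
    using chain_in_SucD by blast
  then show ?case
    using Suc.prems j n hom_degen_degen[OF M(3), of i j'] Suc.IH[OF M(2), of j'] by simp
qed

lemma simplicial_chains: "simplicial_set chains"
  unfolding simplicial_upto_def chains_sel
proof (intro conjI allI impI; (elim conjE exE)?)
  fix k i M t assume "1 \<le> k" "i \<le> k" "chain_in k t M"
  then show "\<exists>t. chain_in (k - 1) t (chain_face i M)" by (cases k) (auto dest: chain_face_in)
next
  fix k i j M t assume "2 \<le> k" "i < j" "j \<le> k" "chain_in k t M"
  then show "chain_face i (chain_face j M) = chain_face (j - 1) (chain_face i M)"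
    using chain_face_face[of "k - 2"] by (simp add: Suc_diff_Suc numeral_2_eq_2 le_Suc_eq)
qed (blast intro: chain_degen_in chain_face_degen_less chain_face_degen_eq chain_face_degen_greater
    chain_degen_degen)+

text \<open>
  In a chain \<open>Row r M\<close> of length \<open>m\<close>, \<open>d\<^sub>0\<close> forgets \<open>r\<close> only, and the first morphisms of \<open>d\<^sub>2\<close>
  and \<open>d\<^sub>m\<close> are \<open>\<delta>\<^sub>1 r\<close> and \<open>\<delta>\<^sub>m\<^sub>-\<^sub>1 r\<close>.  Questions about these three faces thus reduce to one about
  two faces in the homs.
\<close>

lemma chain_eqI_three_faces:
  assumes inj: "\<And>p s t r r'. \<lbrakk>3 \<le> p; r \<in> K p s t; r' \<in> K p s t; \<delta> 1 r = \<delta> 1 r'; \<delta> p r = \<delta> p r'\<rbrakk> \<Longrightarrow> r = r'"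
    and m: "4 \<le> m" and M: "M \<in> cells chains m" "M' \<in> cells chains m"
    and eq: "chain_face 0 M = chain_face 0 M'" "chain_face 2 M = chain_face 2 M'" "chain_face m M = chain_face m M'"
  shows "M = M'"
proof -
  obtain p where p: "m = Suc (Suc p)" "3 \<le> Suc p" using m by (intro that[of "m - 2"]) auto
  obtain r s t L r' s' t' L' where M': "M = Row r L" "r \<in> K (Suc p) s t" "chain_in (Suc p) s L"
     "M' = Row r' L'" "r' \<in> K (Suc p) s' t'" "chain_in (Suc p) s' L'"
    using M p chain_in_SucD unfolding chains_sel by metis
  have e: "L = L'" "\<delta> 1 r = \<delta> 1 r'" "\<delta> (Suc p) r = \<delta> (Suc p) r'"
    using eq M' p by (simp_all add: numeral_2_eq_2)
  have "s = s'" using M'(3,6) e(1) chain_in_facts by blast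
  moreover have "t = t'"
    using target[OF hom_face_in[OF M'(2), of 1]] target[OF hom_face_in[OF M'(5), of 1]] e(2) by simp
  ultimately show ?thesis using inj[OF p(2)] M' e by blast
qed

text \<open>
  The compatibility of \<open>y\<^sub>0\<close> with \<open>y\<^sub>2\<close> and \<open>y\<^sub>m\<close> says that the new morphism can be put in front
  of \<open>y\<^sub>0\<close>, and that of \<open>y\<^sub>2\<close> with \<open>y\<^sub>m\<close> is the hypothesis of \<open>ex\<close>.
\<close>

lemma chain_with_three_faces:
  assumes ex: "\<And>p s t t' r r'. \<lbrakk>3 \<le> p; r \<in> K (p - 1) s t; r' \<in> K (p - 1) s t'; \<delta> 1 r = \<delta> (p - 1) r'\<rbrakk> \<Longrightarrow>
      \<exists>q \<in> K p s t. \<delta> p q = r \<and> \<delta> 1 q = r'"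
    and m: "4 \<le> m" and y: "compatible chains m y"
  shows "\<exists>M \<in> cells chains m. chain_face 0 M = y 0 \<and> chain_face 2 M = y 2 \<and> chain_face m M = y m"
proof -
  obtain p where p: "m = Suc (Suc (Suc p))" "3 \<le> Suc (Suc p)" using m by (intro that[of "m - 3"]) auto
  have y_in: "\<exists>t. chain_in (Suc (Suc p)) t (y i)" if "i \<le> m" for i
    using y that p unfolding compatible_def by simp
  have y_face: "chain_face i (y j) = chain_face (j - 1) (y i)" if "i < j" "j \<le> m" for i j
    using y that p unfolding compatible_def by simp
  obtain s L where L: "y 0 = L" "chain_in (Suc (Suc p)) s L" using y_in[of 0] by blast
  obtain r s1 t L1 where r: "y m = Row r L1" "r \<in> K (Suc p) s1 t" "chain_in (Suc p) s1 L1"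
    using y_in[of m] chain_in_SucD by blast
  obtain r' s2 t' L2 where r': "y 2 = Row r' L2" "r' \<in> K (Suc p) s2 t'" "chain_in (Suc p) s2 L2"
    using y_in[of 2] p chain_in_SucD by force
  have L1: "L1 = chain_face (Suc (Suc p)) L" using y_face[of 0 m] r L p by simp
  have L2: "L2 = chain_face (Suc 0) L" using y_face[of 0 2] r' L p by simp
  have "chain_in (Suc p) s L1" "chain_in (Suc p) s L2"
    unfolding L1 L2 using chain_face_Suc_in[OF L(2)] by auto
  then have s: "s1 = s" "s2 = s" using r(3) r'(3) chain_in_facts by blast+
  have "\<delta> 1 r = \<delta> (Suc p) r'" using y_face[of 2 m] r r' p by (simp add: numeral_2_eq_2)
  then obtain q where q: "q \<in> K (Suc (Suc p)) s t" "\<delta> (Suc (Suc p)) q = r" "\<delta> 1 q = r'"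
    using ex[OF p(2), of r s t r' t'] r r' s by auto
  show ?thesis
    using q L L1 L2 r r' p Row_in[OF L(2) q(1)] by (intro bexI[of _ "Row q L"]) (auto simp: numeral_2_eq_2)
qed

lemma length_rows [simp]: "length (rows M) = chain_dim M"
  by (induction M) auto

lemma dim_chain_face [simp]: "j \<le> chain_dim M \<Longrightarrow> chain_dim (chain_face j M) = chain_dim M - 1"
  by (induction j M rule: chain_face.induct) auto

lemma dim_chain_degen [simp]: "j \<le> chain_dim M \<Longrightarrow> chain_dim (chain_degen j M) = Suc (chain_dim M)"
  by (induction j M rule: chain_degen.induct) auto

lemma rows_chain_face_0: "Suc p < chain_dim M \<Longrightarrow> rows (chain_face 0 M) ! p = rows M ! Suc p"
  by (cases M) auto

lemma rows_chain_face:
  "\<lbrakk>0 < j; j \<le> chain_dim M; Suc p < chain_dim M\<rbrakk> \<Longrightarrow> rows (chain_face j M) ! p =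
     (if Suc p < j then \<delta> (j - Suc p) (rows M ! p)
      else if Suc p = j then comp (\<delta> 0 (rows M ! p)) (rows M ! Suc p)
      else rows M ! Suc p)"
proof (induction j M arbitrary: p rule: chain_face.induct)
  case (5 i r M)
  then show ?case by (cases p) auto
qed (auto simp: nth_Cons split: nat.split)

lemma rows_chain_degen:
  "\<lbrakk>j \<le> chain_dim M; p \<le> chain_dim M\<rbrakk> \<Longrightarrow> rows (chain_degen j M) ! p =
     (if p < j then \<sigma> (j - Suc p) (rows M ! p)
      else if p = j then unit (chain_dim M - j) (obs M ! j)
      else rows M ! (p - 1))"
proof (induction j M arbitrary: p rule: chain_degen.induct)
  case (1 M)
  then show ?case by (cases p; cases M) auto
next
  case (2 i r M)
  then show ?case by (cases p) (auto simp: nth_Cons split: nat.split)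
qed auto

lemma chain_in_nth:
  "chain_in n t M \<Longrightarrow> length (obs M) = Suc n \<and> (\<forall>i \<le> n. obs M ! i \<in> Ob) \<and>
     obs M ! 0 = t \<and> obs M ! n = end_ob M \<and>
     (\<forall>i < n. rows M ! i \<in> K (n - Suc i) (obs M ! Suc i) (obs M ! i))"
proof (induction rule: chain_in.induct)
  case (Row_in n s M r t)
  then show ?case using K_Ob[of r n s t] by (auto simp: nth_Cons target split: nat.split)
qed simp

lemma chain_eqI: "rows M = rows M' \<Longrightarrow> end_ob M = end_ob M' \<Longrightarrow> M = M'"
proof (induction M arbitrary: M')
  case (Pt x)
  then show ?case by (cases M') auto
next
  case (Row r M)
  then show ?case by (cases M') auto
qed

lemma chain_ex:
  assumes x: "\<And>i. i \<le> n \<Longrightarrow> x i \<in> Ob"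
    and r: "\<And>i. i < n \<Longrightarrow> r i \<in> K (n - Suc i) (x (Suc i)) (x i)"
  shows "\<exists>M. chain_in n (x 0) M \<and> rows M = map r [0..<n] \<and> end_ob M = x n"
proof -
  have "\<exists>M. chain_in (n - m) (x m) M \<and> rows M = map r [m..<n] \<and> end_ob M = x n" if "m \<le> n" for m
    using that
  proof (induction m rule: inc_induct)
    case base
    then show ?case using x by (intro exI[of _ "Pt (x n)"]) (auto intro: Pt_in)
  next
    case (step m)
    then obtain M where M: "chain_in (n - Suc m) (x (Suc m)) M" "rows M = map r [Suc m..<n]" "end_ob M = x n"
      by blast
    have "chain_in (Suc (n - Suc m)) (x m) (Row (r m) M)"
      using M(1) r[of m] step by (intro Row_in) auto
    then show ?case using M step
      by (intro exI[of _ "Row (r m) M"]) (auto simp: Suc_diff_Suc upt_conv_Cons)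
  qed
  from this[of 0] show ?thesis by simp
qed

end

section \<open>Rows of matrices as morphisms of a simplicial category\<close>

text \<open>
  The inner faces of a string of monoid elements multiply two neighbours, and the last face, at
  the index of the last entry, drops this entry.
\<close>

fun contract :: "('a \<Rightarrow> 'a \<Rightarrow> 'a) \<Rightarrow> nat \<Rightarrow> 'a list \<Rightarrow> 'a list" where
  "contract m i [] = []"
| "contract m 0 [a] = []"
| "contract m 0 (a # b # l) = m a b # l"
| "contract m (Suc i) (a # l) = a # contract m i l"

fun insert_at :: "nat \<Rightarrow> 'a \<Rightarrow> 'a list \<Rightarrow> 'a list" where
  "insert_at 0 e l = e # l"
| "insert_at (Suc i) e [] = [e]"
| "insert_at (Suc i) e (a # l) = a # insert_at i e l"

lemma length_contract [simp]: "i < length l \<Longrightarrow> length (contract m i l) = length l - 1"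
  by (induction m i l rule: contract.induct) auto

lemma length_insert_at [simp]: "length (insert_at i e l) = Suc (length l)"
  by (induction i e l rule: insert_at.induct) auto

lemma set_insert_at: "set (insert_at i e l) = insert e (set l)"
  by (induction i e l rule: insert_at.induct) auto

lemma insert_at_insert_at:
  "i \<le> j \<Longrightarrow> j \<le> length l \<Longrightarrow> insert_at i e (insert_at j e l) = insert_at (Suc j) e (insert_at i e l)"
proof (induction i arbitrary: j l)
  case (Suc i)
  then show ?case by (cases j; cases l) auto
qed simp

lemma contract_insert_at_less:
  "Suc i < j \<Longrightarrow> j \<le> length l \<Longrightarrow> contract m i (insert_at j e l) = insert_at (j - 1) e (contract m i l)"
proof (induction i arbitrary: j l)
  case 0
  then show ?case by (cases j; cases "j - 1"; cases l; cases "tl l") auto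
next
  case (Suc i)
  then obtain j' a l' where "j = Suc (Suc j')" "l = a # l'"
    by (cases j; cases "j - 1"; cases l) auto
  with Suc show ?case by simp
qed

lemma contract_insert_at_greater:
  "j < i \<Longrightarrow> i \<le> length l \<Longrightarrow> contract m i (insert_at j e l) = insert_at j e (contract m (i - 1) l)"
proof (induction j arbitrary: i l)
  case 0
  then show ?case by (cases i) auto
next
  case (Suc j)
  then obtain i' a l' where "i = Suc (Suc i')" "l = a # l'"
    by (cases i; cases "i - 1"; cases l) auto
  with Suc show ?case by simp
qed

lemma contract_nth:
  "\<lbrakk>i < length l; Suc k < length l\<rbrakk> \<Longrightarrow> contract m i l ! k =
     (if k < i then l ! k else if k = i then m (l ! i) (l ! Suc i) else l ! Suc k)"
proof (induction m i l arbitrary: k rule: contract.induct)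
  case (4 m i a l)
  then show ?case by (cases k) auto
qed (auto simp: nth_Cons split: nat.split)

lemma insert_at_nth:
  "\<lbrakk>i \<le> length l; k \<le> length l\<rbrakk> \<Longrightarrow>
     insert_at i e l ! k = (if k < i then l ! k else if k = i then e else l ! (k - 1))"
proof (induction i e l arbitrary: k rule: insert_at.induct)
  case (3 i e a l)
  then show ?case by (cases k) (auto simp: nth_Cons split: nat.split)
qed (auto simp: nth_Cons split: nat.split)

lemma contract_last: "contract m (length l) (l @ [a]) = l"
  by (induction l) auto

lemma insert_at_replicate: "insert_at i e (replicate n e) = replicate (Suc n) e"
proof (induction i arbitrary: n)
  case (Suc i)
  then show ?case by (cases n) auto
qed simp

context monoid
begin

lemma contract_closed: "set l \<subseteq> carrier G \<Longrightarrow> set (contract (\<otimes>) i l) \<subseteq> carrier G"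
  by (induction "(\<otimes>)" i l rule: contract.induct) auto

lemma contract_contract:
  "\<lbrakk>set l \<subseteq> carrier G; i < j; j < length l\<rbrakk> \<Longrightarrow>
     contract (\<otimes>) i (contract (\<otimes>) j l) = contract (\<otimes>) (j - 1) (contract (\<otimes>) i l)"
proof (induction i arbitrary: j l)
  case 0
  then obtain j' a b l' where "j = Suc j'" "l = a # b # l'"
    by (cases j; cases l; cases "tl l") auto
  with 0 show ?case by (cases j'; cases l') (auto simp: m_assoc)
next
  case (Suc i)
  then obtain j' a l' where "j = Suc (Suc j')" "l = a # l'"
    by (cases j; cases "j - 1"; cases l) auto
  with Suc show ?case by simp
qed

lemma contract_insert_at_same:
  "\<lbrakk>set l \<subseteq> carrier G; j \<le> length l\<rbrakk> \<Longrightarrow> contract (\<otimes>) j (insert_at j \<one> l) = l"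
proof (induction j arbitrary: l)
  case 0
  then show ?case by (cases l) auto
next
  case (Suc j)
  then show ?case by (cases l) auto
qed

lemma contract_insert_at_Suc:
  "\<lbrakk>set l \<subseteq> carrier G; j < length l\<rbrakk> \<Longrightarrow> contract (\<otimes>) j (insert_at (Suc j) \<one> l) = l"
proof (induction j arbitrary: l)
  case 0
  then show ?case by (cases l) auto
next
  case (Suc j)
  then show ?case by (cases l) auto
qed

lemma contract_replicate: "i \<le> n \<Longrightarrow> contract (\<otimes>) i (replicate (Suc n) \<one>) = replicate n \<one>"
proof (induction i arbitrary: n)
  case 0
  then show ?case by (cases n) auto
next
  case (Suc i)
  then show ?case by (cases n) auto
qed

end

context crossed_monoid
begin

lemma arrow_ends: "\<alpha> \<in> arrows C s t \<Longrightarrow> s \<in> Obj C \<and> t \<in> Obj C \<and> src C \<alpha> = s \<and> tgt C \<alpha> = t"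
  using src_in tgt_in by (auto simp: arrows_def)

lemma pull_in: "\<lbrakk>\<alpha> \<in> arrows C s t; a \<in> carrier (fib A t)\<rbrakk> \<Longrightarrow> pull A \<alpha> a \<in> carrier (fib A s)"
  using pull_hom[of \<alpha> s t] by (auto simp: monoid_hom_def hom_def)

lemma pull_mult: "\<lbrakk>\<alpha> \<in> arrows C s t; a \<in> carrier (fib A t); b \<in> carrier (fib A t)\<rbrakk> \<Longrightarrow>
    pull A \<alpha> (a \<otimes>\<^bsub>fib A t\<^esub> b) = pull A \<alpha> a \<otimes>\<^bsub>fib A s\<^esub> pull A \<alpha> b"
  using pull_hom[of \<alpha> s t] by (auto simp: monoid_hom_def hom_def)

lemma pull_one: "\<alpha> \<in> arrows C s t \<Longrightarrow> pull A \<alpha> \<one>\<^bsub>fib A t\<^esub> = \<one>\<^bsub>fib A s\<^esub>"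
  using pull_hom[of \<alpha> s t] by (auto simp: monoid_hom_def)

lemma bd_in: "\<lbrakk>t \<in> Obj C; a \<in> carrier (fib A t)\<rbrakk> \<Longrightarrow> bd A t a \<in> arrows C t t"
  using bd_hom[of t] by (auto simp: monoid_hom_def hom_def End_def)

lemma bd_mult: "\<lbrakk>t \<in> Obj C; a \<in> carrier (fib A t); b \<in> carrier (fib A t)\<rbrakk> \<Longrightarrow>
    bd A t (a \<otimes>\<^bsub>fib A t\<^esub> b) = cmp C (bd A t a) (bd A t b)"
  using bd_hom[of t] by (auto simp: monoid_hom_def hom_def End_def)

lemma bd_one: "t \<in> Obj C \<Longrightarrow> bd A t \<one>\<^bsub>fib A t\<^esub> = ident C t"
  using bd_hom[of t] by (auto simp: monoid_hom_def End_def)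

lemma cmp_bd_in: "\<lbrakk>\<alpha> \<in> arrows C s t; a \<in> carrier (fib A s)\<rbrakk> \<Longrightarrow> cmp C \<alpha> (bd A s a) \<in> arrows C s t"
  using cmp_in bd_in arrow_ends by meson

text \<open>
  The row \<open>(\<alpha>, a\<^sub>1, \<dots>, a\<^sub>n)\<close> with \<open>\<alpha> : s \<rightarrow> t\<close> is a string
  \<open>\<alpha> \<Rightarrow> \<alpha> \<partial>a\<^sub>1 \<Rightarrow> \<alpha> \<partial>(a\<^sub>1 a\<^sub>2) \<Rightarrow> \<dots>\<close> of 2-cells; for fixed \<open>s\<close> and \<open>t\<close> the rows form the nerve
  of the category given by the right action of \<open>A(s)\<close> on \<open>C(s, t)\<close>.
\<close>

definition row_hom :: "nat \<Rightarrow> 'o \<Rightarrow> 'o \<Rightarrow> ('m \<times> 'a list) set" where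
  "row_hom n s t = {(\<alpha>, l). \<alpha> \<in> arrows C s t \<and> set l \<subseteq> carrier (fib A s) \<and> length l = n}"

fun row_face :: "nat \<Rightarrow> 'm \<times> 'a list \<Rightarrow> 'm \<times> 'a list" where
  "row_face 0 (\<alpha>, []) = (\<alpha>, [])"
| "row_face 0 (\<alpha>, a # l) = (cmp C \<alpha> (bd A (src C \<alpha>) a), l)"
| "row_face (Suc i) (\<alpha>, l) = (\<alpha>, contract (mult (fib A (src C \<alpha>))) i l)"

fun row_degen :: "nat \<Rightarrow> 'm \<times> 'a list \<Rightarrow> 'm \<times> 'a list" where
  "row_degen i (\<alpha>, l) = (\<alpha>, insert_at i \<one>\<^bsub>fib A (src C \<alpha>)\<^esub> l)"

text \<open>
  The entries \<open>a\<^sub>k\<^bsup>\<eta>\<^esup> b\<^sub>k\<close> with \<open>\<eta> = \<beta> \<partial>(b\<^sub>1 \<cdots> b\<^sub>k\<^sub>-\<^sub>1)\<close> of a composite row.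
\<close>

fun twist :: "'m \<Rightarrow> 'a list \<Rightarrow> 'a list \<Rightarrow> 'a list" where
  "twist \<beta> (a # as) (b # bs) =
     (pull A \<beta> a \<otimes>\<^bsub>fib A (src C \<beta>)\<^esub> b) # twist (cmp C \<beta> (bd A (src C \<beta>) b)) as bs"
| "twist \<beta> _ _ = []"

fun row_comp :: "'m \<times> 'a list \<Rightarrow> 'm \<times> 'a list \<Rightarrow> 'm \<times> 'a list" where
  "row_comp (\<alpha>, as) (\<beta>, bs) = (cmp C \<alpha> \<beta>, twist \<beta> as bs)"

definition row_unit :: "nat \<Rightarrow> 'o \<Rightarrow> 'm \<times> 'a list" where
  "row_unit n x = (ident C x, replicate n \<one>\<^bsub>fib A x\<^esub>)"

lemma row_homE:
  assumes "r \<in> row_hom n s t"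
  obtains \<alpha> l where "r = (\<alpha>, l)" "\<alpha> \<in> arrows C s t" "set l \<subseteq> carrier (fib A s)" "length l = n"
    "src C \<alpha> = s" "tgt C \<alpha> = t" "s \<in> Obj C" "t \<in> Obj C"
  using assms arrow_ends by (auto simp: row_hom_def)

lemma simplicial_row_hom:
  "simplicial_set \<lparr>cells = \<lambda>n. row_hom n s t, face = \<lambda>_. row_face, degen = \<lambda>_. row_degen\<rparr>"
  unfolding simplicial_upto_def sset.select_convs
proof (intro conjI allI impI; elim conjE)
  fix k i r assume h: "1 \<le> k" "i \<le> k" and r: "r \<in> row_hom k s t"
  from r obtain \<alpha> l where [simp]: "r = (\<alpha>, l)" "src C \<alpha> = s" "length l = k"
    and a: "\<alpha> \<in> arrows C s t" and l: "set l \<subseteq> carrier (fib A s)" and s: "s \<in> Obj C" by (elim row_homE)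
  interpret G: monoid "fib A s" using s by (rule fib_monoid)
  show "row_face i r \<in> row_hom (k - 1) s t"
    using h a l G.contract_closed[OF l] cmp_bd_in \<open>length l = k\<close>
    by (cases i; cases l) (auto simp: row_hom_def simp del: \<open>length l = k\<close>)
next
  fix k i r assume h: "i \<le> k" and r: "r \<in> row_hom k s t"
  from r obtain \<alpha> l where [simp]: "r = (\<alpha>, l)" "src C \<alpha> = s" "length l = k"
    and a: "\<alpha> \<in> arrows C s t" and l: "set l \<subseteq> carrier (fib A s)" and s: "s \<in> Obj C" by (elim row_homE)
  interpret G: monoid "fib A s" using s by (rule fib_monoid)
  show "row_degen i r \<in> row_hom (Suc k) s t" using a l by (auto simp: row_hom_def set_insert_at)
next
  fix k i j r assume h: "2 \<le> k" "i < j" "j \<le> k" and r: "r \<in> row_hom k s t"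
  from r obtain \<alpha> l where [simp]: "r = (\<alpha>, l)" "src C \<alpha> = s" "length l = k"
    and a: "\<alpha> \<in> arrows C s t" and l: "set l \<subseteq> carrier (fib A s)" and s: "s \<in> Obj C" by (elim row_homE)
  interpret G: monoid "fib A s" using s by (rule fib_monoid)
  obtain j' where j: "j = Suc j'" using h by (cases j) auto
  obtain b c l' where L: "l = b # c # l'" using h \<open>length l = k\<close> by (cases l; cases "tl l") auto
  show "row_face i (row_face j r) = row_face (j - 1) (row_face i r)"
  proof (cases i)
    case 0
    have "src C (cmp C \<alpha> (bd A s b)) = s" using cmp_bd_in[OF a, of b] L l arrow_ends by simp
    then show ?thesis using 0 j L h l s a
      by (cases j') (auto simp: bd_mult cmp_assoc[OF a bd_in bd_in])
  next
    case (Suc i')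
    then show ?thesis using j h l G.contract_contract[of l i' j'] by (cases j') auto
  qed
next
  fix k i j r assume h: "i < j" "j \<le> k" and r: "r \<in> row_hom k s t"
  from r obtain \<alpha> l where [simp]: "r = (\<alpha>, l)" "src C \<alpha> = s" "length l = k"
    and a: "\<alpha> \<in> arrows C s t" and l: "set l \<subseteq> carrier (fib A s)" and s: "s \<in> Obj C" by (elim row_homE)
  obtain j' where j: "j = Suc j'" using h by (cases j) auto
  obtain b l' where L: "l = b # l'" using h \<open>length l = k\<close> by (cases l) auto
  show "row_face i (row_degen j r) = row_degen (j - 1) (row_face i r)"
  proof (cases i)
    case 0
    have "src C (cmp C \<alpha> (bd A s b)) = s" using cmp_bd_in[OF a, of b] L l arrow_ends by simp
    then show ?thesis using 0 j L by simp
  next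
    case (Suc i')
    then show ?thesis using contract_insert_at_less[of i' j l] h by simp
  qed
next
  fix k i j r assume h: "j \<le> k" "i = j \<or> i = Suc j" and r: "r \<in> row_hom k s t"
  from r obtain \<alpha> l where [simp]: "r = (\<alpha>, l)" "src C \<alpha> = s" "length l = k"
    and a: "\<alpha> \<in> arrows C s t" and l: "set l \<subseteq> carrier (fib A s)" and s: "s \<in> Obj C" by (elim row_homE)
  interpret G: monoid "fib A s" using s by (rule fib_monoid)
  show "row_face i (row_degen j r) = r"
  proof (cases i)
    case 0
    then show ?thesis using h s a by (simp add: bd_one ident_right)
  next
    case (Suc i')
    then show ?thesis
      using h l G.contract_insert_at_same[of l i'] G.contract_insert_at_Suc[of l i'] by auto
  qed
next
  fix k i j r assume h: "Suc j < i" "i \<le> Suc k" and r: "r \<in> row_hom k s t"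
  from r obtain \<alpha> l where [simp]: "r = (\<alpha>, l)" "src C \<alpha> = s" "length l = k" by (elim row_homE)
  obtain i' where "i = Suc (Suc i')" using h by (cases i; cases "i - 1") auto
  then show "row_face i (row_degen j r) = row_degen j (row_face (i - 1) r)"
    using h contract_insert_at_greater[of j "Suc i'" l] by simp
next
  fix k i j r assume h: "i \<le> j" "j \<le> k" and r: "r \<in> row_hom k s t"
  from r obtain \<alpha> l where "r = (\<alpha>, l)" "src C \<alpha> = s" "length l = k" by (elim row_homE)
  then show "row_degen i (row_degen j r) = row_degen (Suc j) (row_degen i r)"
    using h insert_at_insert_at[of i j l] by simp
qed

lemma twist_in:
  "\<lbrakk>\<beta> \<in> arrows C u s; set as \<subseteq> carrier (fib A s); set bs \<subseteq> carrier (fib A u); length as = length bs\<rbrakk> \<Longrightarrow>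
     set (twist \<beta> as bs) \<subseteq> carrier (fib A u) \<and> length (twist \<beta> as bs) = length bs"
proof (induction as arbitrary: \<beta> bs)
  case (Cons a as)
  then obtain b bs' where "bs = b # bs'" by (cases bs) auto
  with Cons show ?case
    using arrow_ends[OF Cons.prems(1)] monoid.m_closed[OF fib_monoid] pull_in[OF Cons.prems(1)]
      Cons.IH[OF cmp_bd_in[OF Cons.prems(1)], of b bs'] by auto
qed simp

text \<open>
  Associativity of the composition: the exponents agree entry by entry because
  \<open>\<beta> \<partial>b \<gamma> \<partial>c = \<beta> \<gamma> \<partial>(b\<^bsup>\<gamma>\<^esup> c)\<close>.
\<close>

lemma twist_assoc:
  "\<lbrakk>\<beta> \<in> arrows C u s; \<gamma> \<in> arrows C v u; set as \<subseteq> carrier (fib A s); set bs \<subseteq> carrier (fib A u);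
    set cs \<subseteq> carrier (fib A v); length as = length bs; length bs = length cs\<rbrakk> \<Longrightarrow>
   twist \<gamma> (twist \<beta> as bs) cs = twist (cmp C \<beta> \<gamma>) as (twist \<gamma> bs cs)"
proof (induction as arbitrary: \<beta> \<gamma> bs cs)
  case (Cons a as)
  then obtain b bs' c cs' where L: "bs = b # bs'" "cs = c # cs'" by (cases bs; cases cs) auto
  note \<beta> = Cons.prems(1) and \<gamma> = Cons.prems(2)
  have ob: "u \<in> Obj C" "v \<in> Obj C" and [simp]: "src C \<beta> = u" "src C \<gamma> = v"
    using arrow_ends \<beta> \<gamma> by auto
  have [simp]: "src C (cmp C \<beta> \<gamma>) = v" using arrow_ends cmp_in[OF \<beta> \<gamma>] by blast
  have c: "a \<in> carrier (fib A s)" "b \<in> carrier (fib A u)" "c \<in> carrier (fib A v)" using Cons.prems L by auto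
  note p = pull_in[OF \<beta> c(1)] pull_in[OF \<gamma> c(2)] pull_in[OF \<gamma> pull_in[OF \<beta> c(1)]]
  interpret U: monoid "fib A u" using ob(1) by (rule fib_monoid)
  interpret V: monoid "fib A v" using ob(2) by (rule fib_monoid)
  have \<beta>b: "cmp C \<beta> (bd A u b) \<in> arrows C u s" and \<gamma>c: "cmp C \<gamma> (bd A v c) \<in> arrows C v u"
    using \<beta> \<gamma> c by (blast intro: cmp_bd_in)+
  note bb = bd_in[OF ob(1) c(2)] bd_in[OF ob(2) c(3)] bd_in[OF ob(2) p(2)]
  have "cmp C (cmp C \<beta> \<gamma>) (bd A v (pull A \<gamma> b \<otimes>\<^bsub>fib A v\<^esub> c))
      = cmp C \<beta> (cmp C (cmp C \<gamma> (bd A v (pull A \<gamma> b))) (bd A v c))"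
    using \<beta> \<gamma> ob c p bb cmp_in
    by (simp add: bd_mult cmp_assoc[OF \<beta> \<gamma> cmp_in] cmp_assoc[OF \<gamma> bb(3,2)])
  also have "\<dots> = cmp C (cmp C \<beta> (bd A u b)) (cmp C \<gamma> (bd A v c))"
    unfolding bd_pull[OF \<gamma> c(2)] cmp_assoc[OF bb(1) \<gamma> bb(2)]
    by (rule cmp_assoc[OF \<beta> bb(1) \<gamma>c, symmetric])
  finally have "cmp C (cmp C \<beta> \<gamma>) (bd A v (pull A \<gamma> b \<otimes>\<^bsub>fib A v\<^esub> c))
      = cmp C (cmp C \<beta> (bd A u b)) (cmp C \<gamma> (bd A v c))" .
  then show ?case
    using Cons.IH[OF \<beta>b \<gamma>c, of bs' cs'] Cons.prems L c p
    by (simp add: pull_mult[OF \<gamma>] pull_cmp[OF \<beta> \<gamma>] V.m_assoc)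
qed simp

lemma twist_unit_right:
  "\<lbrakk>s \<in> Obj C; set as \<subseteq> carrier (fib A s)\<rbrakk> \<Longrightarrow>
     twist (ident C s) as (replicate (length as) \<one>\<^bsub>fib A s\<^esub>) = as"
proof (induction as)
  case (Cons a as)
  have "src C (ident C s) = s" using arrow_ends ident_in Cons by blast
  then show ?case
    using Cons monoid.r_one[OF fib_monoid] pull_ident ident_right[OF ident_in] by (simp add: bd_one)
qed simp

lemma twist_unit_left:
  "\<lbrakk>\<beta> \<in> arrows C u s; set bs \<subseteq> carrier (fib A u)\<rbrakk> \<Longrightarrow>
     twist \<beta> (replicate (length bs) \<one>\<^bsub>fib A s\<^esub>) bs = bs"
proof (induction bs arbitrary: \<beta>)
  case (Cons b bs)
  then show ?case
    using arrow_ends[OF Cons.prems(1)] monoid.l_one[OF fib_monoid] pull_one[OF Cons.prems(1)]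
      Cons.IH[OF cmp_bd_in[OF Cons.prems(1)], of b] by simp
qed simp

text \<open>
  Multiplying two neighbouring entries commutes with composition by the Peiffer identity
  \<open>a\<^sub>2\<^bsup>\<beta>\<^esup> b\<^sub>1 = b\<^sub>1 a\<^sub>2\<^bsup>\<beta> \<partial>b\<^sub>1\<^esup>\<close>.
\<close>

lemma contract_twist:
  "\<lbrakk>\<beta> \<in> arrows C u s; set as \<subseteq> carrier (fib A s); set bs \<subseteq> carrier (fib A u);
    length as = length bs; i < length bs\<rbrakk> \<Longrightarrow>
   contract (mult (fib A u)) i (twist \<beta> as bs)
     = twist \<beta> (contract (mult (fib A s)) i as) (contract (mult (fib A u)) i bs)"
proof (induction i arbitrary: \<beta> as bs)
  case 0
  note \<beta> = 0(1)
  have ob: "u \<in> Obj C" "s \<in> Obj C" and [simp]: "src C \<beta> = u" using arrow_ends \<beta> by auto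
  from 0 obtain a1 as1 b1 bs1 where L: "as = a1 # as1" "bs = b1 # bs1" "length as1 = length bs1"
    by (cases as; cases bs) auto
  show ?case
  proof (cases as1)
    case Nil
    then show ?thesis using L by simp
  next
    case (Cons a2 as2)
    with L obtain b2 bs2 where L2: "bs1 = b2 # bs2" by (cases bs1) auto
    have c: "a1 \<in> carrier (fib A s)" "a2 \<in> carrier (fib A s)" "b1 \<in> carrier (fib A u)" "b2 \<in> carrier (fib A u)"
      using 0 L L2 Cons by auto
    interpret U: monoid "fib A u" using ob(1) by (rule fib_monoid)
    note p = pull_in[OF \<beta> c(1)] pull_in[OF \<beta> c(2)]
    note bb = bd_in[OF ob(1) c(3)] bd_in[OF ob(1) c(4)]
    have q: "pull A (bd A u b1) (pull A \<beta> a2) \<in> carrier (fib A u)" by (rule pull_in[OF bb(1) p(2)])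
    have [simp]: "src C (cmp C \<beta> (bd A u b1)) = u" using arrow_ends cmp_bd_in[OF \<beta> c(3)] by blast
    \<comment> \<open>the equality of the first entries, which is where the Peiffer identity enters\<close>
    have "pull A \<beta> (a1 \<otimes>\<^bsub>fib A s\<^esub> a2) \<otimes>\<^bsub>fib A u\<^esub> (b1 \<otimes>\<^bsub>fib A u\<^esub> b2) =
        pull A \<beta> a1 \<otimes>\<^bsub>fib A u\<^esub> ((pull A \<beta> a2 \<otimes>\<^bsub>fib A u\<^esub> b1) \<otimes>\<^bsub>fib A u\<^esub> b2)"
      using c p by (simp add: pull_mult[OF \<beta>] U.m_assoc)
    also have "\<dots> = (pull A \<beta> a1 \<otimes>\<^bsub>fib A u\<^esub> b1) \<otimes>\<^bsub>fib A u\<^esub>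
        (pull A (cmp C \<beta> (bd A u b1)) a2 \<otimes>\<^bsub>fib A u\<^esub> b2)"
      using c p q by (simp add: peiffer[OF ob(1) p(2) c(3)] pull_cmp[OF \<beta> bb(1) c(2)] U.m_assoc)
    finally show ?thesis
      using L L2 Cons c ob by (simp add: bd_mult cmp_assoc[OF \<beta> bb])
  qed
next
  case (Suc i)
  note \<beta> = Suc.prems(1)
  from Suc.prems obtain a as' b bs' where L: "as = a # as'" "bs = b # bs'"
    by (cases as; cases bs) auto
  then show ?case
    using Suc arrow_ends[OF \<beta>] Suc.IH[OF cmp_bd_in[OF \<beta>], of b as' bs'] by simp
qed

lemma insert_at_twist:
  "\<lbrakk>\<beta> \<in> arrows C u s; set as \<subseteq> carrier (fib A s); set bs \<subseteq> carrier (fib A u);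
    length as = length bs; i \<le> length bs\<rbrakk> \<Longrightarrow>
   insert_at i \<one>\<^bsub>fib A u\<^esub> (twist \<beta> as bs)
     = twist \<beta> (insert_at i \<one>\<^bsub>fib A s\<^esub> as) (insert_at i \<one>\<^bsub>fib A u\<^esub> bs)"
proof (induction i arbitrary: \<beta> as bs)
  case 0
  then show ?case
    using arrow_ends[OF 0(1)] pull_one[OF 0(1)] monoid.l_one[OF fib_monoid] monoid.one_closed[OF fib_monoid]
    by (simp add: bd_one ident_right[OF 0(1)])
next
  case (Suc i)
  note \<beta> = Suc.prems(1)
  from Suc.prems obtain a as' b bs' where L: "as = a # as'" "bs = b # bs'"
    by (cases as; cases bs) auto
  then show ?case
    using Suc arrow_ends[OF \<beta>] Suc.IH[OF cmp_bd_in[OF \<beta>], of b as' bs'] by simp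
qed

text \<open>
  The face \<open>\<delta>\<^sub>0\<close> is functorial by the equivariance of \<open>\<partial>\<close>, and the other faces by
  \<open>contract_twist\<close>.
\<close>

lemma simplicial_category_rows:
  "simplicial_category (Obj C) row_hom row_face row_degen row_comp row_unit (\<lambda>r. tgt C (fst r))"
proof
  show "simplicial_set \<lparr>cells = \<lambda>n. row_hom n s t, face = \<lambda>_. row_face, degen = \<lambda>_. row_degen\<rparr>" for s t
    by (rule simplicial_row_hom)
  show "s \<in> Obj C \<and> t \<in> Obj C" if "r \<in> row_hom n s t" for r n s t using that by (elim row_homE) simp
  show "tgt C (fst r) = t" if "r \<in> row_hom n s t" for r n s t using that by (elim row_homE) simp
  show "row_comp r r' \<in> row_hom n u t" if "r \<in> row_hom n s t" "r' \<in> row_hom n u s" for r r' n s t u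
    using that twist_in cmp_in by (auto simp: row_hom_def)
  show "row_comp (row_comp r r') r'' = row_comp r (row_comp r' r'')"
    if "r \<in> row_hom n s t" "r' \<in> row_hom n u s" "r'' \<in> row_hom n v u" for r r' r'' n s t u v
    using that twist_assoc cmp_assoc by (auto simp: row_hom_def)
  show "row_unit n x \<in> row_hom n x x" if "x \<in> Obj C" for n x
    using that ident_in monoid.one_closed[OF fib_monoid] by (auto simp: row_hom_def row_unit_def)
  show "row_comp r (row_unit n s) = r" if "r \<in> row_hom n s t" for r n s t
    using that twist_unit_right arrow_ends ident_right by (auto simp: row_hom_def row_unit_def)
  show "row_comp (row_unit n t) r = r" if "r \<in> row_hom n s t" for r n s t
    using that twist_unit_left ident_left by (auto simp: row_hom_def row_unit_def)
  show "row_face i (row_comp r r') = row_comp (row_face i r) (row_face i r')"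
    if r: "r \<in> row_hom (Suc n) s t" "r' \<in> row_hom (Suc n) u s" and i: "i \<le> Suc n" for r r' n s t u i
  proof -
    from r(1) obtain \<alpha> as where [simp]: "r = (\<alpha>, as)" "length as = Suc n" "src C \<alpha> = s"
      and a: "\<alpha> \<in> arrows C s t" "set as \<subseteq> carrier (fib A s)" "s \<in> Obj C" by (elim row_homE)
    from r(2) obtain \<beta> bs where [simp]: "r' = (\<beta>, bs)" "length bs = Suc n" "src C \<beta> = u"
      and b: "\<beta> \<in> arrows C u s" "set bs \<subseteq> carrier (fib A u)" "u \<in> Obj C" by (elim row_homE)
    have [simp]: "src C (cmp C \<alpha> \<beta>) = u" using cmp_in[OF a(1) b(1)] arrow_ends by blast
    show ?thesis
    proof (cases i)
      case 0
      obtain x as' y bs' where L: "as = x # as'" "bs = y # bs'"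
        using \<open>length as = Suc n\<close> \<open>length bs = Suc n\<close> by (cases as; cases bs) auto
      have x: "x \<in> carrier (fib A s)" and y: "y \<in> carrier (fib A u)" using L a b by auto
      note px = pull_in[OF b(1) x]
      note bx = bd_in[OF a(3) x] and bdy = bd_in[OF b(3) y] and bpx = bd_in[OF b(3) px]
      have "cmp C (cmp C \<alpha> \<beta>) (bd A u (pull A \<beta> x \<otimes>\<^bsub>fib A u\<^esub> y))
          = cmp C \<alpha> (cmp C (cmp C \<beta> (bd A u (pull A \<beta> x))) (bd A u y))"
        by (simp add: bd_mult[OF b(3) px y] cmp_assoc[OF a(1) b(1) cmp_in[OF bpx bdy]] cmp_assoc[OF b(1) bpx bdy])
      also have "\<dots> = cmp C (cmp C \<alpha> (bd A s x)) (cmp C \<beta> (bd A u y))"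
        unfolding bd_pull[OF b(1) x] cmp_assoc[OF bx b(1) bdy]
        by (rule cmp_assoc[OF a(1) bx cmp_in[OF b(1) bdy], symmetric])
      finally show ?thesis using 0 L by simp
    next
      case (Suc i')
      then show ?thesis using contract_twist[OF b(1) a(2) b(2), of i'] i by simp
    qed
  qed
  show "row_degen i (row_comp r r') = row_comp (row_degen i r) (row_degen i r')"
    if "r \<in> row_hom n s t" "r' \<in> row_hom n u s" "i \<le> n" for r r' n s t u i
  proof -
    from that(1) obtain \<alpha> as where r: "r = (\<alpha>, as)" "length as = n" "src C \<alpha> = s"
      and a: "\<alpha> \<in> arrows C s t" "set as \<subseteq> carrier (fib A s)" by (elim row_homE)
    from that(2) obtain \<beta> bs where r': "r' = (\<beta>, bs)" "length bs = n" "src C \<beta> = u"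
      and b: "\<beta> \<in> arrows C u s" "set bs \<subseteq> carrier (fib A u)" by (elim row_homE)
    have "src C (cmp C \<alpha> \<beta>) = u" using cmp_in[OF a(1) b(1)] arrow_ends by blast
    then show ?thesis using insert_at_twist[OF b(1) a(2) b(2), of i] r r' that(3) by simp
  qed
  show "row_face i (row_unit (Suc n) x) = row_unit n x" if "x \<in> Obj C" "i \<le> Suc n" for x i n
  proof -
    have "src C (ident C x) = x" using arrow_ends[OF ident_in] that by blast
    then show ?thesis
      using that monoid.contract_replicate[OF fib_monoid, of x _ n] ident_right[OF ident_in]
      by (cases i) (auto simp: row_unit_def bd_one simp del: replicate_Suc, simp add: bd_one)
  qed
  show "row_degen i (row_unit n x) = row_unit (Suc n) x" if "x \<in> Obj C" "i \<le> n" for x i n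
    using that arrow_ends[OF ident_in[of x]] by (simp add: row_unit_def insert_at_replicate)
qed

text \<open>
  In a row of degree \<open>p\<close> the face \<open>\<delta>\<^sub>p\<close> forgets only the last entry, and \<open>\<delta>\<^sub>1\<close> still shows the last
  entry, unmultiplied, if \<open>p \<ge> 3\<close>.
\<close>

lemma row_eqI_two_faces:
  assumes "3 \<le> p" "r \<in> row_hom p s t" "r' \<in> row_hom p s t"
    "row_face 1 r = row_face 1 r'" "row_face p r = row_face p r'"
  shows "r = r'"
proof -
  obtain \<alpha> l where r: "r = (\<alpha>, l)" "length l = p" using assms(2) by (elim row_homE)
  obtain \<alpha>' l' where r': "r' = (\<alpha>', l')" "length l' = p" using assms(3) by (elim row_homE)
  obtain q where q: "p = Suc q" using assms(1) by (cases p) auto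
  obtain k z where k: "l = k @ [z]" "length k = q" using r q by (cases l rule: rev_cases) auto
  obtain k' z' where k': "l' = k' @ [z']" "length k' = q" using r' q by (cases l' rule: rev_cases) auto
  have e: "\<alpha> = \<alpha>'" "k = k'" using assms(5) r r' q k k' contract_last[of _ k z] contract_last[of _ k' z'] by auto
  obtain a b k0 where "k = a # b # k0" using k assms(1) q by (cases k; cases "tl k") auto
  then show ?thesis using assms(4) r r' k k' e by auto
qed

text \<open>
  The required row is \<open>r\<close> with the last entry of \<open>r'\<close> appended.  For \<open>p \<ge> 3\<close> the product formed by
  \<open>\<delta>\<^sub>1\<close> does not involve this entry.
\<close>

lemma row_with_two_faces:
  assumes p: "3 \<le> p" and r: "r \<in> row_hom (p - 1) s t" and r': "r' \<in> row_hom (p - 1) s t'"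
    and e: "row_face 1 r = row_face (p - 1) r'"
  shows "\<exists>q \<in> row_hom p s t. row_face p q = r \<and> row_face 1 q = r'"
proof -
  obtain n where n: "p = Suc (Suc n)" "1 \<le> n" using p by (intro that[of "p - 2"]) auto
  obtain \<alpha> l where R: "r = (\<alpha>, l)" "length l = Suc n" "set l \<subseteq> carrier (fib A s)" "\<alpha> \<in> arrows C s t"
    using r n by (elim row_homE) auto
  obtain \<alpha>' l' where R': "r' = (\<alpha>', l')" "length l' = Suc n" "set l' \<subseteq> carrier (fib A s)"
    using r' n by (elim row_homE) auto
  obtain k z where k: "l' = k @ [z]" "length k = n" using R' by (cases l' rule: rev_cases) auto
  obtain a b l0 where l: "l = a # b # l0" using R n by (cases l; cases "tl l") auto
  have "\<alpha> = \<alpha>'" "contract (mult (fib A (src C \<alpha>))) 0 l = k"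
    using e R R' n k contract_last[of _ k z] by auto
  then show ?thesis
    using R R' k l n contract_last[of _ l z]
    by (intro bexI[of _ "(\<alpha>, l @ [z])"]) (auto simp: row_hom_def)
qed

end

section \<open>The nerve as the simplicial set of chains\<close>

lemma mk_mat_eq_iff:
  "mk_mat n D U = mk_mat n D' U' \<longleftrightarrow>
     (\<forall>i. 1 \<le> i \<and> i \<le> n \<longrightarrow> D i = D' i) \<and> (\<forall>i k. 1 \<le> i \<and> i < k \<and> k \<le> n \<longrightarrow> U i k = U' i k)"
  unfolding mk_mat_def by (auto simp: fun_eq_iff)

context crossed_monoid
begin

sublocale rows: simplicial_category "Obj C" row_hom row_face row_degen row_comp row_unit "\<lambda>r. tgt C (fst r)"
  by (rule simplicial_category_rows)

text \<open>This identifies the recursively updated exponent of \<open>twist\<close> with \<open>eta\<close>.\<close>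

lemma twist_nth:
  "\<lbrakk>\<beta> \<in> arrows C u s; set as \<subseteq> carrier (fib A s); set bs \<subseteq> carrier (fib A u); length as = length bs; k < length bs\<rbrakk> \<Longrightarrow>
   twist \<beta> as bs ! k =
     pull A (cmp C \<beta> (bd A u (foldr (mult (fib A u)) (take k bs) \<one>\<^bsub>fib A u\<^esub>))) (as ! k) \<otimes>\<^bsub>fib A u\<^esub> bs ! k"
proof (induction k arbitrary: \<beta> as bs)
  case 0
  then obtain a as' b bs' where "as = a # as'" "bs = b # bs'" by (cases as; cases bs) auto
  then show ?case using arrow_ends[OF 0(1)] by (simp add: bd_one ident_right[OF 0(1)])
next
  case (Suc k)
  note \<beta> = Suc.prems(1)
  from Suc.prems obtain a as' b bs' where L: "as = a # as'" "bs = b # bs'" by (cases as; cases bs) auto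
  have u: "u \<in> Obj C" "src C \<beta> = u" using arrow_ends[OF \<beta>] by auto
  interpret U: monoid "fib A u" using u(1) by (rule fib_monoid)
  have b: "b \<in> carrier (fib A u)" using Suc.prems L by simp
  have c: "set l \<subseteq> carrier (fib A u) \<Longrightarrow> foldr (mult (fib A u)) l \<one>\<^bsub>fib A u\<^esub> \<in> carrier (fib A u)" for l
    by (induction l) auto
  have t: "set (take k bs') \<subseteq> carrier (fib A u)"
    using Suc.prems(3) L set_take_subset[of k bs'] by auto
  show ?case
    using Suc.IH[OF cmp_bd_in[OF \<beta> b], of as' bs'] Suc.prems L u b c[OF t]
    by (simp add: bd_mult cmp_assoc[OF \<beta> bd_in bd_in])
qed

definition diag :: "('o, 'm \<times> 'a list) chain \<Rightarrow> nat \<Rightarrow> 'm" where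
  "diag M j = fst (rows M ! (j - 1))"

definition entry :: "('o, 'm \<times> 'a list) chain \<Rightarrow> nat \<Rightarrow> nat \<Rightarrow> 'a" where
  "entry M i k = snd (rows M ! (i - 1)) ! (k - Suc i)"

definition matrix :: "('o, 'm \<times> 'a list) chain \<Rightarrow> ('o, 'm, 'a) ncell" where
  "matrix M = (if chain_dim M = 0 then Vertex (end_ob M) else mk_mat (chain_dim M) (diag M) (entry M))"

context
  fixes n t M
  assumes M: "rows.chain_in n t M"
begin

lemma chain_dim_eq: "chain_dim M = n"
  using rows.chain_in_facts[OF M] by simp

lemma row_in: "1 \<le> j \<Longrightarrow> j \<le> n \<Longrightarrow> rows M ! (j - 1) \<in> row_hom (n - j) (rows.obs M ! j) (rows.obs M ! (j - 1))"
  using rows.chain_in_nth[OF M] by (cases j) auto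

lemma diag_in: "1 \<le> j \<Longrightarrow> j \<le> n \<Longrightarrow> diag M j \<in> arrows C (rows.obs M ! j) (rows.obs M ! (j - 1))"
  using row_in[of j] by (auto simp: row_hom_def diag_def)

lemma src_diag: "1 \<le> j \<Longrightarrow> j \<le> n \<Longrightarrow> src C (diag M j) = rows.obs M ! j"
  using diag_in[of j] arrow_ends by blast

lemma entries_in: "1 \<le> j \<Longrightarrow> j \<le> n \<Longrightarrow> set (snd (rows M ! (j - 1))) \<subseteq> carrier (fib A (rows.obs M ! j))"
  using row_in[of j] by (auto simp: row_hom_def)

lemma length_entries: "1 \<le> j \<Longrightarrow> j \<le> n \<Longrightarrow> length (snd (rows M ! (j - 1))) = n - j"
  using row_in[of j] by (auto simp: row_hom_def)

lemma entry_in: "1 \<le> i \<Longrightarrow> i < k \<Longrightarrow> k \<le> n \<Longrightarrow> entry M i k \<in> carrier (fib A (rows.obs M ! i))"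
proof -
  assume h: "1 \<le> i" "i < k" "k \<le> n"
  then have "k - Suc i < length (snd (rows M ! (i - 1)))" using length_entries[of i] by simp
  from nth_mem[OF this] show ?thesis using entries_in[of i] h unfolding entry_def by auto
qed

lemma row_eq: "rows M ! (j - 1) = (diag M j, snd (rows M ! (j - 1)))"
  by (simp add: diag_def)

lemma vert_diag: "1 \<le> n \<Longrightarrow> j \<le> n \<Longrightarrow> vert C (diag M) j = rows.obs M ! j"
  using src_diag[of j] diag_in[of 1] arrow_ends[of "diag M 1"] by (auto simp: vert_def)

lemma matrix_in: "matrix M \<in> nerve_cells C A n"
proof (cases "n = 0")
  case True
  then show ?thesis using rows.chain_in_nth[OF M] by (auto simp: matrix_def chain_dim_eq nerve_cells_def)
next
  case False
  then have "matrix M = mk_mat n (diag M) (entry M)" by (simp add: matrix_def chain_dim_eq)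
  moreover have "\<forall>i \<le> n. rows.obs M ! i \<in> Obj C" using rows.chain_in_nth[OF M] by blast
  ultimately show ?thesis
    unfolding nerve_cells_def using False diag_in entry_in
    by (auto intro!: exI[of _ "diag M"] exI[of _ "entry M"] exI[of _ "\<lambda>i. rows.obs M ! i"])
qed

end

text \<open>
  On the cells of the nerve the face and degeneracy formulas only read entries inside the triangle,
  so that the padding by \<open>undefined\<close> in \<open>mk_mat\<close> can be ignored.
\<close>

lemma nerve_face_mk_mat_inner:
  assumes j: "0 < j" "j < n"
  shows "nerve_face C A n j (mk_mat n D U) = mk_mat (n - 1)
       (\<lambda>i. if i < j then D i
            else if i = j then cmp C (D j) (cmp C (bd A (vert C D j) (U j (Suc j))) (D (Suc j)))
            else D (Suc i))
       (\<lambda>i k. if i < j then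
                (if k < j then U i k
                 else if k = j then U i j \<otimes>\<^bsub>fib A (vert C D i)\<^esub> U i (Suc j)
                 else U i (Suc k))
              else if i = j then
                pull A (eta C A D U j k) (U j (Suc k))
                  \<otimes>\<^bsub>fib A (vert C D (Suc j))\<^esub> U (Suc j) (Suc k)
              else U (Suc i) (Suc k))"
proof -
  define D' where "D' = (\<lambda>j. if 1 \<le> j \<and> j \<le> n then D j else undefined)"
  define U' where "U' = (\<lambda>i k. if 1 \<le> i \<and> i < k \<and> k \<le> n then U i k else undefined)"
  have v: "vert C D' i = vert C D i" if "i \<le> n" for i
    using that j by (auto simp: vert_def D'_def)
  have "eta C A D' U' j k = eta C A D U j k" if "j < k" "k < n" for k
  proof -
    have "map (U' (Suc j)) [j + 2..<Suc k] = map (U (Suc j)) [j + 2..<Suc k]"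
      using that by (intro map_cong) (auto simp: U'_def)
    then show ?thesis using j v[of "Suc j"] by (simp add: D'_def eta_def Let_def del: upt_Suc map_eq_conv)
  qed
  note eta = this
  have e: "mk_mat n D U = Mat D' U'" by (simp add: mk_mat_def D'_def U'_def)
  have n: "n \<noteq> 1" "j \<noteq> 0" "j \<noteq> n" using j by auto
  show ?thesis
    unfolding e nerve_face.simps if_not_P[OF n(1)] if_not_P[OF n(2)] if_not_P[OF n(3)] mk_mat_eq_iff
    using j v eta by (auto simp: D'_def U'_def)
qed

lemma nerve_face_mk_mat_outer:
  assumes "2 \<le> n"
  shows "nerve_face C A n 0 (mk_mat n D U) = mk_mat (n - 1) (\<lambda>i. D (Suc i)) (\<lambda>i k. U (Suc i) (Suc k))"
    and "nerve_face C A n n (mk_mat n D U) = mk_mat (n - 1) D U"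
  using assms by (auto simp: mk_mat_def fun_eq_iff)

lemma nerve_degen_mk_mat:
  assumes "1 \<le> n" "j \<le> n"
  shows "nerve_degen C A n j (mk_mat n D U) = mk_mat (Suc n)
     (\<lambda>i. if i \<le> j then D i
          else if i = Suc j then ident C (vert C D j)
          else D (i - 1))
     (\<lambda>i k. if i \<le> j then
              (if k \<le> j then U i k
               else if k = Suc j then \<one>\<^bsub>fib A (vert C D i)\<^esub>
               else U i (k - 1))
            else if i = Suc j then \<one>\<^bsub>fib A (vert C D j)\<^esub>
            else U (i - 1) (k - 1))"
proof -
  define D' where "D' = (\<lambda>j. if 1 \<le> j \<and> j \<le> n then D j else undefined)"
  define U' where "U' = (\<lambda>i k. if 1 \<le> i \<and> i < k \<and> k \<le> n then U i k else undefined)"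
  have v: "vert C D' i = vert C D i" if "i \<le> n" for i
    using that assms by (auto simp: vert_def D'_def)
  have e: "mk_mat n D U = Mat D' U'" by (simp add: mk_mat_def D'_def U'_def)
  show ?thesis
    unfolding e nerve_degen.simps mk_mat_eq_iff using assms v by (auto simp: D'_def U'_def)
qed

lemma matrix_face:
  assumes M: "rows.chain_in n t M" and n: "1 \<le> n" and j: "j \<le> n"
  shows "nerve_face C A n j (matrix M) = matrix (rows.chain_face j M)"
proof (cases "n = 1")
  case True
  then obtain r x where M': "M = Row r (Pt x)" "r \<in> row_hom 0 x t"
    using rows.chain_in_SucD[of 0 t M] rows.chain_in_0D M by (metis One_nat_def)
  then obtain \<alpha> where "r = (\<alpha>, [])" "src C \<alpha> = x" "tgt C \<alpha> = t" by (elim row_homE) auto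
  moreover have "j = 0 \<or> j = 1" using j True by auto
  ultimately show ?thesis using M' True by (auto simp: matrix_def diag_def mk_mat_def)
next
  case False
  then have n2: "2 \<le> n" using n by simp
  note dM = chain_dim_eq[OF M] and vert = vert_diag[OF M n] and src = src_diag[OF M] and row = row_eq[OF M]
    and len = length_entries[OF M] and arr = diag_in[OF M]
  have mM: "matrix M = mk_mat n (diag M) (entry M)" using n by (simp add: matrix_def dM)
  let ?N = "rows.chain_face j M"
  have mN: "matrix ?N = mk_mat (n - 1) (diag ?N) (entry ?N)" using n2 j by (simp add: matrix_def dM)
  consider "j = 0" | "0 < j" "j < n" | "j = n" using j by linarith
  then show ?thesis
  proof cases
    case 1
    have "rows ?N ! (i - 1) = rows M ! i" if "1 \<le> i" "i \<le> n - 1" for i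
      using rows.rows_chain_face_0[of "i - 1" M] that dM n2 1 by simp
    then show ?thesis
      unfolding mM mN unfolding 1 nerve_face_mk_mat_outer(1)[OF n2] mk_mat_eq_iff
      using 1 by (auto simp: diag_def entry_def)
  next
    case 2
    let ?l = "\<lambda>i. snd (rows M ! (i - 1))"
    have rl: "rows ?N ! (i - 1) = (diag M i, contract (mult (fib A (rows.obs M ! i))) (j - Suc i) (?l i))"
      if i: "1 \<le> i" "i < j" for i
    proof -
      have "rows ?N ! (i - 1) = row_face (j - i) (rows M ! (i - 1))"
        using rows.rows_chain_face[of j M "i - 1"] i 2 dM by simp
      also have "j - i = Suc (j - Suc i)" using i by simp
      finally show ?thesis using src[of i] i 2 by (subst (asm) row) simp
    qed
    have rr: "rows ?N ! (i - 1) = rows M ! i" if i: "j < i" "i \<le> n - 1" for i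
      using rows.rows_chain_face[of j M "i - 1"] i 2 dM by simp
    obtain a l where al: "?l j = a # l" using len[of j] 2 by (cases "?l j") auto
    have a: "a = entry M j (Suc j)" unfolding entry_def al by simp
    have rj: "rows ?N ! (j - 1) =
        (cmp C (cmp C (diag M j) (bd A (rows.obs M ! j) (entry M j (Suc j)))) (diag M (Suc j)),
         twist (diag M (Suc j)) l (?l (Suc j)))"
    proof -
      have "rows ?N ! (j - 1) = row_comp (row_face 0 (rows M ! (j - 1))) (rows M ! (Suc j - 1))"
        using rows.rows_chain_face[of j M "j - 1"] 2 dM by simp
      also have "\<dots> = row_comp (row_face 0 (diag M j, ?l j)) (diag M (Suc j), ?l (Suc j))"
        by (rule arg_cong2[where f = "\<lambda>x. row_comp (row_face 0 x)", OF row row])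
      finally show ?thesis using src[of j] 2 unfolding al a by simp
    qed
    have D: "diag ?N i = (if i < j then diag M i
            else if i = j then cmp C (diag M j) (cmp C (bd A (vert C (diag M) j) (entry M j (Suc j))) (diag M (Suc j)))
            else diag M (Suc i))" if i: "1 \<le> i" "i \<le> n - 1" for i
    proof -
      have "diag M (Suc j) \<in> arrows C (rows.obs M ! Suc j) (rows.obs M ! j)" using arr[of "Suc j"] 2 by simp
      moreover have "bd A (rows.obs M ! j) (entry M j (Suc j)) \<in> arrows C (rows.obs M ! j) (rows.obs M ! j)"
        using entry_in[OF M, of j "Suc j"] arrow_ends[OF arr[of j]] 2 by (intro bd_in) auto
      ultimately show ?thesis
        using rl[of i] rr[of i] rj i 2 vert[of j] cmp_assoc[OF arr[of j]] unfolding diag_def[of ?N]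
        by (auto simp: diag_def[of M "Suc i"])
    qed
    have U: "entry ?N i k = (if i < j then
                (if k < j then entry M i k
                 else if k = j then entry M i j \<otimes>\<^bsub>fib A (vert C (diag M) i)\<^esub> entry M i (Suc j)
                 else entry M i (Suc k))
              else if i = j then
                pull A (eta C A (diag M) (entry M) j k) (entry M j (Suc k))
                  \<otimes>\<^bsub>fib A (vert C (diag M) (Suc j))\<^esub> entry M (Suc j) (Suc k)
              else entry M (Suc i) (Suc k))" if i: "1 \<le> i" "i < k" "k \<le> n - 1" for i k
    proof -
      consider "i < j" | "i = j" | "j < i" by linarith
      then show ?thesis
      proof cases
        assume ij: "i < j"
        have "entry ?N i k = contract (mult (fib A (rows.obs M ! i))) (j - Suc i) (?l i) ! (k - Suc i)"
          using rl[OF i(1) ij] by (simp add: entry_def)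
        also have "\<dots> = (if k - Suc i < j - Suc i then ?l i ! (k - Suc i)
            else if k - Suc i = j - Suc i then ?l i ! (j - Suc i) \<otimes>\<^bsub>fib A (rows.obs M ! i)\<^esub> ?l i ! Suc (j - Suc i)
            else ?l i ! Suc (k - Suc i))"
          using len[of i] i ij 2 by (intro contract_nth) auto
        finally show ?thesis using i ij 2 vert[of i] by (auto simp: entry_def Suc_diff_Suc)
      next
        assume ij: "i = j"
        let ?u = "rows.obs M ! Suc j" and ?b = "?l (Suc j)"
        have b: "diag M (Suc j) \<in> arrows C ?u (rows.obs M ! j)" "set ?b \<subseteq> carrier (fib A ?u)"
          using arr[of "Suc j"] entries_in[OF M, of "Suc j"] 2 by auto
        have l: "set l \<subseteq> carrier (fib A (rows.obs M ! j))" "length l = length ?b"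
          using entries_in[OF M, of j] len[of j] len[of "Suc j"] 2 al by auto
        have k: "k - Suc j < length ?b" using len[of "Suc j"] i ij 2 by simp
        have "map (entry M (Suc j)) [j + 2..<Suc k] = take (k - Suc j) ?b"
          using k i ij by (intro nth_equalityI) (auto simp: entry_def simp del: upt_Suc)
        then have e: "eta C A (diag M) (entry M) j k = cmp C (diag M (Suc j))
            (bd A ?u (foldr (mult (fib A ?u)) (take (k - Suc j) ?b) \<one>\<^bsub>fib A ?u\<^esub>))"
          using vert[of "Suc j"] 2 by (simp add: eta_def Let_def)
        have "l ! (k - Suc j) = ?l j ! Suc (k - Suc j)" unfolding al by simp
        also have "\<dots> = entry M j (Suc k)" using i ij by (simp add: entry_def Suc_diff_Suc)
        finally have "l ! (k - Suc j) = entry M j (Suc k)" .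
        moreover have "?b ! (k - Suc j) = entry M (Suc j) (Suc k)" by (simp add: entry_def)
        moreover have "entry ?N i k = twist (diag M (Suc j)) l ?b ! (k - Suc j)"
          using rj ij by (simp add: entry_def)
        ultimately show ?thesis
          using twist_nth[OF b(1) l(1) b(2) l(2) k] e ij vert[of "Suc j"] 2 by simp
      next
        assume "j < i"
        then show ?thesis using rr[of i] i 2 by (simp add: entry_def)
      qed
    qed
    show ?thesis
      unfolding mM mN nerve_face_mk_mat_inner[OF 2] mk_mat_eq_iff using D U by auto
  next
    case 3
    have "rows ?N ! (i - 1) = row_face (n - i) (rows M ! (i - 1))" if "1 \<le> i" "i \<le> n - 1" for i
      using rows.rows_chain_face[of n M "i - 1"] that dM n2 3 by auto
    then have r: "rows ?N ! (i - 1) =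
        (diag M i, contract (mult (fib A (rows.obs M ! i))) (n - Suc i) (snd (rows M ! (i - 1))))"
      if "1 \<le> i" "i \<le> n - 1" for i
      using that src[of i] row_eq[OF M, of i] row_face.simps(3)[of "n - Suc i" "diag M i" "snd (rows M ! (i - 1))"]
      by (simp add: Suc_diff_Suc)
    show ?thesis
      unfolding mM mN unfolding 3 nerve_face_mk_mat_outer(2)[OF n2] mk_mat_eq_iff
    proof (intro conjI allI impI)
      fix i assume "1 \<le> i \<and> i \<le> n - 1"
      then show "diag M i = diag (rows.chain_face n M) i" using r[of i] 3 by (simp add: diag_def)
    next
      fix i k assume h: "1 \<le> i \<and> i < k \<and> k \<le> n - 1"
      then have "i \<le> n" "length (snd (rows M ! (i - 1))) = n - i" using len[of i] by auto
      then have "contract (mult (fib A (rows.obs M ! i))) (n - Suc i) (snd (rows M ! (i - 1))) ! (k - Suc i)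
          = snd (rows M ! (i - 1)) ! (k - Suc i)"
        using h by (subst contract_nth) auto
      then show "entry M i k = entry (rows.chain_face n M) i k"
        using h r[of i] 3 by (simp add: entry_def)
    qed
  qed
qed

lemma matrix_degen:
  assumes M: "rows.chain_in n t M" and j: "j \<le> n"
  shows "nerve_degen C A n j (matrix M) = matrix (rows.chain_degen j M)"
proof (cases "n = 0")
  case True
  then show ?thesis
    using rows.chain_in_0D[of t M] M j by (auto simp: matrix_def mk_mat_eq_iff diag_def row_unit_def)
next
  case False
  then have n: "1 \<le> n" by simp
  note dM = chain_dim_eq[OF M] and vert = vert_diag[OF M n] and src = src_diag[OF M]
    and len = length_entries[OF M]
  have mM: "matrix M = mk_mat n (diag M) (entry M)" using n by (simp add: matrix_def dM)
  let ?N = "rows.chain_degen j M"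
  have mN: "matrix ?N = mk_mat (Suc n) (diag ?N) (entry ?N)" using j by (simp add: matrix_def dM)
  have rl: "rows ?N ! (i - 1) = (diag M i, insert_at (j - i) \<one>\<^bsub>fib A (rows.obs M ! i)\<^esub> (snd (rows M ! (i - 1))))"
    if i: "1 \<le> i" "i \<le> j" for i
  proof -
    have "rows ?N ! (i - 1) = row_degen (j - i) (rows M ! (i - 1))"
      using rows.rows_chain_degen[of j M "i - 1"] i j dM by (cases i) auto
    also have "rows M ! (i - 1) = (diag M i, snd (rows M ! (i - 1)))" by (rule row_eq[OF M])
    finally show ?thesis using src[of i] i j by simp
  qed
  have rj: "rows ?N ! j = (ident C (rows.obs M ! j), replicate (n - j) \<one>\<^bsub>fib A (rows.obs M ! j)\<^esub>)"
    using rows.rows_chain_degen[of j M j] j dM by (simp add: row_unit_def)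
  have rr: "rows ?N ! (i - 1) = rows M ! (i - 1 - 1)" if "Suc j < i" "i \<le> Suc n" for i
    using rows.rows_chain_degen[of j M "i - 1"] that j dM by (cases i) auto
  show ?thesis
    unfolding mM mN nerve_degen_mk_mat[OF n j] mk_mat_eq_iff
  proof (intro conjI allI impI; elim conjE)
    fix i assume i: "1 \<le> i" "i \<le> Suc n"
    consider "i \<le> j" | "i = Suc j" | "Suc j < i" by linarith
    then show "(if i \<le> j then diag M i else if i = Suc j then ident C (vert C (diag M) j) else diag M (i - 1)) = diag ?N i"
      using rl[of i] rj rr[of i] i j vert[of j] by cases (auto simp: diag_def)
  next
    fix i k assume i: "1 \<le> i" "i < k" "k \<le> Suc n"
    consider "i \<le> j" | "i = Suc j" | "Suc j < i" by linarith
    then show "(if i \<le> j then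
              (if k \<le> j then entry M i k
               else if k = Suc j then \<one>\<^bsub>fib A (vert C (diag M) i)\<^esub>
               else entry M i (k - 1))
            else if i = Suc j then \<one>\<^bsub>fib A (vert C (diag M) j)\<^esub>
            else entry M (i - 1) (k - 1)) = entry ?N i k"
    proof cases
      case 1
      have "insert_at (j - i) \<one>\<^bsub>fib A (rows.obs M ! i)\<^esub> (snd (rows M ! (i - 1))) ! (k - Suc i) =
         (if k - Suc i < j - i then snd (rows M ! (i - 1)) ! (k - Suc i)
          else if k - Suc i = j - i then \<one>\<^bsub>fib A (rows.obs M ! i)\<^esub>
          else snd (rows M ! (i - 1)) ! (k - Suc i - 1))"
        using len[of i] i j 1 by (intro insert_at_nth) auto
      then show ?thesis using rl[of i] i j vert[of i] 1 by (auto simp: entry_def)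
    next
      case 2
      then show ?thesis using rj i j vert[of j] by (simp add: entry_def)
    next
      case 3
      then show ?thesis using rr[of i] i by (simp add: entry_def)
    qed
  qed
qed

lemma bij_matrix: "bij_betw matrix (cells rows.chains n) (nerve_cells C A n)"
  unfolding bij_betw_def
proof
  show "inj_on matrix (cells rows.chains n)"
  proof (rule inj_onI)
    fix M M' assume "M \<in> cells rows.chains n" "M' \<in> cells rows.chains n" and e: "matrix M = matrix M'"
    then obtain t t' where M: "rows.chain_in n t M" and M': "rows.chain_in n t' M'" by auto
    note d = chain_dim_eq[OF M] chain_dim_eq[OF M']
    show "M = M'"
    proof (cases "n = 0")
      case True
      then have "M = Pt t" "M' = Pt t'" using M M' rows.chain_in_0D by auto
      then show ?thesis using e by (simp add: matrix_def)
    next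
      case False
      then have D: "\<And>i. 1 \<le> i \<and> i \<le> n \<Longrightarrow> diag M i = diag M' i"
        and U: "\<And>i k. 1 \<le> i \<and> i < k \<and> k \<le> n \<Longrightarrow> entry M i k = entry M' i k"
        using e d by (auto simp: matrix_def mk_mat_eq_iff)
      have "rows M = rows M'"
      proof (rule nth_equalityI)
        fix p assume "p < length (rows M)"
        then have p: "1 \<le> Suc p" "Suc p \<le> n" using d by auto
        have "snd (rows M ! (Suc p - 1)) = snd (rows M' ! (Suc p - 1))"
        proof (rule nth_equalityI)
          fix q assume "q < length (snd (rows M ! (Suc p - 1)))"
          then show "snd (rows M ! (Suc p - 1)) ! q = snd (rows M' ! (Suc p - 1)) ! q"
            using U[of "Suc p" "Suc (Suc p) + q"] length_entries[OF M p] by (simp add: entry_def)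
        qed (simp only: length_entries[OF M p] length_entries[OF M' p])
        then show "rows M ! p = rows M' ! p"
          using D[of "Suc p"] p row_eq[OF M, of "Suc p"] row_eq[OF M', of "Suc p"] by simp
      qed (simp add: d)
      moreover have "end_ob M = end_ob M'"
        using rows.chain_in_nth[OF M] rows.chain_in_nth[OF M'] src_diag[OF M, of n] src_diag[OF M', of n]
          D[of n] False by simp
      ultimately show ?thesis by (rule rows.chain_eqI)
    qed
  qed
next
  have "X \<in> matrix ` cells rows.chains n" if X: "X \<in> nerve_cells C A n" for X
  proof (cases "n = 0")
    case True
    with X obtain x where x: "x \<in> Obj C" "X = Vertex x" by (auto simp: nerve_cells_def)
    then have "X = matrix (Pt x)" by (simp add: matrix_def)
    moreover have "Pt x \<in> cells rows.chains n" using True rows.Pt_in[OF x(1)] by auto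
    ultimately show ?thesis by blast
  next
    case False
    from X obtain D U x where X': "X = mk_mat n D U"
      and x: "\<forall>i \<le> n. x i \<in> Obj C"
      and D: "\<forall>j. 1 \<le> j \<and> j \<le> n \<longrightarrow> D j \<in> arrows C (x j) (x (j - 1))"
      and U: "\<forall>i j. 1 \<le> i \<and> i < j \<and> j \<le> n \<longrightarrow> U i j \<in> carrier (fib A (x i))"
      unfolding nerve_cells_def if_not_P[OF False] by blast
    define r where "r = (\<lambda>i. (D (Suc i), map (U (Suc i)) [Suc (Suc i)..<Suc n]))"
    have "r i \<in> row_hom (n - Suc i) (x (Suc i)) (x i)" if "i < n" for i
      using that U D[rule_format, of "Suc i"] by (auto simp: r_def row_hom_def)
    from rows.chain_ex[OF x[rule_format] this] obtain M where M: "rows.chain_in n (x 0) M" "rows M = map r [0..<n]"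
      by blast
    have "Suc (Suc (k - 2)) = k" if "1 \<le> i" "i < k" for i k :: nat using that by simp
    then have "matrix M = X"
      using False by (auto simp: X' matrix_def chain_dim_eq[OF M(1)] mk_mat_eq_iff diag_def entry_def M(2) r_def
          simp del: upt_Suc)
    moreover have "M \<in> cells rows.chains n" using M(1) by auto
    ultimately show ?thesis by blast
  qed
  then show "matrix ` cells rows.chains n = nerve_cells C A n" using matrix_in by auto
qed

lemma nerve_sel: "cells (nerve C A) = nerve_cells C A" "face (nerve C A) = nerve_face C A"
  "degen (nerve C A) = nerve_degen C A"
  by (simp_all add: nerve_def)

lemma simplicial_nerve: "simplicial_set (nerve C A)"
proof (rule simplicial_set_transfer[OF rows.simplicial_chains])
  show "matrix ` cells rows.chains k = cells (nerve C A) k" for k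
    using bij_matrix[of k] by (simp add: nerve_sel bij_betw_def)
  show "face (nerve C A) k i (matrix M) = matrix (face rows.chains k i M)"
    if "1 \<le> k" "i \<le> k" "M \<in> cells rows.chains k" for k i M
    using that matrix_face unfolding nerve_sel rows.chains_sel by blast
  show "degen (nerve C A) k i (matrix M) = matrix (degen rows.chains k i M)"
    if "i \<le> k" "M \<in> cells rows.chains k" for k i M
    using that matrix_degen unfolding nerve_sel rows.chains_sel by blast
qed

text \<open>
  The corner \<open>m\<^sub>1\<^sub>n\<close> of a matrix is the only entry that neither \<open>d\<^sub>0\<close> nor \<open>d\<^sub>n\<close> shows, and for
  \<open>n \<ge> 4\<close> it is also the corner of \<open>d\<^sub>2\<close>.  For the compatibility conditions to see it, this is
  needed one dimension lower, whence \<open>m > 4\<close>.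
\<close>

lemma unique_filler_chains:
  assumes "4 < m" "compatible rows.chains m y"
  shows "unique_filler rows.chains m y"
proof (rule unique_filler_from_three_faces[OF rows.simplicial_chains order_refl assms])
  fix k M M' assume h: "4 \<le> k" "M \<in> cells rows.chains k" "M' \<in> cells rows.chains k"
    "face rows.chains k 0 M = face rows.chains k 0 M'" "face rows.chains k 2 M = face rows.chains k 2 M'"
    "face rows.chains k k M = face rows.chains k k M'"
  show "M = M'"
    by (rule rows.chain_eqI_three_faces[OF _ h(1-3)], (rule row_eqI_two_faces; assumption))
      (use h(4-6) in simp_all)
next
  show "\<exists>M \<in> cells rows.chains m. face rows.chains m 0 M = y 0 \<and> face rows.chains m 2 M = y 2 \<and>
      face rows.chains m m M = y m"
    unfolding rows.chains_sel(2)
    by (rule rows.chain_with_three_faces[OF _ _ assms(2)], (rule row_with_two_faces; assumption))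
      (use assms(1) in simp)
qed

end

theorem theorem4p1:
  fixes C :: "('o, 'm) cat" and A :: "('o, 'm, 'a) crossed"
  assumes "crossed_monoid C A"
  shows "coskeletal 4 (nerve C A)"
proof -
  interpret crossed_monoid C A by (rule assms)
  show ?thesis
  proof (rule coskeletalI[OF simplicial_nerve])
    fix m and y :: "nat \<Rightarrow> ('o, 'm, 'a) ncell" assume m: "4 < m" and y: "compatible (nerve C A) m y"
    show "unique_filler (nerve C A) m y"
    proof (rule unique_filler_transfer[OF rows.simplicial_chains _ _ _ unique_filler_chains[OF m] y])
      show "bij_betw matrix (cells rows.chains k) (cells (nerve C A) k)" for k
        by (simp add: nerve_sel bij_matrix)
      show "face (nerve C A) k i (matrix M) = matrix (face rows.chains k i M)"
        if "1 \<le> k" "i \<le> k" "M \<in> cells rows.chains k" for k i M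
        using that matrix_face unfolding nerve_sel rows.chains_sel by blast
    qed (use m in auto)
  qed
qed

end
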